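(* Let $\Lambda_R'$ be the proof system obtained from $\Lambda_R$ by removing the axiom schema $\odot^{\mathcal{S}}_\alpha\phi\to\neg\odot_\alpha\neg\phi$ (ConSO). Then $\Lambda_R'$ is sound and complete with respect to the class of bi-valued kiobt-models: for every formula $\phi$ of $\mathcal{L}_{\textsf{R}}$, $\phi$ is derivable in $\Lambda_R'$ iff $\phi$ is true at every index of every bi-valued kiobt-model.
   Context: \textbf{Language.} Fix a finite set $Ags$ of agents and a countable set $P$ of propositional variables. $\mathcal{L}_{\textsf{R}}$ is given by $\phi ::= p \mid \neg\phi\mid \phi\wedge\phi\mid \Box\phi\mid [\alpha]\phi\mid K_\alpha\phi\mid I_\alpha\phi\mid \odot_\alpha\phi\mid \odot^{\mathcal{S}}_\alpha\phi$ with $p\in P$, $\alpha\in Ags$; $\Diamond=\neg\Box\neg$. \textbf{Frames.} A bi-valued kiobt-frame is a tuple $\langle M,\sqsubset,Ags,\mathbf{Choice},\{\sim_\alpha\}_{\alpha\in Ags},\tau,\mathbf{Value}_{\mathcal{O}},\mathbf{Value}_{\mathcal{S}}\rangle$ where: $M$ is a nonempty set of moments and $\sqsubset$ a strict partial order on $M$ with no backward branching. A history is a maximal $\sqsubset$-chain; $H$ is the set of histories, $H_m=\{h\in H:m\in h\}$; indices are pairs $\langle m,h\rangle$ with $m\in h$. $\mathbf{Choice}$ assigns to each $\alpha$ and $m$ a partition $\mathbf{Choice}^m_\alpha$ of $H_m$; $\mathbf{Choice}^m_\alpha(h)$ is the cell of $h$. Constraints: (NC) if $h,h'\in H_m$ and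 $m'\in h\cap h'$ for some $m'\sqsupset m$, then $h,h'$ lie in the same cell of every $\mathbf{Choice}^m_\alpha$; (IA) for every $m$ and every selection function $s$ with $s(\alpha)\in\mathbf{Choice}^m_\alpha$, $\bigcap_\alpha s(\alpha)\neq\emptyset$ (set of these: $\mathbf{Select}^m$). Each $\sim_\alpha$ is an equivalence relation on indices with (OAC) if $\langle m_*,h_*\rangle\sim_\alpha\langle m,h\rangle$ then $\langle m_*,h_*'\rangle\sim_\alpha\langle m,h\rangle$ for all $h_*'\in\mathbf{Choice}^{m_*}_\alpha(h_* )$; (Unif-H) if $\langle m_*,h_*\rangle\sim_\alpha\langle m,h\rangle$ then for every $h_*'\in H_{m_*}$ there is $h'\in H_m$ with $\langle m_*,h_*'\rangle\sim_\alpha\langle m,h'\rangle$. Let $\pi^\Box_\alpha[\langle m,h\rangle]=\{\langle m',h'\rangle:\exists h''\in H_{m'},\ \langle m,h\rangle\sim_\alpha\langle m',h''\rangle\}$. $\tau$ assigns to each $\alpha$ and index $\langle m,h\rangle$ a topology $\tau^{\langle m,h\rangle}_\alpha$ on $\pi^\Box_\alpha[\langle m,h\rangle]$ such that (CI) any two nonempty open sets intersect, and (KI) $\tau^{\langle m,h\rangle}_\alpha=\tau^{\langle m',h'\rangle}_\alpha$ whenever $\pi^\Box_\alpha[\langle m,h\rangle]=\pi^\Box_\alpha[\langle m',h'\rangle]$. $\mathbf{Value}_{\mathcal{O}},\mathbf{Value}_{\mathcal{S}}:H\to\mathbb{R}$ are arbitrary independent functions. A bi-valued kiobt-model adds a valuation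 $\mathcal{V}:P\to2^{\text{indices}}$. \textbf{Orderings.} $\mathbf{State}^m_\beta=\{\bigcap_{\alpha\neq\beta}s(\alpha):s\in\mathbf{Select}^m\}$. For $X,Y\subseteq H$: $X\le Y$ iff $\mathbf{Value}_{\mathcal{O}}(h)\le\mathbf{Value}_{\mathcal{O}}(h')$ for all $h\in X,h'\in Y$; $X\le_s Y$ likewise with $\mathbf{Value}_{\mathcal{S}}$. For $L,L'\in\mathbf{Choice}^m_\alpha$: $L\preceq L'$ iff $L\cap S\le L'\cap S$ for all $S\in\mathbf{State}^m_\alpha$. Write $m\sim_\alpha m'$ iff $\langle m,h\rangle\sim_\alpha\langle m',h'\rangle$ for some $h,h'$. For $L\subseteq H_m$, $[L]^{m'}_\alpha=\{h'\in H_{m'}:\exists h\in L,\ \langle m,h\rangle\sim_\alpha\langle m',h'\rangle\}$. $L\preceq_s L'$ iff for every $m'$ with $m\sim_\alpha m'$ and every $S\in\mathbf{State}^{m'}_\alpha$, $[L]^{m'}_\alpha\cap S\le_s[L']^{m'}_\alpha\cap S$. Strict versions $\prec,\prec_s$ as usual. \textbf{Semantics.} With $|\phi|^m=\{h\in H_m:\mathcal{M},\langle m,h\rangle\models\phi\}$ and $\|\phi\|$ the set of indices satisfying $\phi$: atoms, Booleans standard; $\Box\phi$: $\phi$ at $\langle m,h'\rangle$ for all $h'\in H_m$; $[\alpha]\phi$: $\phi$ at $\langle m,h'\rangle$ for all $h'\in\mathbf{Choice}^m_\alpha(h)$; $K_\alpha\phi$: $\phi$ at all $\sim_\alpha$-related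 indices; $I_\alpha\phi$: there is a nonempty $U\in\tau^{\langle m,h\rangle}_\alpha$ with $U\subseteq\|\phi\|$; $\odot_\alpha\phi$ at $\langle m,h\rangle$ iff for every $L\in\mathbf{Choice}^m_\alpha$ with $L\not\subseteq|\phi|^m$ there is $L'\in\mathbf{Choice}^m_\alpha$ with $L\prec L'$ such that every $L''$ with $L''=L'$ or $L'\preceq L''$ satisfies $L''\subseteq|\phi|^m$; $\odot^{\mathcal{S}}_\alpha\phi$ at $\langle m,h\rangle$ iff for every $L\in\mathbf{Choice}^m_\alpha$ with $[L]^{m'}_\alpha\not\subseteq|\phi|^{m'}$ for some $m'$ with $m\sim_\alpha m'$, there is $L'$ with $L\prec_s L'$ such that every $L''$ with $L''=L'$ or $L'\preceq_s L''$ satisfies $[L'']^{m''}_\alpha\subseteq|\phi|^{m''}$ for all $m''$ with $m\sim_\alpha m''$. \textbf{Proof system $\Lambda_R$.} Axioms: propositional tautologies; S5 for $\Box$, $[\alpha]$, $K_\alpha$; KD for $I_\alpha$; $\Box\phi\to[\alpha]\phi$; for distinct $\alpha_1,\dots,\alpha_k$, $\bigwedge_i\Diamond[\alpha_i]\phi_i\to\Diamond\bigwedge_i[\alpha_i]\phi_i$; $K_\alpha\phi\to[\alpha]\phi$; $\Diamond K_\alpha\phi\to K_\alpha\Diamond\phi$; $\odot_\alpha(\phi\to\psi)\to(\odot_\alpha\phi\to\odot_\alpha\psi)$; $\Box\phi\to\odot_\alpha\phi$; $\odot_\alpha\phi\to\Box\odot_\alpha\phi$; $\odot_\alpha\phi\to\odot_\alpha[\alpha]\phi$;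 $\odot_\alpha\phi\to\Diamond[\alpha]\phi$; $\odot^{\mathcal{S}}_\alpha(\phi\to\psi)\to(\odot^{\mathcal{S}}_\alpha\phi\to\odot^{\mathcal{S}}_\alpha\psi)$; $\odot^{\mathcal{S}}_\alpha\phi\to\odot^{\mathcal{S}}_\alpha K_\alpha\phi$; $K_\alpha\Box\phi\to\odot^{\mathcal{S}}_\alpha\phi$; $\odot^{\mathcal{S}}_\alpha\phi\to\Diamond K_\alpha\phi$; $\odot^{\mathcal{S}}_\alpha\phi\to K_\alpha\Box\odot^{\mathcal{S}}_\alpha\phi$; $\odot^{\mathcal{S}}_\alpha\phi\to\neg\odot_\alpha\neg\phi$ (ConSO); $\Box K_\alpha\phi\to I_\alpha\phi$; $I_\alpha\phi\to\Box K_\alpha I_\alpha\phi$. Rules: modus ponens, uniform substitution, necessitation for every modal operator. *)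

theory Defs
  imports "HOL-Analysis.Abstract_Topology" "HOL-Library.Disjoint_Sets" "HOL-Library.Countable"
begin

section \<open>Language\<close>

text \<open>Agents are the elements of a type \<open>'a\<close> and propositional variables those of a type \<open>'p\<close>;
  the theorem takes \<open>'a\<close> finite and \<open>'p\<close> countable.\<close>

datatype ('p, 'a) fm =
    Atom 'p
  | Neg "('p, 'a) fm"
  | Conj "('p, 'a) fm" "('p, 'a) fm"
  | Box "('p, 'a) fm"
  | Stit 'a "('p, 'a) fm"      \<comment> \<open>\<open>[\<alpha>]\<phi>\<close>\<close>
  | Know 'a "('p, 'a) fm"      \<comment> \<open>\<open>K\<^sub>\<alpha>\<phi>\<close>\<close>
  | Bel 'a "('p, 'a) fm"       \<comment> \<open>\<open>I\<^sub>\<alpha>\<phi>\<close>\<close>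
  | Ought 'a "('p, 'a) fm"     \<comment> \<open>\<open>\<odot>\<^sub>\<alpha>\<phi>\<close>\<close>
  | SOught 'a "('p, 'a) fm"    \<comment> \<open>\<open>\<odot>\<close> with superscript \<open>\<S>\<close>\<close>

abbreviation Imp :: "('p, 'a) fm \<Rightarrow> ('p, 'a) fm \<Rightarrow> ('p, 'a) fm" where
  "Imp \<phi> \<psi> \<equiv> Neg (Conj \<phi> (Neg \<psi>))"

abbreviation Dia :: "('p, 'a) fm \<Rightarrow> ('p, 'a) fm" where
  "Dia \<phi> \<equiv> Neg (Box (Neg \<phi>))"

text \<open>Finite conjunction. The language has no primitive verum, so the value at \<open>[]\<close> is irrelevant;
  only nonempty lists are used.\<close>

fun BigConj :: "('p, 'a) fm list \<Rightarrow> ('p, 'a) fm" where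
  "BigConj [] = undefined"
| "BigConj [\<phi>] = \<phi>"
| "BigConj (\<phi> # \<psi> # \<phi>s) = Conj \<phi> (BigConj (\<psi> # \<phi>s))"

primrec subst_fm :: "('p \<Rightarrow> ('p, 'a) fm) \<Rightarrow> ('p, 'a) fm \<Rightarrow> ('p, 'a) fm" where
  "subst_fm \<sigma> (Atom p) = \<sigma> p"
| "subst_fm \<sigma> (Neg \<phi>) = Neg (subst_fm \<sigma> \<phi>)"
| "subst_fm \<sigma> (Conj \<phi> \<psi>) = Conj (subst_fm \<sigma> \<phi>) (subst_fm \<sigma> \<psi>)"
| "subst_fm \<sigma> (Box \<phi>) = Box (subst_fm \<sigma> \<phi>)"
| "subst_fm \<sigma> (Stit \<alpha> \<phi>) = Stit \<alpha> (subst_fm \<sigma> \<phi>)"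
| "subst_fm \<sigma> (Know \<alpha> \<phi>) = Know \<alpha> (subst_fm \<sigma> \<phi>)"
| "subst_fm \<sigma> (Bel \<alpha> \<phi>) = Bel \<alpha> (subst_fm \<sigma> \<phi>)"
| "subst_fm \<sigma> (Ought \<alpha> \<phi>) = Ought \<alpha> (subst_fm \<sigma> \<phi>)"
| "subst_fm \<sigma> (SOught \<alpha> \<phi>) = SOught \<alpha> (subst_fm \<sigma> \<phi>)"


section \<open>Frames and models\<close>

text \<open>A history is a set of moments, and an index \<open>\<langle>m, h\<rangle>\<close> is a pair.\<close>

type_synonym 'm index = "'m \<times> 'm set"

record ('m, 'a) frame =
  Mom :: "'m set"
  prec :: "'m \<Rightarrow> 'm \<Rightarrow> bool"
  Choice :: "'a \<Rightarrow> 'm \<Rightarrow> 'm set set set"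
  Indist :: "'a \<Rightarrow> ('m index \<times> 'm index) set"
  Topol :: "'a \<Rightarrow> 'm index \<Rightarrow> 'm index topology"
  Value_O :: "'m set \<Rightarrow> real"
  Value_S :: "'m set \<Rightarrow> real"

record ('m, 'a, 'p) model = "('m, 'a) frame" +
  Val :: "'p \<Rightarrow> 'm index set"

definition histories :: "('m, 'a, 'z) frame_scheme \<Rightarrow> 'm set set" where
  "histories F = {h. pred_on.maxchain (Mom F) (prec F) h}"

definition hists_at :: "('m, 'a, 'z) frame_scheme \<Rightarrow> 'm \<Rightarrow> 'm set set" where
  "hists_at F m = {h \<in> histories F. m \<in> h}"

definition indices :: "('m, 'a, 'z) frame_scheme \<Rightarrow> 'm index set" where
  "indices F = {(m, h). m \<in> Mom F \<and> h \<in> hists_at F m}"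

definition choice_cell :: "('m, 'a, 'z) frame_scheme \<Rightarrow> 'a \<Rightarrow> 'm \<Rightarrow> 'm set \<Rightarrow> 'm set set" where
  "choice_cell F \<alpha> m h = (THE L. L \<in> Choice F \<alpha> m \<and> h \<in> L)"

definition Select :: "('m, 'a, 'z) frame_scheme \<Rightarrow> 'm \<Rightarrow> ('a \<Rightarrow> 'm set set) set" where
  "Select F m = {s. \<forall>\<alpha>. s \<alpha> \<in> Choice F \<alpha> m}"

definition ex_ante_info :: "('m, 'a, 'z) frame_scheme \<Rightarrow> 'a \<Rightarrow> 'm index \<Rightarrow> 'm index set" where
  "ex_ante_info F \<alpha> i =
    {(m', h'). (m', h') \<in> indices F \<and> (\<exists>h''\<in>hists_at F m'. (i, (m', h'')) \<in> Indist F \<alpha>)}"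

definition branching_time :: "('m, 'a, 'z) frame_scheme \<Rightarrow> bool" where
  "branching_time F \<longleftrightarrow>
    Mom F \<noteq> {} \<and> irreflp_on (Mom F) (prec F) \<and> transp_on (Mom F) (prec F) \<and>
    (\<forall>m\<in>Mom F. \<forall>m1\<in>Mom F. \<forall>m2\<in>Mom F.
      prec F m1 m \<and> prec F m2 m \<longrightarrow> prec F m1 m2 \<or> m1 = m2 \<or> prec F m2 m1)"

definition cond_NC :: "('m, 'a, 'z) frame_scheme \<Rightarrow> bool" where
  "cond_NC F \<longleftrightarrow>
    (\<forall>m\<in>Mom F. \<forall>h\<in>hists_at F m. \<forall>h'\<in>hists_at F m.
      (\<exists>m'\<in>h \<inter> h'. prec F m m') \<longrightarrow> (\<forall>\<alpha>. choice_cell F \<alpha> m h = choice_cell F \<alpha> m h'))"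

definition cond_IA :: "('m, 'a, 'z) frame_scheme \<Rightarrow> bool" where
  "cond_IA F \<longleftrightarrow> (\<forall>m\<in>Mom F. \<forall>s\<in>Select F m. (\<Inter>\<alpha>. s \<alpha>) \<noteq> {})"

definition cond_OAC :: "('m, 'a, 'z) frame_scheme \<Rightarrow> bool" where
  "cond_OAC F \<longleftrightarrow>
    (\<forall>\<alpha> m1 h1 m h. ((m1, h1), (m, h)) \<in> Indist F \<alpha> \<longrightarrow>
      (\<forall>h1'\<in>choice_cell F \<alpha> m1 h1. ((m1, h1'), (m, h)) \<in> Indist F \<alpha>))"

definition cond_UnifH :: "('m, 'a, 'z) frame_scheme \<Rightarrow> bool" where
  "cond_UnifH F \<longleftrightarrow>
    (\<forall>\<alpha> m1 h1 m h. ((m1, h1), (m, h)) \<in> Indist F \<alpha> \<longrightarrow>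
      (\<forall>h1'\<in>hists_at F m1. \<exists>h'\<in>hists_at F m. ((m1, h1'), (m, h')) \<in> Indist F \<alpha>))"

definition cond_CI :: "('m, 'a, 'z) frame_scheme \<Rightarrow> bool" where
  "cond_CI F \<longleftrightarrow>
    (\<forall>\<alpha>. \<forall>i\<in>indices F. \<forall>U V.
      openin (Topol F \<alpha> i) U \<and> openin (Topol F \<alpha> i) V \<and> U \<noteq> {} \<and> V \<noteq> {} \<longrightarrow> U \<inter> V \<noteq> {})"

definition cond_KI :: "('m, 'a, 'z) frame_scheme \<Rightarrow> bool" where
  "cond_KI F \<longleftrightarrow>
    (\<forall>\<alpha>. \<forall>i\<in>indices F. \<forall>j\<in>indices F.
      ex_ante_info F \<alpha> i = ex_ante_info F \<alpha> j \<longrightarrow> Topol F \<alpha> i = Topol F \<alpha> j)"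

definition kiobt_frame :: "('m, 'a, 'z) frame_scheme \<Rightarrow> bool" where
  "kiobt_frame F \<longleftrightarrow>
    branching_time F \<and>
    (\<forall>\<alpha>. \<forall>m\<in>Mom F. partition_on (hists_at F m) (Choice F \<alpha> m)) \<and>
    cond_NC F \<and> cond_IA F \<and>
    (\<forall>\<alpha>. equiv (indices F) (Indist F \<alpha>)) \<and>
    cond_OAC F \<and> cond_UnifH F \<and>
    (\<forall>\<alpha>. \<forall>i\<in>indices F. topspace (Topol F \<alpha> i) = ex_ante_info F \<alpha> i) \<and>
    cond_CI F \<and> cond_KI F"

definition kiobt_model :: "('m, 'a, 'p) model \<Rightarrow> bool" where
  "kiobt_model \<M> \<longleftrightarrow> kiobt_frame \<M> \<and> (\<forall>p. Val \<M> p \<subseteq> indices \<M>)"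


section \<open>Orderings\<close>

text \<open>Intersecting with \<open>hists_at F m\<close> only matters when \<open>\<beta>\<close> is the sole agent: the empty
  intersection is then taken within \<open>H\<^sub>m\<close>.\<close>

definition State :: "('m, 'a, 'z) frame_scheme \<Rightarrow> 'a \<Rightarrow> 'm \<Rightarrow> 'm set set set" where
  "State F \<beta> m = {hists_at F m \<inter> (\<Inter>\<alpha>\<in>- {\<beta>}. s \<alpha>) | s. s \<in> Select F m}"

definition val_le :: "('m set \<Rightarrow> real) \<Rightarrow> 'm set set \<Rightarrow> 'm set set \<Rightarrow> bool" where
  "val_le v X Y \<longleftrightarrow> (\<forall>h\<in>X. \<forall>h'\<in>Y. v h \<le> v h')"

definition dom_le :: "('m, 'a, 'z) frame_scheme \<Rightarrow> 'a \<Rightarrow> 'm \<Rightarrow> 'm set set \<Rightarrow> 'm set set \<Rightarrow> bool" where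
  "dom_le F \<alpha> m L L' \<longleftrightarrow> (\<forall>S\<in>State F \<alpha> m. val_le (Value_O F) (L \<inter> S) (L' \<inter> S))"

definition dom_less :: "('m, 'a, 'z) frame_scheme \<Rightarrow> 'a \<Rightarrow> 'm \<Rightarrow> 'm set set \<Rightarrow> 'm set set \<Rightarrow> bool" where
  "dom_less F \<alpha> m L L' \<longleftrightarrow> dom_le F \<alpha> m L L' \<and> \<not> dom_le F \<alpha> m L' L"

definition mom_indist :: "('m, 'a, 'z) frame_scheme \<Rightarrow> 'a \<Rightarrow> 'm \<Rightarrow> 'm \<Rightarrow> bool" where
  "mom_indist F \<alpha> m m' \<longleftrightarrow> (\<exists>h h'. ((m, h), (m', h')) \<in> Indist F \<alpha>)"

text \<open>\<open>epi_cluster F \<alpha> m L m'\<close> is the epistemic cluster of \<open>L \<subseteq> H\<^sub>m\<close> at \<open>m'\<close>.\<close>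

definition epi_cluster :: "('m, 'a, 'z) frame_scheme \<Rightarrow> 'a \<Rightarrow> 'm \<Rightarrow> 'm set set \<Rightarrow> 'm \<Rightarrow> 'm set set" where
  "epi_cluster F \<alpha> m L m' = {h' \<in> hists_at F m'. \<exists>h\<in>L. ((m, h), (m', h')) \<in> Indist F \<alpha>}"

definition sdom_le :: "('m, 'a, 'z) frame_scheme \<Rightarrow> 'a \<Rightarrow> 'm \<Rightarrow> 'm set set \<Rightarrow> 'm set set \<Rightarrow> bool" where
  "sdom_le F \<alpha> m L L' \<longleftrightarrow>
    (\<forall>m'. mom_indist F \<alpha> m m' \<longrightarrow>
      (\<forall>S\<in>State F \<alpha> m'.
        val_le (Value_S F) (epi_cluster F \<alpha> m L m' \<inter> S) (epi_cluster F \<alpha> m L' m' \<inter> S)))"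

definition sdom_less :: "('m, 'a, 'z) frame_scheme \<Rightarrow> 'a \<Rightarrow> 'm \<Rightarrow> 'm set set \<Rightarrow> 'm set set \<Rightarrow> bool" where
  "sdom_less F \<alpha> m L L' \<longleftrightarrow> sdom_le F \<alpha> m L L' \<and> \<not> sdom_le F \<alpha> m L' L"


section \<open>Semantics\<close>

primrec sat :: "('m, 'a, 'p) model \<Rightarrow> 'm \<Rightarrow> 'm set \<Rightarrow> ('p, 'a) fm \<Rightarrow> bool" where
  "sat \<M> m h (Atom p) \<longleftrightarrow> (m, h) \<in> Val \<M> p"
| "sat \<M> m h (Neg \<phi>) \<longleftrightarrow> \<not> sat \<M> m h \<phi>"
| "sat \<M> m h (Conj \<phi> \<psi>) \<longleftrightarrow> sat \<M> m h \<phi> \<and> sat \<M> m h \<psi>"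
| "sat \<M> m h (Box \<phi>) \<longleftrightarrow> (\<forall>h'\<in>hists_at \<M> m. sat \<M> m h' \<phi>)"
| "sat \<M> m h (Stit \<alpha> \<phi>) \<longleftrightarrow> (\<forall>h'\<in>choice_cell \<M> \<alpha> m h. sat \<M> m h' \<phi>)"
| "sat \<M> m h (Know \<alpha> \<phi>) \<longleftrightarrow>
    (\<forall>m' h'. ((m, h), (m', h')) \<in> Indist \<M> \<alpha> \<longrightarrow> sat \<M> m' h' \<phi>)"
| "sat \<M> m h (Bel \<alpha> \<phi>) \<longleftrightarrow>
    (\<exists>U. openin (Topol \<M> \<alpha> (m, h)) U \<and> U \<noteq> {} \<and>
         U \<subseteq> {(m', h'). (m', h') \<in> indices \<M> \<and> sat \<M> m' h' \<phi>})"
| "sat \<M> m h (Ought \<alpha> \<phi>) \<longleftrightarrow>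
    (\<forall>L\<in>Choice \<M> \<alpha> m. \<not> L \<subseteq> {g \<in> hists_at \<M> m. sat \<M> m g \<phi>} \<longrightarrow>
      (\<exists>L'\<in>Choice \<M> \<alpha> m. dom_less \<M> \<alpha> m L L' \<and>
        (\<forall>L''\<in>Choice \<M> \<alpha> m. L'' = L' \<or> dom_le \<M> \<alpha> m L' L'' \<longrightarrow>
          L'' \<subseteq> {g \<in> hists_at \<M> m. sat \<M> m g \<phi>})))"
| "sat \<M> m h (SOught \<alpha> \<phi>) \<longleftrightarrow>
    (\<forall>L\<in>Choice \<M> \<alpha> m.
      (\<exists>m'. mom_indist \<M> \<alpha> m m' \<and>
        \<not> epi_cluster \<M> \<alpha> m L m' \<subseteq> {g \<in> hists_at \<M> m'. sat \<M> m' g \<phi>}) \<longrightarrow>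
      (\<exists>L'\<in>Choice \<M> \<alpha> m. sdom_less \<M> \<alpha> m L L' \<and>
        (\<forall>L''\<in>Choice \<M> \<alpha> m. L'' = L' \<or> sdom_le \<M> \<alpha> m L' L'' \<longrightarrow>
          (\<forall>m''. mom_indist \<M> \<alpha> m m'' \<longrightarrow>
            epi_cluster \<M> \<alpha> m L'' m'' \<subseteq> {g \<in> hists_at \<M> m''. sat \<M> m'' g \<phi>}))))"

text \<open>Truth at every index of every bi-valued kiobt-model whose moments are drawn from the type
  \<open>'m\<close>. HOL cannot quantify over types inside a formula, so the type of moments is a parameter.\<close>

definition valid_over :: "'m itself \<Rightarrow> ('p, 'a) fm \<Rightarrow> bool" where
  "valid_over _ \<phi> \<longleftrightarrow>
    (\<forall>\<M> :: ('m, 'a, 'p) model. kiobt_model \<M> \<longrightarrow> (\<forall>(m, h)\<in>indices \<M>. sat \<M> m h \<phi>))"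


section \<open>Proof systems\<close>

text \<open>A formula is a propositional tautology if it is true under every assignment of truth values
  that treats the atoms and the formulas headed by a modal operator as propositional letters.\<close>

primrec prop_eval :: "(('p, 'a) fm \<Rightarrow> bool) \<Rightarrow> ('p, 'a) fm \<Rightarrow> bool" where
  "prop_eval v (Atom p) \<longleftrightarrow> v (Atom p)"
| "prop_eval v (Neg \<phi>) \<longleftrightarrow> \<not> prop_eval v \<phi>"
| "prop_eval v (Conj \<phi> \<psi>) \<longleftrightarrow> prop_eval v \<phi> \<and> prop_eval v \<psi>"
| "prop_eval v (Box \<phi>) \<longleftrightarrow> v (Box \<phi>)"
| "prop_eval v (Stit \<alpha> \<phi>) \<longleftrightarrow> v (Stit \<alpha> \<phi>)"
| "prop_eval v (Know \<alpha> \<phi>) \<longleftrightarrow> v (Know \<alpha> \<phi>)"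
| "prop_eval v (Bel \<alpha> \<phi>) \<longleftrightarrow> v (Bel \<alpha> \<phi>)"
| "prop_eval v (Ought \<alpha> \<phi>) \<longleftrightarrow> v (Ought \<alpha> \<phi>)"
| "prop_eval v (SOught \<alpha> \<phi>) \<longleftrightarrow> v (SOught \<alpha> \<phi>)"

definition tautology :: "('p, 'a) fm \<Rightarrow> bool" where
  "tautology \<phi> \<longleftrightarrow> (\<forall>v. prop_eval v \<phi>)"

definition K_axioms :: "(('p, 'a) fm \<Rightarrow> ('p, 'a) fm) \<Rightarrow> ('p, 'a) fm set" where
  "K_axioms N = {Imp (N (Imp \<phi> \<psi>)) (Imp (N \<phi>) (N \<psi>)) | \<phi> \<psi>. True}"

definition S5_axioms :: "(('p, 'a) fm \<Rightarrow> ('p, 'a) fm) \<Rightarrow> ('p, 'a) fm set" where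
  "S5_axioms N = K_axioms N \<union>
    {Imp (N \<phi>) \<phi> | \<phi>. True} \<union>
    {Imp (N \<phi>) (N (N \<phi>)) | \<phi>. True} \<union>
    {Imp (Neg (N \<phi>)) (N (Neg (N \<phi>))) | \<phi>. True}"

definition KD_axioms :: "(('p, 'a) fm \<Rightarrow> ('p, 'a) fm) \<Rightarrow> ('p, 'a) fm set" where
  "KD_axioms N = K_axioms N \<union> {Imp (N \<phi>) (Neg (N (Neg \<phi>))) | \<phi>. True}"

text \<open>The axioms of \<open>\<Lambda>\<^sub>R\<close> other than ConSO. In \<open>indep\<close>, the list \<open>ps\<close> pairs the distinct agents
  \<open>\<alpha>\<^sub>i\<close> with the formulas \<open>\<phi>\<^sub>i\<close>.\<close>

inductive_set axioms_R' :: "('p, 'a) fm set" where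
  taut: "tautology \<phi> \<Longrightarrow> \<phi> \<in> axioms_R'"
| S5_Box: "\<phi> \<in> S5_axioms Box \<Longrightarrow> \<phi> \<in> axioms_R'"
| S5_Stit: "\<phi> \<in> S5_axioms (Stit \<alpha>) \<Longrightarrow> \<phi> \<in> axioms_R'"
| S5_Know: "\<phi> \<in> S5_axioms (Know \<alpha>) \<Longrightarrow> \<phi> \<in> axioms_R'"
| KD_Bel: "\<phi> \<in> KD_axioms (Bel \<alpha>) \<Longrightarrow> \<phi> \<in> axioms_R'"
| Box_Stit: "Imp (Box \<phi>) (Stit \<alpha> \<phi>) \<in> axioms_R'"
| indep: "ps \<noteq> [] \<Longrightarrow> distinct (map fst ps) \<Longrightarrow>
    Imp (BigConj (map (\<lambda>(\<alpha>, \<phi>). Dia (Stit \<alpha> \<phi>)) ps))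
        (Dia (BigConj (map (\<lambda>(\<alpha>, \<phi>). Stit \<alpha> \<phi>) ps))) \<in> axioms_R'"
| Know_Stit: "Imp (Know \<alpha> \<phi>) (Stit \<alpha> \<phi>) \<in> axioms_R'"
| Unif: "Imp (Dia (Know \<alpha> \<phi>)) (Know \<alpha> (Dia \<phi>)) \<in> axioms_R'"
| K_Ought: "\<phi> \<in> K_axioms (Ought \<alpha>) \<Longrightarrow> \<phi> \<in> axioms_R'"
| Box_Ought: "Imp (Box \<phi>) (Ought \<alpha> \<phi>) \<in> axioms_R'"
| Ought_Box: "Imp (Ought \<alpha> \<phi>) (Box (Ought \<alpha> \<phi>)) \<in> axioms_R'"
| Ought_Stit: "Imp (Ought \<alpha> \<phi>) (Ought \<alpha> (Stit \<alpha> \<phi>)) \<in> axioms_R'"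
| Ought_Can: "Imp (Ought \<alpha> \<phi>) (Dia (Stit \<alpha> \<phi>)) \<in> axioms_R'"
| K_SOught: "\<phi> \<in> K_axioms (SOught \<alpha>) \<Longrightarrow> \<phi> \<in> axioms_R'"
| SOught_Know: "Imp (SOught \<alpha> \<phi>) (SOught \<alpha> (Know \<alpha> \<phi>)) \<in> axioms_R'"
| KBox_SOught: "Imp (Know \<alpha> (Box \<phi>)) (SOught \<alpha> \<phi>) \<in> axioms_R'"
| SOught_Can: "Imp (SOught \<alpha> \<phi>) (Dia (Know \<alpha> \<phi>)) \<in> axioms_R'"
| SOught_KBox: "Imp (SOught \<alpha> \<phi>) (Know \<alpha> (Box (SOught \<alpha> \<phi>))) \<in> axioms_R'"
| BoxK_Bel: "Imp (Box (Know \<alpha> \<phi>)) (Bel \<alpha> \<phi>) \<in> axioms_R'"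
| Bel_BoxK: "Imp (Bel \<alpha> \<phi>) (Box (Know \<alpha> (Bel \<alpha> \<phi>))) \<in> axioms_R'"

definition ConSO :: "('p, 'a) fm set" where
  "ConSO = {Imp (SOught \<alpha> \<phi>) (Neg (Ought \<alpha> (Neg \<phi>))) | \<alpha> \<phi>. True}"

definition axioms_R :: "('p, 'a) fm set" where
  "axioms_R = axioms_R' \<union> ConSO"

inductive derivable_from :: "('p, 'a) fm set \<Rightarrow> ('p, 'a) fm \<Rightarrow> bool" for Ax where
  ax: "\<phi> \<in> Ax \<Longrightarrow> derivable_from Ax \<phi>"
| MP: "derivable_from Ax (Imp \<phi> \<psi>) \<Longrightarrow> derivable_from Ax \<phi> \<Longrightarrow> derivable_from Ax \<psi>"
| US: "derivable_from Ax \<phi> \<Longrightarrow> derivable_from Ax (subst_fm \<sigma> \<phi>)"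
| nec_Box: "derivable_from Ax \<phi> \<Longrightarrow> derivable_from Ax (Box \<phi>)"
| nec_Stit: "derivable_from Ax \<phi> \<Longrightarrow> derivable_from Ax (Stit \<alpha> \<phi>)"
| nec_Know: "derivable_from Ax \<phi> \<Longrightarrow> derivable_from Ax (Know \<alpha> \<phi>)"
| nec_Bel: "derivable_from Ax \<phi> \<Longrightarrow> derivable_from Ax (Bel \<alpha> \<phi>)"
| nec_Ought: "derivable_from Ax \<phi> \<Longrightarrow> derivable_from Ax (Ought \<alpha> \<phi>)"
| nec_SOught: "derivable_from Ax \<phi> \<Longrightarrow> derivable_from Ax (SOught \<alpha> \<phi>)"

abbreviation derivable_R :: "('p, 'a) fm \<Rightarrow> bool" where
  "derivable_R \<equiv> derivable_from axioms_R"

abbreviation derivable_R' :: "('p, 'a) fm \<Rightarrow> bool" where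
  "derivable_R' \<equiv> derivable_from axioms_R'"

text \<open>The type of moments over which completeness is stated. It has the cardinality of the
  continuum, hence that of the set of all sets of formulas when \<open>'p\<close> is countable and \<open>'a\<close> is
  finite, so it has room for a model built from maximal consistent sets. Completeness
  with respect to models over one type is at least as strong as completeness with respect to the
  class of all models.\<close>

type_synonym universe = "nat set"

end

theory Submission
  imports Defs
begin

text \<open>For completeness, the maximal consistent sets are the worlds of a branching-time model in which
  each class of the canonical relation of \<open>\<box>\<close> is a moment, with one history through it for every member of
  the class. Let \<open>O\<^sub>\<alpha>\<close> be the set of worlds that satisfy every \<open>\<phi>\<close> with \<open>\<odot>\<^sub>\<alpha>\<phi>\<close>. This set is a union of
  choice cells of \<open>\<alpha>\<close>, so if the value of a history is the number of agents \<open>\<alpha>\<close> with the history in \<open>O\<^sub>\<alpha>\<close>,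
  then under a fixed choice of the other agents only membership in \<open>O\<^sub>\<alpha>\<close> matters to \<open>\<alpha>\<close>, and the
  optimal choices of \<open>\<alpha>\<close> are exactly the cells inside \<open>O\<^sub>\<alpha>\<close>. A single value function thus serves all
  agents. The subjective oughts are treated in the same way by the second value function, and since the
  two functions are unrelated, ConSO is not needed. The open sets for \<open>I\<^sub>\<alpha>\<close> are the sets that contain
  all worlds compatible with the beliefs of \<open>\<alpha>\<close>.\<close>

section \<open>Soundness\<close>

subsection \<open>Obligation by dominance\<close>

text \<open>Soundness hinges on the K axioms of the oughts. They need transitive dominance, but
  \<open>val_le\<close> passes only through a nonempty middle set. IA supplies it, because every
  choice meets every state; for subjective dominance the cluster must first reach the other moment
  (Unif-H) and contain a full choice cell there (OAC). In the completeness proof an ought has to be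
  reduced to a property of single worlds, since a history carries one value that is independent of
  the index of evaluation. The interaction axioms permit this: formulas
  \<open>Ought \<alpha> \<phi>\<close> are constant on Box-classes, so the demands a world makes on
  its alternatives are those that each alternative makes on itself. \<open>Ought_Stit\<close> makes
  meeting them invariant under the choices of \<alpha>, and \<open>Ought_Can\<close> makes them
  satisfiable at every moment. The subjective ought behaves alike along K followed by Box, and
  uniformity moves an optimal world back to the moment of evaluation. Histories are sets of moments,
  so worlds that share a moment would be one history unless each also had a private later
  moment.\<close>

definition obligatory :: "'c set \<Rightarrow> ('c \<Rightarrow> 'c \<Rightarrow> bool) \<Rightarrow> ('c \<Rightarrow> bool) \<Rightarrow> bool" where
  "obligatory C le P \<longleftrightarrow>
    (\<forall>L\<in>C. \<not> P L \<longrightarrow>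
      (\<exists>L'\<in>C. (le L L' \<and> \<not> le L' L) \<and> (\<forall>L''\<in>C. L'' = L' \<or> le L' L'' \<longrightarrow> P L'')))"

text \<open>This is the K axiom for an arbitrary transitive order; no best choice has to exist.
  Above a choice that fails \<open>P\<close>, climb to \<open>L1\<close>, from which
  \<open>P\<close> holds upwards; if \<open>Q\<close> fails at or above \<open>L1\<close>, climb
  once more. The order need not be reflexive, as a choice with histories of different values in one
  state does not dominate itself; hence equality is a separate case.\<close>

lemma obligatory_mono2:
  assumes trans: "\<And>A B D. A \<in> C \<Longrightarrow> B \<in> C \<Longrightarrow> D \<in> C \<Longrightarrow> le A B \<Longrightarrow> le B D \<Longrightarrow> le A D"
    and P: "obligatory C le P" and Q: "obligatory C le Q"
    and R: "\<And>L. L \<in> C \<Longrightarrow> P L \<Longrightarrow> Q L \<Longrightarrow> R L"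
  shows "obligatory C le R"
proof -
  have main: "\<exists>L'\<in>C. (le L L' \<and> \<not> le L' L) \<and> (\<forall>L''\<in>C. L'' = L' \<or> le L' L'' \<longrightarrow> R L'')"
    if P: "obligatory C le P" and Q: "obligatory C le Q" and L: "L \<in> C" "\<not> P L"
      and R: "\<And>L. L \<in> C \<Longrightarrow> P L \<Longrightarrow> Q L \<Longrightarrow> R L" for P Q R L
  proof -
    obtain L1 where L1: "L1 \<in> C" "le L L1" "\<not> le L1 L"
        "\<And>L''. L'' \<in> C \<Longrightarrow> L'' = L1 \<or> le L1 L'' \<Longrightarrow> P L''"
      using P L unfolding obligatory_def by blast
    show ?thesis
    proof (cases "\<forall>L''\<in>C. L'' = L1 \<or> le L1 L'' \<longrightarrow> Q L''")
      case True
      then show ?thesis using L1 R by blast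
    next
      case False
      then obtain L2 where L2: "L2 \<in> C" "L2 = L1 \<or> le L1 L2" "\<not> Q L2" by blast
      then obtain L3 where L3: "L3 \<in> C" "le L2 L3" "\<not> le L3 L2"
          "\<And>L''. L'' \<in> C \<Longrightarrow> L'' = L3 \<or> le L3 L'' \<Longrightarrow> Q L''"
        using Q unfolding obligatory_def by blast
      have LL2: "le L L2" using L2 L1 L trans by blast
      have "le L L3" using LL2 L L2 L3 trans by blast
      \<comment> \<open>Otherwise \<open>L3\<close> would lie below \<open>L2\<close> by way of
        \<open>L\<close>.\<close>
      moreover have "\<not> le L3 L" using LL2 L L2 L3 trans by blast
      moreover have "R L''" if "L'' \<in> C" "L'' = L3 \<or> le L3 L''" for L''
      proof -
        have "le L1 L3" using L1 L2 L3 trans by blast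
        then have "le L1 L''" using that L1 L3 trans by blast
        then show ?thesis using that L1 L3 R by blast
      qed
      ultimately show ?thesis using L3 by blast
    qed
  qed
  show ?thesis
    unfolding obligatory_def
  proof (intro ballI impI)
    fix L assume L: "L \<in> C" "\<not> R L"
    then consider "\<not> P L" | "\<not> Q L" using R by blast
    then show "\<exists>L'\<in>C. (le L L' \<and> \<not> le L' L) \<and> (\<forall>L''\<in>C. L'' = L' \<or> le L' L'' \<longrightarrow> R L'')"
    proof cases
      case 1
      then show ?thesis using main[OF P Q L(1)] R by simp
    next
      case 2
      then show ?thesis using main[OF Q P L(1)] R by simp
    qed
  qed
qed

lemma obligatory_satisfiable: "obligatory C le P \<Longrightarrow> C \<noteq> {} \<Longrightarrow> \<exists>L\<in>C. P L"
  unfolding obligatory_def by blast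

lemma obligatory_all: "(\<And>L. L \<in> C \<Longrightarrow> P L) \<Longrightarrow> obligatory C le P"
  unfolding obligatory_def by blast

lemma obligatory_mono:
  "obligatory C le P \<Longrightarrow> (\<And>L. L \<in> C \<Longrightarrow> P L \<Longrightarrow> R L) \<Longrightarrow> obligatory C le R"
  unfolding obligatory_def by meson

text \<open>Obligation depends on the order and the property only up to a correspondence that is
  total on both sides, not necessarily a function. It is meant for the choices at two epistemically
  related moments, matched when their clusters coincide.\<close>

lemma obligatory_transfer:
  assumes P: "obligatory C le P"
    and bwd: "\<And>L'. L' \<in> C' \<Longrightarrow> \<exists>L\<in>C. r L L'"
    and fwd: "\<And>L. L \<in> C \<Longrightarrow> \<exists>L'\<in>C'. r L L'"
    and le: "\<And>A B A' B'. r A A' \<Longrightarrow> r B B' \<Longrightarrow> le A B \<longleftrightarrow> le' A' B'"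
    and PP: "\<And>A A'. r A A' \<Longrightarrow> P A \<longleftrightarrow> P' A'"
  shows "obligatory C' le' P'"
  unfolding obligatory_def
proof (intro ballI impI)
  fix L' assume L': "L' \<in> C'" "\<not> P' L'"
  then obtain L where L: "L \<in> C" "r L L'" using bwd by blast
  then have "\<not> P L" using PP L' by blast
  then obtain N where N: "N \<in> C" "le L N" "\<not> le N L"
      "\<And>L''. L'' \<in> C \<Longrightarrow> L'' = N \<or> le N L'' \<Longrightarrow> P L''"
    using P L unfolding obligatory_def by blast
  obtain N' where N': "N' \<in> C'" "r N N'" using fwd N by blast
  have "P' L''" if "L'' \<in> C'" "L'' = N' \<or> le' N' L''" for L''
    using that N N' PP le bwd by metis
  moreover have "le' L' N'" "\<not> le' N' L'" using N N' L le by blast+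
  ultimately show "\<exists>N'\<in>C'. (le' L' N' \<and> \<not> le' N' L') \<and> (\<forall>L''\<in>C'. L'' = N' \<or> le' N' L'' \<longrightarrow> P' L'')"
    using N' by blast
qed

text \<open>An element of the middle set carries the inequality across; an empty set would be
  comparable with everything.\<close>

lemma val_le_trans:
  "val_le v A B \<Longrightarrow> val_le v B D \<Longrightarrow> B \<noteq> {} \<Longrightarrow> val_le v A D"
  unfolding val_le_def by (meson all_not_in_conv order_trans)

subsection \<open>Frames\<close>

locale kiobt =
  fixes F :: "('m, 'a, 'z) frame_scheme"
  assumes frame: "kiobt_frame F"
begin

lemma hists_at_Mom: "h \<in> hists_at F m \<Longrightarrow> m \<in> Mom F"
  unfolding hists_at_def histories_def pred_on.maxchain_def pred_on.chain_def by blast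

lemma index_iff [simp]: "(m, h) \<in> indices F \<longleftrightarrow> h \<in> hists_at F m"
  using hists_at_Mom by (auto simp: indices_def)

lemma partition: "m \<in> Mom F \<Longrightarrow> partition_on (hists_at F m) (Choice F \<alpha> m)"
  using frame by (simp add: kiobt_frame_def)

lemma Choice_subset: "m \<in> Mom F \<Longrightarrow> L \<in> Choice F \<alpha> m \<Longrightarrow> L \<subseteq> hists_at F m"
  using partition[of m \<alpha>] unfolding partition_on_def by blast

lemma Choice_nonempty: "m \<in> Mom F \<Longrightarrow> L \<in> Choice F \<alpha> m \<Longrightarrow> L \<noteq> {}"
  using partition[of m \<alpha>] unfolding partition_on_def by blast

lemma choice_cell_eq:
  assumes "m \<in> Mom F" "L \<in> Choice F \<alpha> m" "h \<in> L"
  shows "choice_cell F \<alpha> m h = L"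
  unfolding choice_cell_def
proof (rule the_equality)
  show "L' = L" if "L' \<in> Choice F \<alpha> m \<and> h \<in> L'" for L'
    using that assms partition[OF assms(1), of \<alpha>]
    by (auto simp: partition_on_def disjoint_def)
qed (use assms in blast)

lemma choice_cell_in:
  assumes "h \<in> hists_at F m"
  shows "choice_cell F \<alpha> m h \<in> Choice F \<alpha> m" "h \<in> choice_cell F \<alpha> m h"
proof -
  have m: "m \<in> Mom F" using assms hists_at_Mom by blast
  obtain L where "L \<in> Choice F \<alpha> m" "h \<in> L"
    using partition[OF m, of \<alpha>] assms by (auto simp: partition_on_def)
  then show "choice_cell F \<alpha> m h \<in> Choice F \<alpha> m" "h \<in> choice_cell F \<alpha> m h"
    using choice_cell_eq[OF m] by simp_all
qed

lemma choice_cell_cell: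
  assumes "h \<in> hists_at F m" "h' \<in> choice_cell F \<alpha> m h"
  shows "h' \<in> hists_at F m" "choice_cell F \<alpha> m h' = choice_cell F \<alpha> m h"
proof -
  note m = hists_at_Mom[OF assms(1)] and L = choice_cell_in(1)[OF assms(1), of \<alpha>]
  show "h' \<in> hists_at F m" using Choice_subset[OF m L] assms(2) by blast
  show "choice_cell F \<alpha> m h' = choice_cell F \<alpha> m h" by (rule choice_cell_eq[OF m L assms(2)])
qed

section \<open>Indistinguishability\<close>

lemma Indist_equiv: "equiv (indices F) (Indist F \<alpha>)"
  using frame by (simp add: kiobt_frame_def)

lemma Indist_indices: "((m, h), (m', h')) \<in> Indist F \<alpha> \<Longrightarrow> h \<in> hists_at F m \<and> h' \<in> hists_at F m'"
  using Indist_equiv[of \<alpha>] by (auto simp: equiv_def index_iff)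

lemma Indist_refl: "h \<in> hists_at F m \<Longrightarrow> ((m, h), (m, h)) \<in> Indist F \<alpha>"
  using Indist_equiv[of \<alpha>] hists_at_Mom by (auto simp: equiv_def refl_on_def index_iff)

lemma Indist_sym: "(i, j) \<in> Indist F \<alpha> \<Longrightarrow> (j, i) \<in> Indist F \<alpha>"
  using Indist_equiv[of \<alpha>] unfolding equiv_def sym_def by blast

lemma Indist_trans: "(i, j) \<in> Indist F \<alpha> \<Longrightarrow> (j, k) \<in> Indist F \<alpha> \<Longrightarrow> (i, k) \<in> Indist F \<alpha>"
  using Indist_equiv[of \<alpha>] unfolding equiv_def trans_def by blast

lemma Indist_iff: "(i, j) \<in> Indist F \<alpha> \<Longrightarrow> (i, k) \<in> Indist F \<alpha> \<longleftrightarrow> (j, k) \<in> Indist F \<alpha>"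
  using Indist_sym Indist_trans by metis

text \<open>OAC applied to a reflexive pair; it follows that information classes are unions of
  choice cells.\<close>

lemma Indist_cell:
  assumes "h \<in> hists_at F m" "h' \<in> choice_cell F \<alpha> m h"
  shows "((m, h), (m, h')) \<in> Indist F \<alpha>"
proof -
  have "((m, h'), (m, h)) \<in> Indist F \<alpha>"
    using frame assms Indist_refl[of h m \<alpha>] unfolding kiobt_frame_def cond_OAC_def by blast
  then show ?thesis using Indist_sym by blast
qed

lemma Indist_unif:
  assumes "((m, h), (m', h')) \<in> Indist F \<alpha>" "g \<in> hists_at F m"
  obtains g' where "g' \<in> hists_at F m'" "((m, g), (m', g')) \<in> Indist F \<alpha>"
  using frame assms unfolding kiobt_frame_def cond_UnifH_def by blast

section \<open>States, dominance and epistemic clusters\<close>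

lemma State_meets_Choice:
  assumes m: "m \<in> Mom F" and L: "L \<in> Choice F \<alpha> m" and S: "S \<in> State F \<alpha> m"
  shows "L \<inter> S \<noteq> {}"
proof -
  obtain s where s: "s \<in> Select F m" and S: "S = hists_at F m \<inter> (\<Inter>\<beta>\<in>- {\<alpha>}. s \<beta>)"
    using S unfolding State_def by blast
  \<comment> \<open>Overriding the entry of \<alpha> leaves the state unchanged, since a state only
    involves the other agents.\<close>
  have "s(\<alpha> := L) \<in> Select F m" using s L by (simp add: Select_def)
  then have "(\<Inter>\<beta>. (s(\<alpha> := L)) \<beta>) \<noteq> {}"
    using frame m unfolding kiobt_frame_def cond_IA_def by blast
  then obtain h where h: "\<And>\<beta>. h \<in> (s(\<alpha> := L)) \<beta>" by blast
  have "h \<in> L" using h[of \<alpha>] by simp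
  moreover have "h \<in> s \<beta>" if "\<beta> \<noteq> \<alpha>" for \<beta> using h[of \<beta>] that by simp
  ultimately show ?thesis using S Choice_subset[OF m L] by blast
qed

lemma dom_le_trans:
  assumes m: "m \<in> Mom F" and B: "B \<in> Choice F \<alpha> m" and "dom_le F \<alpha> m A B" "dom_le F \<alpha> m B D"
  shows "dom_le F \<alpha> m A D"
  unfolding dom_le_def
proof
  fix S assume S: "S \<in> State F \<alpha> m"
  show "val_le (Value_O F) (A \<inter> S) (D \<inter> S)"
    by (rule val_le_trans[where B = "B \<inter> S"])
      (use S assms State_meets_Choice[OF m B S] in \<open>auto simp: dom_le_def\<close>)
qed

text \<open>Unif-H brings some history into the cluster at \<open>m'\<close>, OAC adds the whole
  choice cell of that history, and by IA a cell meets every state.\<close>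

lemma epi_cluster_meets_State:
  assumes L: "L \<in> Choice F \<alpha> m" "m \<in> Mom F" and mm: "mom_indist F \<alpha> m m'" and S: "S \<in> State F \<alpha> m'"
  shows "epi_cluster F \<alpha> m L m' \<inter> S \<noteq> {}"
proof -
  obtain h where h: "h \<in> L" "h \<in> hists_at F m"
    using Choice_nonempty[OF L(2,1)] Choice_subset[OF L(2,1)] by blast
  obtain k k' where "((m, k), (m', k')) \<in> Indist F \<alpha>" using mm unfolding mom_indist_def by blast
  then obtain h' where h': "h' \<in> hists_at F m'" "((m, h), (m', h')) \<in> Indist F \<alpha>"
    by (rule Indist_unif[OF _ h(2)])
  obtain g where g: "g \<in> choice_cell F \<alpha> m' h'" "g \<in> S"
    using State_meets_Choice[OF hists_at_Mom[OF h'(1)] choice_cell_in(1)[OF h'(1)] S] by blast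
  have "((m, h), (m', g)) \<in> Indist F \<alpha>" using Indist_trans h' Indist_cell g by blast
  then show ?thesis using g h Indist_indices unfolding epi_cluster_def by blast
qed

lemma sdom_le_trans:
  assumes m: "m \<in> Mom F" and B: "B \<in> Choice F \<alpha> m" and "sdom_le F \<alpha> m A B" "sdom_le F \<alpha> m B D"
  shows "sdom_le F \<alpha> m A D"
  unfolding sdom_le_def
proof (intro allI impI ballI)
  fix m' S assume mm: "mom_indist F \<alpha> m m'" and S: "S \<in> State F \<alpha> m'"
  show "val_le (Value_S F) (epi_cluster F \<alpha> m A m' \<inter> S) (epi_cluster F \<alpha> m D m' \<inter> S)"
    by (rule val_le_trans[where B = "epi_cluster F \<alpha> m B m' \<inter> S"])
      (use mm S assms epi_cluster_meets_State[OF B m mm S] in \<open>auto simp: sdom_le_def\<close>)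
qed

lemma mom_indist_hist:
  assumes "mom_indist F \<alpha> m m'" "h \<in> hists_at F m"
  obtains h' where "h' \<in> hists_at F m'" "((m, h), (m', h')) \<in> Indist F \<alpha>"
proof -
  obtain k k' where "((m, k), (m', k')) \<in> Indist F \<alpha>" using assms(1) unfolding mom_indist_def by blast
  then show ?thesis using that Indist_unif[OF _ assms(2)] by blast
qed

lemma mom_indist_sym: "mom_indist F \<alpha> m m' \<Longrightarrow> mom_indist F \<alpha> m' m"
  unfolding mom_indist_def using Indist_sym by blast

text \<open>The two links may use different histories at the middle moment; Unif-H realigns
  them.\<close>

lemma mom_indist_trans: "mom_indist F \<alpha> m m' \<Longrightarrow> mom_indist F \<alpha> m' m'' \<Longrightarrow> mom_indist F \<alpha> m m''"
proof -
  assume *: "mom_indist F \<alpha> m m'" "mom_indist F \<alpha> m' m''"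
  then obtain h h' where h: "((m, h), (m', h')) \<in> Indist F \<alpha>" unfolding mom_indist_def by blast
  then have "h' \<in> hists_at F m'" using Indist_indices by blast
  then obtain h'' where "((m', h'), (m'', h'')) \<in> Indist F \<alpha>" using *(2) mom_indist_hist by blast
  then show ?thesis using Indist_trans[OF h] unfolding mom_indist_def by blast
qed

text \<open>By OAC the cluster of a choice cell is the information class of any one of its
  histories, restricted to \<open>n\<close>, and related histories have the same class.\<close>

lemma epi_cluster_cong_Indist:
  assumes L: "L \<in> Choice F \<alpha> m" "h \<in> L" "m \<in> Mom F" and L': "L' \<in> Choice F \<alpha> m'" "h' \<in> L'" "m' \<in> Mom F"
    and hh: "((m, h), (m', h')) \<in> Indist F \<alpha>"
  shows "epi_cluster F \<alpha> m L n = epi_cluster F \<alpha> m' L' n"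
proof -
  have *: "epi_cluster F \<alpha> m L n = {g \<in> hists_at F n. ((m, h), (n, g)) \<in> Indist F \<alpha>}"
    if L: "L \<in> Choice F \<alpha> m" "h \<in> L" "m \<in> Mom F" for m L h
  proof -
    have "((m, h), (m, g)) \<in> Indist F \<alpha>" if "g \<in> L" for g
      using that L(2) Indist_cell[of h m g \<alpha>] Choice_subset[OF L(3,1)] choice_cell_eq[OF L(3,1,2)] by blast
    then have "((m, g), (n, k)) \<in> Indist F \<alpha> \<longleftrightarrow> ((m, h), (n, k)) \<in> Indist F \<alpha>" if "g \<in> L" for g k
      using that Indist_iff by metis
    then show ?thesis unfolding epi_cluster_def using L(2) by blast
  qed
  show ?thesis unfolding *[OF L] *[OF L'] Indist_iff[OF hh] ..
qed

lemma epi_cluster_transfer: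
  assumes mm: "mom_indist F \<alpha> m m'" and L: "L \<in> Choice F \<alpha> m"
  obtains L' where "L' \<in> Choice F \<alpha> m'" "epi_cluster F \<alpha> m L = epi_cluster F \<alpha> m' L'"
proof -
  have m: "m \<in> Mom F" "m' \<in> Mom F" using mm Indist_indices hists_at_Mom unfolding mom_indist_def by blast+
  obtain h where h: "h \<in> L" "h \<in> hists_at F m"
    using Choice_nonempty[OF m(1) L] Choice_subset[OF m(1) L] by blast
  then obtain h' where h': "h' \<in> hists_at F m'" "((m, h), (m', h')) \<in> Indist F \<alpha>"
    using mm mom_indist_hist by blast
  have "epi_cluster F \<alpha> m L = epi_cluster F \<alpha> m' (choice_cell F \<alpha> m' h')"
    using epi_cluster_cong_Indist[OF L h(1) m(1) choice_cell_in(1)[OF h'(1)] choice_cell_in(2)[OF h'(1)] m(2) h'(2)]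
    by blast
  then show ?thesis using that choice_cell_in h' by blast
qed

section \<open>Ex ante information and its topologies\<close>

lemma ex_ante_info_mono:
  assumes "((m, g), (m', h')) \<in> Indist F \<alpha>" "h \<in> hists_at F m"
  shows "ex_ante_info F \<alpha> (m, h) \<subseteq> ex_ante_info F \<alpha> (m', h')"
proof
  fix j assume "j \<in> ex_ante_info F \<alpha> (m, h)"
  then obtain n k k' where j: "j = (n, k)" "(n, k) \<in> indices F" "k' \<in> hists_at F n"
      "((m, h), (n, k')) \<in> Indist F \<alpha>"
    unfolding ex_ante_info_def by blast
  obtain k'' where "k'' \<in> hists_at F n" "((m, g), (n, k'')) \<in> Indist F \<alpha>"
    using Indist_unif[OF j(4)] Indist_indices[OF assms(1)] by blast
  then show "j \<in> ex_ante_info F \<alpha> (m', h')"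
    using j(1,2) Indist_iff[OF assms(1)] unfolding ex_ante_info_def by blast
qed

text \<open>Ex ante information forgets the history, so a link from any \<open>g\<close> through
  \<open>m\<close> settles the matter for every \<open>h\<close> through \<open>m\<close>; Unif-H
  supplies the missing history in each direction. With KI the topologies agree too, which is the
  content of the axiom \<open>Bel_BoxK\<close>.\<close>

lemma ex_ante_info_eq:
  assumes "((m, g), (m', h')) \<in> Indist F \<alpha>" "h \<in> hists_at F m"
  shows "ex_ante_info F \<alpha> (m, h) = ex_ante_info F \<alpha> (m', h')"
proof (rule subset_antisym)
  show "ex_ante_info F \<alpha> (m, h) \<subseteq> ex_ante_info F \<alpha> (m', h')"
    by (rule ex_ante_info_mono[OF assms])
  obtain g' where "((m, h), (m', g')) \<in> Indist F \<alpha>"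
    by (rule Indist_unif[OF assms])
  then have "((m', g'), (m, h)) \<in> Indist F \<alpha>" by (rule Indist_sym)
  moreover have "h' \<in> hists_at F m'" using assms Indist_indices by blast
  ultimately show "ex_ante_info F \<alpha> (m', h') \<subseteq> ex_ante_info F \<alpha> (m, h)"
    by (rule ex_ante_info_mono)
qed

lemma Topol_eq:
  assumes "((m, g), (m', h')) \<in> Indist F \<alpha>" "h \<in> hists_at F m"
  shows "Topol F \<alpha> (m, h) = Topol F \<alpha> (m', h')"
proof -
  have "(m, h) \<in> indices F" "(m', h') \<in> indices F"
    using assms(2) Indist_indices[OF assms(1)] by simp_all
  then show ?thesis
    using ex_ante_info_eq[OF assms] frame unfolding kiobt_frame_def cond_KI_def by blast
qed

lemma topspace_Topol:
  assumes "h \<in> hists_at F m"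
  shows "topspace (Topol F \<alpha> (m, h)) = ex_ante_info F \<alpha> (m, h)"
  using frame assms index_iff[of m h] unfolding kiobt_frame_def by blast

lemma index_in_topspace:
  assumes "h \<in> hists_at F m"
  shows "(m, h) \<in> topspace (Topol F \<alpha> (m, h))"
  unfolding topspace_Topol[OF assms] ex_ante_info_def
  using assms Indist_refl[OF assms, of \<alpha>] by auto

lemma Topol_meet:
  assumes "h \<in> hists_at F m" "openin (Topol F \<alpha> (m, h)) U" "openin (Topol F \<alpha> (m, h)) V"
    "U \<noteq> {}" "V \<noteq> {}"
  shows "U \<inter> V \<noteq> {}"
proof -
  have "(m, h) \<in> indices F" using assms(1) by simp
  then show ?thesis using frame assms(2-) unfolding kiobt_frame_def cond_CI_def by blast
qed

lemma topspace_subset_indices: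
  assumes "h \<in> hists_at F m" shows "topspace (Topol F \<alpha> (m, h)) \<subseteq> indices F"
  unfolding topspace_Topol[OF assms] ex_ante_info_def by blast

text \<open>IA for a partial selection: the agents outside \<open>A\<close> are given the cell of
  the arbitrary history \<open>h\<close>.\<close>

lemma Select_nonempty:
  assumes "h \<in> hists_at F m" "\<And>\<alpha>. \<alpha> \<in> A \<Longrightarrow> g \<alpha> \<in> hists_at F m"
  obtains h' where "h' \<in> hists_at F m" "\<And>\<alpha>. \<alpha> \<in> A \<Longrightarrow> h' \<in> choice_cell F \<alpha> m (g \<alpha>)"
proof -
  define s where "s \<alpha> = choice_cell F \<alpha> m (if \<alpha> \<in> A then g \<alpha> else h)" for \<alpha>
  have g: "(if \<alpha> \<in> A then g \<alpha> else h) \<in> hists_at F m" for \<alpha> using assms by simp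
  have "s \<in> Select F m" unfolding Select_def s_def using choice_cell_in(1)[OF g] by simp
  then have "(\<Inter>\<alpha>. s \<alpha>) \<noteq> {}"
    using frame assms(1) hists_at_Mom unfolding kiobt_frame_def cond_IA_def by blast
  then obtain h' where h': "\<And>\<alpha>. h' \<in> s \<alpha>" by blast
  have "h' \<in> hists_at F m" using h' choice_cell_cell(1)[OF g] unfolding s_def by blast
  moreover have "h' \<in> choice_cell F \<alpha> m (g \<alpha>)" if "\<alpha> \<in> A" for \<alpha>
    using h'[of \<alpha>] that by (simp add: s_def)
  ultimately show ?thesis using that by blast
qed

end

subsection \<open>Truth of the axioms\<close>

text \<open>Truth at an index is itself one of the assignments over which \<open>tautology\<close>
  quantifies.\<close>

lemma sat_prop_eval: "sat \<M> m h \<phi> \<longleftrightarrow> prop_eval (sat \<M> m h) \<phi>"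
  by (induction \<phi>) auto

lemma sat_ImpI: "(sat \<M> m h \<phi> \<Longrightarrow> sat \<M> m h \<psi>) \<Longrightarrow> sat \<M> m h (Imp \<phi> \<psi>)"
  by auto

lemma sat_BigConj: "\<phi>s \<noteq> [] \<Longrightarrow> sat \<M> m h (BigConj \<phi>s) \<longleftrightarrow> (\<forall>\<phi>\<in>set \<phi>s. sat \<M> m h \<phi>)"
  by (induction \<phi>s rule: BigConj.induct) auto

lemma sat_Ought_obligatory:
  "sat \<M> m h (Ought \<alpha> \<phi>) \<longleftrightarrow>
    obligatory (Choice \<M> \<alpha> m) (dom_le \<M> \<alpha> m) (\<lambda>L. L \<subseteq> {g \<in> hists_at \<M> m. sat \<M> m g \<phi>})"
  by (simp add: obligatory_def dom_less_def)

lemma sat_SOught_obligatory: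
  "sat \<M> m h (SOught \<alpha> \<phi>) \<longleftrightarrow>
    obligatory (Choice \<M> \<alpha> m) (sdom_le \<M> \<alpha> m)
      (\<lambda>L. \<forall>m'. mom_indist \<M> \<alpha> m m' \<longrightarrow>
        epi_cluster \<M> \<alpha> m L m' \<subseteq> {g \<in> hists_at \<M> m'. sat \<M> m' g \<phi>})"
  unfolding obligatory_def sdom_less_def[symmetric] by simp

text \<open>Together with \<open>refl\<close>, the assumption \<open>iff\<close> amounts to an
  equivalence relation, in the form that makes formulas headed by \<open>N\<close> constant along
  \<open>r\<close>.\<close>

lemma sat_S5_axioms:
  assumes N: "\<And>m h \<psi>. h \<in> hists_at \<M> m \<Longrightarrow> sat \<M> m h (N \<psi>) \<longleftrightarrow> (\<forall>n k. r (m, h) (n, k) \<longrightarrow> sat \<M> n k \<psi>)"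
    and closed: "\<And>m h n k. h \<in> hists_at \<M> m \<Longrightarrow> r (m, h) (n, k) \<Longrightarrow> k \<in> hists_at \<M> n"
    and refl: "\<And>m h. h \<in> hists_at \<M> m \<Longrightarrow> r (m, h) (m, h)"
    and iff: "\<And>m h i j. h \<in> hists_at \<M> m \<Longrightarrow> r (m, h) i \<Longrightarrow> r (m, h) j \<longleftrightarrow> r i j"
    and \<phi>: "\<phi> \<in> S5_axioms N" and h: "h \<in> hists_at \<M> m"
  shows "sat \<M> m h \<phi>"
proof -
  have *: "sat \<M> n k (N \<psi>) \<longleftrightarrow> sat \<M> m h (N \<psi>)" if "r (m, h) (n, k)" for n k \<psi>
    using N[OF h] N[OF closed[OF h that]] iff[OF h that] by simp
  from \<phi> consider \<psi>1 \<psi>2 where "\<phi> = Imp (N (Imp \<psi>1 \<psi>2)) (Imp (N \<psi>1) (N \<psi>2))"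
    | \<psi> where "\<phi> = Imp (N \<psi>) \<psi>" | \<psi> where "\<phi> = Imp (N \<psi>) (N (N \<psi>))"
    | \<psi> where "\<phi> = Imp (Neg (N \<psi>)) (N (Neg (N \<psi>)))"
    unfolding S5_axioms_def K_axioms_def by blast
  then show ?thesis
  proof cases
    case 1
    then show ?thesis using N[OF h] by auto
  next
    case 2
    then show ?thesis using N[OF h] refl[OF h] by auto
  next
    case 3
    then show ?thesis using N[OF h] * by auto
  next
    case 4
    have "sat \<M> m h (N (Neg (N \<psi>)))" if "\<not> sat \<M> m h (N \<psi>)"
      using that * by (simp add: N[OF h, of "Neg (N \<psi>)"])
    then show ?thesis using 4 by auto
  qed
qed

locale kiobt_mod =
  fixes \<M> :: "('m, 'a, 'p) model"
  assumes model: "kiobt_model \<M>"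
begin

sublocale kiobt \<M>
  using model by unfold_locales (simp add: kiobt_model_def)

text \<open>The clause for \<open>SOught\<close> refers to choices only through their clusters and
  to the related moments; both look the same from \<open>m'\<close>, once choices with equal
  clusters are matched.\<close>

lemma sat_SOught_transfer:
  assumes "sat \<M> m h (SOught \<alpha> \<phi>)" and mm: "mom_indist \<M> \<alpha> m m'"
  shows "sat \<M> m' h' (SOught \<alpha> \<phi>)"
  using assms(1) unfolding sat_SOught_obligatory
proof (rule obligatory_transfer[where r = "\<lambda>L L'. epi_cluster \<M> \<alpha> m L = epi_cluster \<M> \<alpha> m' L'"])
  have iff: "mom_indist \<M> \<alpha> m n \<longleftrightarrow> mom_indist \<M> \<alpha> m' n" for n
    using mm mom_indist_sym mom_indist_trans by blast
  show "\<exists>L\<in>Choice \<M> \<alpha> m. epi_cluster \<M> \<alpha> m L = epi_cluster \<M> \<alpha> m' L'"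
    if "L' \<in> Choice \<M> \<alpha> m'" for L'
    using epi_cluster_transfer[OF mom_indist_sym[OF mm] that] by metis
  show "\<exists>L'\<in>Choice \<M> \<alpha> m'. epi_cluster \<M> \<alpha> m L = epi_cluster \<M> \<alpha> m' L'"
    if "L \<in> Choice \<M> \<alpha> m" for L
    using epi_cluster_transfer[OF mm that] by metis
  show "sdom_le \<M> \<alpha> m A B \<longleftrightarrow> sdom_le \<M> \<alpha> m' A' B'"
    if "epi_cluster \<M> \<alpha> m A = epi_cluster \<M> \<alpha> m' A'" "epi_cluster \<M> \<alpha> m B = epi_cluster \<M> \<alpha> m' B'"
    for A B A' B'
    using that by (simp add: sdom_le_def iff)
  show "(\<forall>n. mom_indist \<M> \<alpha> m n \<longrightarrow> epi_cluster \<M> \<alpha> m A n \<subseteq> {g \<in> hists_at \<M> n. sat \<M> n g \<phi>}) \<longleftrightarrow>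
      (\<forall>n. mom_indist \<M> \<alpha> m' n \<longrightarrow> epi_cluster \<M> \<alpha> m' A' n \<subseteq> {g \<in> hists_at \<M> n. sat \<M> n g \<phi>})"
    if "epi_cluster \<M> \<alpha> m A = epi_cluster \<M> \<alpha> m' A'" for A A'
    using that by (simp add: iff)
qed

lemma sat_Bel_topspace:
  assumes h: "h \<in> hists_at \<M> m"
    and "\<And>n k. (n, k) \<in> topspace (Topol \<M> \<alpha> (m, h)) \<Longrightarrow> sat \<M> n k \<phi>"
  shows "sat \<M> m h (Bel \<alpha> \<phi>)"
proof -
  have "topspace (Topol \<M> \<alpha> (m, h)) \<subseteq> {(m', h'). (m', h') \<in> indices \<M> \<and> sat \<M> m' h' \<phi>}"
    using topspace_subset_indices[OF h] assms(2) by blast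
  moreover have "topspace (Topol \<M> \<alpha> (m, h)) \<noteq> {}" using index_in_topspace[OF h] by blast
  ultimately show ?thesis unfolding sat.simps(7) using openin_topspace by blast
qed

lemma axioms_sound:
  assumes "\<phi> \<in> axioms_R'" "h \<in> hists_at \<M> m"
  shows "sat \<M> m h \<phi>"
  using assms
proof (induction rule: axioms_R'.cases)
  case (taut \<psi>)
  then show ?case using sat_prop_eval[of \<M> m h \<phi>] by (simp add: tautology_def)
next
  case (S5_Box \<psi>)
  then show ?case by (auto simp: S5_axioms_def K_axioms_def)
next
  case (S5_Stit \<psi> \<alpha>)
  have "sat \<M> m h \<psi>"
  proof (rule sat_S5_axioms[where N = "Stit \<alpha>" and
        r = "\<lambda>i j. fst j = fst i \<and> snd j \<in> choice_cell \<M> \<alpha> (fst i) (snd i)"])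
    show "fst j = fst (m, h) \<and> snd j \<in> choice_cell \<M> \<alpha> (fst (m, h)) (snd (m, h)) \<longleftrightarrow>
        fst j = fst i \<and> snd j \<in> choice_cell \<M> \<alpha> (fst i) (snd i)"
      if "h \<in> hists_at \<M> m" "fst i = fst (m, h) \<and> snd i \<in> choice_cell \<M> \<alpha> (fst (m, h)) (snd (m, h))"
      for m h i j
      using that choice_cell_cell(2)[of h m "snd i" \<alpha>] by simp
  qed (use S5_Stit(2,3) choice_cell_in(2) choice_cell_cell(1) in auto)
  then show ?case using S5_Stit by simp
next
  case (S5_Know \<psi> \<alpha>)
  have "sat \<M> m h \<psi>"
    by (rule sat_S5_axioms[where N = "Know \<alpha>" and r = "\<lambda>i j. (i, j) \<in> Indist \<M> \<alpha>"])
      (use S5_Know(2,3) Indist_refl in \<open>simp_all add: Indist_iff\<close>, blast dest: Indist_indices)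
  then show ?case using S5_Know by simp
next
  case (KD_Bel \<psi> \<alpha>)
  \<comment> \<open>Two beliefs have open witnesses, which intersect by CI. A common point excludes
    believing a formula and its negation (D), and the intersection is an open witness for every
    common consequence (K).\<close>
  have meet: "\<exists>n k. sat \<M> n k \<psi>1 \<and> sat \<M> n k \<psi>2"
      "sat \<M> m h (Bel \<alpha> \<theta>)" if Bel: "sat \<M> m h (Bel \<alpha> \<psi>1)" "sat \<M> m h (Bel \<alpha> \<psi>2)"
      and \<theta>: "\<And>n k. sat \<M> n k \<psi>1 \<Longrightarrow> sat \<M> n k \<psi>2 \<Longrightarrow> sat \<M> n k \<theta>" for \<psi>1 \<psi>2 \<theta>
  proof -
    obtain U where U: "openin (Topol \<M> \<alpha> (m, h)) U" "U \<noteq> {}"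
        "U \<subseteq> {(m', h'). (m', h') \<in> indices \<M> \<and> sat \<M> m' h' \<psi>1}"
      using Bel(1) unfolding sat.simps(7) by blast
    obtain V where V: "openin (Topol \<M> \<alpha> (m, h)) V" "V \<noteq> {}"
        "V \<subseteq> {(m', h'). (m', h') \<in> indices \<M> \<and> sat \<M> m' h' \<psi>2}"
      using Bel(2) unfolding sat.simps(7) by blast
    have UV: "U \<inter> V \<noteq> {}" "openin (Topol \<M> \<alpha> (m, h)) (U \<inter> V)"
      using Topol_meet[OF KD_Bel(3) U(1) V(1) U(2) V(2)] U V by blast+
    show "\<exists>n k. sat \<M> n k \<psi>1 \<and> sat \<M> n k \<psi>2" using UV(1) U(3) V(3) by blast
    have "U \<inter> V \<subseteq> {(m', h'). (m', h') \<in> indices \<M> \<and> sat \<M> m' h' \<theta>}" using U(3) V(3) \<theta> by blast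
    then show "sat \<M> m h (Bel \<alpha> \<theta>)" using UV unfolding sat.simps(7) by blast
  qed
  from KD_Bel(2) consider \<psi>1 \<psi>2 where "\<psi> = Imp (Bel \<alpha> (Imp \<psi>1 \<psi>2)) (Imp (Bel \<alpha> \<psi>1) (Bel \<alpha> \<psi>2))"
    | \<psi>1 where "\<psi> = Imp (Bel \<alpha> \<psi>1) (Neg (Bel \<alpha> (Neg \<psi>1)))"
    unfolding KD_axioms_def K_axioms_def by blast
  then show ?case
  proof cases
    case 1
    then show ?thesis using KD_Bel(1) meet(2)[of "Imp \<psi>1 \<psi>2" \<psi>1 \<psi>2] by (auto simp del: sat.simps(7))
  next
    case 2
    then show ?thesis using KD_Bel(1) meet(1)[of \<psi>1 "Neg \<psi>1" \<psi>1] by (auto simp del: sat.simps(7))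
  qed
next
  case (Box_Stit \<psi> \<alpha>)
  then show ?case using choice_cell_cell(1) by auto
next
  case (indep ps)
  show ?case
  proof -
    have "sat \<M> m h (Dia (BigConj (map (\<lambda>(\<alpha>, \<phi>). Stit \<alpha> \<phi>) ps)))"
      if *: "sat \<M> m h (BigConj (map (\<lambda>(\<alpha>, \<phi>). Dia (Stit \<alpha> \<phi>)) ps))"
    proof -
      have "\<forall>p\<in>set ps. \<exists>g. g \<in> hists_at \<M> m \<and> sat \<M> m g (Stit (fst p) (snd p))"
        using * indep(2) by (fastforce simp: sat_BigConj)
      then obtain g where g: "\<And>p. p \<in> set ps \<Longrightarrow> g p \<in> hists_at \<M> m"
          "\<And>p. p \<in> set ps \<Longrightarrow> sat \<M> m (g p) (Stit (fst p) (snd p))"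
        by metis
      \<comment> \<open>The agents in \<open>ps\<close> are distinct, so an agent determines its
        pair, and the witness chosen for the pair becomes one for the agent.\<close>
      define f where "f \<alpha> = g (\<alpha>, the (map_of ps \<alpha>))" for \<alpha>
      have f: "f \<alpha> = g (\<alpha>, \<psi>)" if "(\<alpha>, \<psi>) \<in> set ps" for \<alpha> \<psi>
        using that indep(3) by (simp add: f_def)
      have "f \<alpha> \<in> hists_at \<M> m" if "\<alpha> \<in> fst ` set ps" for \<alpha>
        using that f g by force
      then obtain h' where h': "h' \<in> hists_at \<M> m"
          "\<And>\<alpha>. \<alpha> \<in> fst ` set ps \<Longrightarrow> h' \<in> choice_cell \<M> \<alpha> m (f \<alpha>)"
        using Select_nonempty[OF indep(4)] by metis
      have "sat \<M> m h' (Stit \<alpha> \<psi>)" if "(\<alpha>, \<psi>) \<in> set ps" for \<alpha> \<psi>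
      proof -
        have "h' \<in> choice_cell \<M> \<alpha> m (g (\<alpha>, \<psi>))" using h'(2) that f by force
        then show ?thesis using g[OF that] choice_cell_cell(2) by simp
      qed
      then have "sat \<M> m h' (BigConj (map (\<lambda>(\<alpha>, \<phi>). Stit \<alpha> \<phi>) ps))"
        using indep(2) by (auto simp: sat_BigConj simp del: sat.simps)
      then show ?thesis using h' by auto
    qed
    then show ?thesis unfolding indep(1) by (rule sat_ImpI)
  qed
next
  case (Know_Stit \<alpha> \<psi>)
  then show ?case using Indist_cell by auto
next
  case (Unif \<alpha> \<psi>)
  \<comment> \<open>Unif-H carries the history that witnesses the diamond to every moment considered
    possible, where what is known at it holds.\<close>
  then show ?case using Indist_unif Indist_sym Indist_indices by simp meson
next
  case (K_Ought \<psi> \<alpha>)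
  have K: "sat \<M> m h (Ought \<alpha> \<psi>2)" if "sat \<M> m h (Ought \<alpha> (Imp \<psi>1 \<psi>2))" "sat \<M> m h (Ought \<alpha> \<psi>1)" for \<psi>1 \<psi>2
    using that unfolding sat_Ought_obligatory
  proof (rule obligatory_mono2[rotated])
    show "dom_le \<M> \<alpha> m A D" if "B \<in> Choice \<M> \<alpha> m" "dom_le \<M> \<alpha> m A B" "dom_le \<M> \<alpha> m B D" for A B D
      using that by (rule dom_le_trans[OF hists_at_Mom[OF K_Ought(3)]])
  qed fastforce
  then show ?case using K_Ought(1,2) unfolding K_axioms_def by (auto simp del: sat.simps(8))
next
  case (Box_Ought \<psi> \<alpha>)
  have "sat \<M> m h (Ought \<alpha> \<psi>)" if "sat \<M> m h (Box \<psi>)"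
    unfolding sat_Ought_obligatory
    using that Box_Ought hists_at_Mom Choice_subset by (intro obligatory_all) fastforce
  then show ?case unfolding Box_Ought(1) by (rule sat_ImpI)
next
  case (Ought_Box \<alpha> \<psi>)
  show ?case unfolding Ought_Box(1) by (rule sat_ImpI) simp
next
  case (Ought_Stit \<alpha> \<psi>)
  have "sat \<M> m h (Ought \<alpha> (Stit \<alpha> \<psi>))" if "sat \<M> m h (Ought \<alpha> \<psi>)"
    using that unfolding sat_Ought_obligatory
  proof (rule obligatory_mono)
    fix L assume "L \<in> Choice \<M> \<alpha> m" "L \<subseteq> {g \<in> hists_at \<M> m. sat \<M> m g \<psi>}"
    then show "L \<subseteq> {g \<in> hists_at \<M> m. sat \<M> m g (Stit \<alpha> \<psi>)}"
      using choice_cell_eq[of m L \<alpha>] Ought_Stit hists_at_Mom by auto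
  qed
  then show ?case unfolding Ought_Stit(1) by (rule sat_ImpI)
next
  case (Ought_Can \<alpha> \<psi>)
  have "sat \<M> m h (Dia (Stit \<alpha> \<psi>))" if *: "sat \<M> m h (Ought \<alpha> \<psi>)"
  proof -
    obtain L where L: "L \<in> Choice \<M> \<alpha> m" "L \<subseteq> {g \<in> hists_at \<M> m. sat \<M> m g \<psi>}"
      using *[unfolded sat_Ought_obligatory, THEN obligatory_satisfiable] choice_cell_in(1)[OF Ought_Can(2)]
      by blast
    have m: "m \<in> Mom \<M>" using Ought_Can hists_at_Mom by blast
    then obtain g where "g \<in> L" "g \<in> hists_at \<M> m" using L Choice_nonempty[OF m L(1)] by blast
    then show ?thesis using L choice_cell_eq[OF m L(1)] by auto
  qed
  then show ?case unfolding Ought_Can(1) by (rule sat_ImpI)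
next
  case (K_SOught \<psi> \<alpha>)
  have K: "sat \<M> m h (SOught \<alpha> \<psi>2)" if "sat \<M> m h (SOught \<alpha> (Imp \<psi>1 \<psi>2))" "sat \<M> m h (SOught \<alpha> \<psi>1)" for \<psi>1 \<psi>2
    using that unfolding sat_SOught_obligatory
  proof (rule obligatory_mono2[rotated])
    show "sdom_le \<M> \<alpha> m A D" if "B \<in> Choice \<M> \<alpha> m" "sdom_le \<M> \<alpha> m A B" "sdom_le \<M> \<alpha> m B D" for A B D
      using that by (rule sdom_le_trans[OF hists_at_Mom[OF K_SOught(3)]])
  qed fastforce
  then show ?case using K_SOught(1,2) unfolding K_axioms_def by (auto simp del: sat.simps(9))
next
  case (SOught_Know \<alpha> \<psi>)
  have "sat \<M> m h (SOught \<alpha> (Know \<alpha> \<psi>))" if "sat \<M> m h (SOught \<alpha> \<psi>)"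
    using that unfolding sat_SOught_obligatory
  proof (rule obligatory_mono)
    fix L assume L: "\<forall>m'. mom_indist \<M> \<alpha> m m' \<longrightarrow>
      epi_cluster \<M> \<alpha> m L m' \<subseteq> {g \<in> hists_at \<M> m'. sat \<M> m' g \<psi>}"
    have "sat \<M> n k \<psi>" if "g \<in> epi_cluster \<M> \<alpha> m L m'" "((m', g), (n, k)) \<in> Indist \<M> \<alpha>" for m' g n k
    proof -
      have "k \<in> epi_cluster \<M> \<alpha> m L n" "mom_indist \<M> \<alpha> m n"
        using that Indist_trans Indist_indices unfolding epi_cluster_def mom_indist_def by blast+
      then show ?thesis using L by blast
    qed
    then show "\<forall>m'. mom_indist \<M> \<alpha> m m' \<longrightarrow>
      epi_cluster \<M> \<alpha> m L m' \<subseteq> {g \<in> hists_at \<M> m'. sat \<M> m' g (Know \<alpha> \<psi>)}"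
      using epi_cluster_def by fastforce
  qed
  then show ?case unfolding SOught_Know(1) by (rule sat_ImpI)
next
  case (KBox_SOught \<alpha> \<psi>)
  have "sat \<M> m h (SOught \<alpha> \<psi>)" if *: "sat \<M> m h (Know \<alpha> (Box \<psi>))"
  proof -
    have "sat \<M> m' g \<psi>" if mm: "mom_indist \<M> \<alpha> m m'" "g \<in> hists_at \<M> m'" for m' g
      using mom_indist_hist[OF mm(1) KBox_SOught(2)] * mm(2) by auto
    then show ?thesis
      unfolding sat_SOught_obligatory epi_cluster_def by (intro obligatory_all) blast
  qed
  then show ?case unfolding KBox_SOught(1) by (rule sat_ImpI)
next
  case (SOught_Can \<alpha> \<psi>)
  have "sat \<M> m h (Dia (Know \<alpha> \<psi>))" if *: "sat \<M> m h (SOught \<alpha> \<psi>)"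
  proof -
    obtain L where L: "L \<in> Choice \<M> \<alpha> m" "\<And>m'. mom_indist \<M> \<alpha> m m' \<Longrightarrow>
        epi_cluster \<M> \<alpha> m L m' \<subseteq> {g \<in> hists_at \<M> m'. sat \<M> m' g \<psi>}"
      using *[unfolded sat_SOught_obligatory, THEN obligatory_satisfiable] choice_cell_in(1)[OF SOught_Can(2)]
      by blast
    have m: "m \<in> Mom \<M>" using SOught_Can hists_at_Mom by blast
    then obtain g where g: "g \<in> L" "g \<in> hists_at \<M> m"
      using Choice_nonempty[OF m L(1)] Choice_subset[OF m L(1)] by blast
    have "sat \<M> n k \<psi>" if "((m, g), (n, k)) \<in> Indist \<M> \<alpha>" for n k
      using L(2)[of n] that g Indist_indices unfolding epi_cluster_def mom_indist_def by blast
    then show ?thesis using g by auto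
  qed
  then show ?case unfolding SOught_Can(1) by (rule sat_ImpI)
next
  case (SOught_KBox \<alpha> \<psi>)
  have "sat \<M> m h (Know \<alpha> (Box (SOught \<alpha> \<psi>)))" if "sat \<M> m h (SOught \<alpha> \<psi>)"
    using sat_SOught_transfer[OF that] unfolding sat.simps(4,6) mom_indist_def by blast
  then show ?case unfolding SOught_KBox(1) by (rule sat_ImpI)
next
  case (BoxK_Bel \<alpha> \<psi>)
  have "sat \<M> m h (Bel \<alpha> \<psi>)" if *: "sat \<M> m h (Box (Know \<alpha> \<psi>))"
  proof -
    \<comment> \<open>The whole space is the open witness: each of its indices is related to an
      index at \<open>m\<close>, and \<open>\<psi>\<close> is known at all of these.\<close>
    have "sat \<M> n k \<psi>" if nk: "(n, k) \<in> topspace (Topol \<M> \<alpha> (m, h))" for n k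
    proof -
      obtain k' where k': "((m, h), (n, k')) \<in> Indist \<M> \<alpha>" "k \<in> hists_at \<M> n"
        using nk unfolding topspace_Topol[OF BoxK_Bel(2)] ex_ante_info_def index_iff by blast
      obtain g where g: "g \<in> hists_at \<M> m" "((n, k), (m, g)) \<in> Indist \<M> \<alpha>"
        by (rule Indist_unif[OF Indist_sym[OF k'(1)] k'(2)])
      then show ?thesis using * Indist_sym[OF g(2)] by simp
    qed
    then show ?thesis by (rule sat_Bel_topspace[OF BoxK_Bel(2)])
  qed
  then show ?case unfolding BoxK_Bel(1) by (rule sat_ImpI)
next
  case (Bel_BoxK \<alpha> \<psi>)
  have "sat \<M> m h (Box (Know \<alpha> (Bel \<alpha> \<psi>)))" if *: "sat \<M> m h (Bel \<alpha> \<psi>)"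
    unfolding sat.simps(4,6)
  proof (intro ballI allI impI)
    fix g n k assume "((m, g), (n, k)) \<in> Indist \<M> \<alpha>"
    then have "Topol \<M> \<alpha> (m, h) = Topol \<M> \<alpha> (n, k)" using Topol_eq Bel_BoxK by blast
    then show "sat \<M> n k (Bel \<alpha> \<psi>)" using * by simp
  qed
  then show ?case unfolding Bel_BoxK(1) by (rule sat_ImpI)
qed

end

section \<open>Uniform substitution as a change of valuation\<close>

lemma hists_at_Val [simp]: "hists_at (\<M>\<lparr>Val := V\<rparr>) = hists_at \<M>"
  by (simp add: fun_eq_iff hists_at_def histories_def)

lemma indices_Val [simp]: "indices (\<M>\<lparr>Val := V\<rparr>) = indices \<M>"
  by (simp add: indices_def)

lemma choice_cell_Val [simp]: "choice_cell (\<M>\<lparr>Val := V\<rparr>) = choice_cell \<M>"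
  by (simp add: fun_eq_iff choice_cell_def)

lemma State_Val [simp]: "State (\<M>\<lparr>Val := V\<rparr>) = State \<M>"
  by (simp add: fun_eq_iff State_def Select_def)

lemma dom_le_Val [simp]: "dom_le (\<M>\<lparr>Val := V\<rparr>) = dom_le \<M>"
  by (simp add: fun_eq_iff dom_le_def)

lemma mom_indist_Val [simp]: "mom_indist (\<M>\<lparr>Val := V\<rparr>) = mom_indist \<M>"
  by (simp add: fun_eq_iff mom_indist_def)

lemma epi_cluster_Val [simp]: "epi_cluster (\<M>\<lparr>Val := V\<rparr>) = epi_cluster \<M>"
  by (simp add: fun_eq_iff epi_cluster_def)

lemma sdom_le_Val [simp]: "sdom_le (\<M>\<lparr>Val := V\<rparr>) = sdom_le \<M>"
  by (simp add: fun_eq_iff sdom_le_def)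

lemma ex_ante_info_Val [simp]: "ex_ante_info (\<M>\<lparr>Val := V\<rparr>) = ex_ante_info \<M>"
  by (simp add: fun_eq_iff ex_ante_info_def)

lemma kiobt_frame_Val [simp]: "kiobt_frame (\<M>\<lparr>Val := V\<rparr>) = kiobt_frame \<M>"
  by (simp add: kiobt_frame_def branching_time_def cond_NC_def cond_IA_def Select_def cond_OAC_def
      cond_UnifH_def cond_CI_def cond_KI_def)

lemma sat_subst_fm:
  assumes "kiobt_model \<M>" "h \<in> hists_at \<M> m"
  shows "sat \<M> m h (subst_fm \<sigma> \<phi>) \<longleftrightarrow>
    sat (\<M>\<lparr>Val := \<lambda>p. {(m, h) \<in> indices \<M>. sat \<M> m h (\<sigma> p)}\<rparr>) m h \<phi>"
proof -
  interpret kiobt_mod \<M> by unfold_locales (fact assms)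
  show ?thesis using assms(2)
  proof (induction \<phi> arbitrary: m h)
    case (Atom p)
    then show ?case using hists_at_Mom index_iff by auto
  next
    case (Stit \<alpha> \<phi>)
    then show ?case using choice_cell_cell(1) by simp
  next
    case (Know \<alpha> \<phi>)
    then show ?case using Indist_indices by simp
  next
    case (Bel \<alpha> \<phi>)
    have "{(m', h'). (m', h') \<in> indices \<M> \<and> sat \<M> m' h' (subst_fm \<sigma> \<phi>)} =
      {(m', h'). (m', h') \<in> indices \<M> \<and>
        sat (\<M>\<lparr>Val := \<lambda>p. {(m, h) \<in> indices \<M>. sat \<M> m h (\<sigma> p)}\<rparr>) m' h' \<phi>}"
      using Bel.IH by auto
    then show ?case by simp
  next
    case (Ought \<alpha> \<phi>)
    then show ?case by (simp add: dom_less_def cong: conj_cong)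
  next
    case (SOught \<alpha> \<phi>)
    then show ?case by (simp add: sdom_less_def cong: conj_cong)
  qed simp_all
qed

lemma soundness:
  assumes "derivable_R' \<phi>" "kiobt_model \<M>" "h \<in> hists_at \<M> m"
  shows "sat \<M> m h \<phi>"
  using assms
\<comment> \<open>Substitution passes to another valuation on the same frame, so the model has to
  vary in the induction.\<close>
proof (induction arbitrary: \<M> m h rule: derivable_from.induct)
  case (ax \<phi>)
  then show ?case by (meson kiobt_mod.axioms_sound kiobt_mod.intro)
next
  case (MP \<phi> \<psi>)
  then show ?case by fastforce
next
  case (US \<phi> \<sigma>)
  have "kiobt_model (\<M>\<lparr>Val := \<lambda>p. {(m, h) \<in> indices \<M>. sat \<M> m h (\<sigma> p)}\<rparr>)"
    using US.prems by (auto simp: kiobt_model_def)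
  then show ?case using US by (simp add: sat_subst_fm)
next
  case (nec_Box \<phi>)
  then show ?case by simp
next
  case (nec_Stit \<phi> \<alpha>)
  then interpret kiobt_mod \<M> by unfold_locales
  show ?case using nec_Stit choice_cell_cell(1) by simp
next
  case (nec_Know \<phi> \<alpha>)
  then interpret kiobt_mod \<M> by unfold_locales
  show ?case using nec_Know Indist_indices by simp
next
  case (nec_Bel \<phi> \<alpha>)
  then interpret kiobt_mod \<M> by unfold_locales
  show ?case
    by (rule sat_Bel_topspace[OF nec_Bel(4)])
      (use topspace_subset_indices[OF nec_Bel(4)] nec_Bel(2,3) index_iff in blast)
next
  case (nec_Ought \<phi> \<alpha>)
  then interpret kiobt_mod \<M> by unfold_locales
  show ?case unfolding sat_Ought_obligatory
    using nec_Ought Choice_subset hists_at_Mom by (intro obligatory_all) blast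
next
  case (nec_SOught \<phi> \<alpha>)
  then interpret kiobt_mod \<M> by unfold_locales
  show ?case unfolding sat_SOught_obligatory epi_cluster_def
    using nec_SOught by (intro obligatory_all) blast
qed

section \<open>Branching-time models from Kripke structures\<close>

text \<open>Here \<open>le\<close> has two levels. A choice with \<open>q\<close> is never strictly
  dominated and so must itself satisfy \<open>P\<close>; a choice without \<open>q\<close> is
  strictly dominated by any choice with \<open>q\<close>, and above the latter there are only
  choices with \<open>q\<close>.\<close>

lemma obligatory_image_iff:
  assumes "\<And>u v. u \<in> I \<Longrightarrow> v \<in> I \<Longrightarrow> le (f u) (f v) \<longleftrightarrow> (q u \<longrightarrow> q v)" "\<exists>u\<in>I. q u"
  shows "obligatory (f ` I) le P \<longleftrightarrow> (\<forall>u\<in>I. q u \<longrightarrow> P (f u))"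
  unfolding obligatory_def using assms by auto

text \<open>The frame built below consists of two-element histories \<open>{mo w, pt w}\<close>: the moment \<open>mo w\<close>
  is shared exactly by the worlds that are equivalent under \<open>Bx\<close>, and \<open>pt w\<close> is a moment above it
  that belongs to a single history. \<open>Opt \<alpha>\<close>, \<open>SOpt \<alpha>\<close> and \<open>Comp \<alpha>\<close> mark the worlds that are optimal for
  \<open>\<alpha>\<close>, subjectively optimal for \<open>\<alpha>\<close> and compatible with the beliefs of \<open>\<alpha>\<close>.\<close>

locale kripke =
  fixes W :: "'w set" and Bx :: "('w \<times> 'w) set" and St Kn :: "'a::finite \<Rightarrow> ('w \<times> 'w) set"
    and Opt SOpt Comp :: "'a \<Rightarrow> 'w \<Rightarrow> bool" and V :: "'p \<Rightarrow> 'w set" and mo pt :: "'w \<Rightarrow> 'm"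
  assumes W_nonempty: "W \<noteq> {}"
    and equiv_Bx: "equiv W Bx" and equiv_St: "equiv W (St \<alpha>)" and equiv_Kn: "equiv W (Kn \<alpha>)"
    and St_Bx: "St \<alpha> \<subseteq> Bx" and St_Kn: "St \<alpha> \<subseteq> Kn \<alpha>"
    and independence: "(\<And>\<alpha>. (w, u \<alpha>) \<in> Bx) \<Longrightarrow> \<exists>x. \<forall>\<alpha>. (u \<alpha>, x) \<in> St \<alpha>"
    and uniformity: "(w, v) \<in> Kn \<alpha> \<Longrightarrow> (w, w') \<in> Bx \<Longrightarrow> \<exists>v'. (v, v') \<in> Bx \<and> (w', v') \<in> Kn \<alpha>"
    and Opt_St: "(w, v) \<in> St \<alpha> \<Longrightarrow> Opt \<alpha> w \<Longrightarrow> Opt \<alpha> v"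
    and Opt_ex: "w \<in> W \<Longrightarrow> \<exists>v. (w, v) \<in> Bx \<and> Opt \<alpha> v"
    and SOpt_Kn: "(w, v) \<in> Kn \<alpha> \<Longrightarrow> SOpt \<alpha> w \<Longrightarrow> SOpt \<alpha> v"
    and SOpt_ex: "w \<in> W \<Longrightarrow> \<exists>v. (w, v) \<in> Bx \<and> SOpt \<alpha> v"
    and Comp_ex: "w \<in> W \<Longrightarrow> \<exists>v. (w, v) \<in> Kn \<alpha> O Bx \<and> Comp \<alpha> v"
    and mo_eq: "w \<in> W \<Longrightarrow> v \<in> W \<Longrightarrow> mo w = mo v \<longleftrightarrow> (w, v) \<in> Bx"
    and pt_inj: "w \<in> W \<Longrightarrow> v \<in> W \<Longrightarrow> pt w = pt v \<longleftrightarrow> w = v"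
    and mo_pt: "w \<in> W \<Longrightarrow> v \<in> W \<Longrightarrow> mo w \<noteq> pt v"
begin

text \<open>Belief and the oughts are boxes over a class of worlds cut down by a property of the
  target. \<open>Kn \<alpha> O Bx\<close> stands for the ex ante information of \<alpha>.\<close>

primrec ksat :: "'w \<Rightarrow> ('p, 'a) fm \<Rightarrow> bool" where
  "ksat w (Atom p) \<longleftrightarrow> w \<in> V p"
| "ksat w (Neg \<phi>) \<longleftrightarrow> \<not> ksat w \<phi>"
| "ksat w (Conj \<phi> \<psi>) \<longleftrightarrow> ksat w \<phi> \<and> ksat w \<psi>"
| "ksat w (Box \<phi>) \<longleftrightarrow> (\<forall>v. (w, v) \<in> Bx \<longrightarrow> ksat v \<phi>)"
| "ksat w (Stit \<alpha> \<phi>) \<longleftrightarrow> (\<forall>v. (w, v) \<in> St \<alpha> \<longrightarrow> ksat v \<phi>)"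
| "ksat w (Know \<alpha> \<phi>) \<longleftrightarrow> (\<forall>v. (w, v) \<in> Kn \<alpha> \<longrightarrow> ksat v \<phi>)"
| "ksat w (Bel \<alpha> \<phi>) \<longleftrightarrow> (\<forall>v. (w, v) \<in> Kn \<alpha> O Bx \<longrightarrow> Comp \<alpha> v \<longrightarrow> ksat v \<phi>)"
| "ksat w (Ought \<alpha> \<phi>) \<longleftrightarrow> (\<forall>v. (w, v) \<in> Bx \<longrightarrow> Opt \<alpha> v \<longrightarrow> ksat v \<phi>)"
| "ksat w (SOught \<alpha> \<phi>) \<longleftrightarrow> (\<forall>v. (w, v) \<in> Kn \<alpha> O Bx \<longrightarrow> SOpt \<alpha> v \<longrightarrow> ksat v \<phi>)"

lemma Bx_refl: "w \<in> W \<Longrightarrow> (w, w) \<in> Bx"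
  using equiv_Bx by (simp add: equiv_def refl_on_def)
lemma Bx_sym: "(w, v) \<in> Bx \<Longrightarrow> (v, w) \<in> Bx"
  using equiv_Bx by (simp add: equiv_def sym_def)
lemma Bx_trans: "(w, v) \<in> Bx \<Longrightarrow> (v, u) \<in> Bx \<Longrightarrow> (w, u) \<in> Bx"
  using equiv_Bx unfolding equiv_def trans_def by blast
lemma Bx_W: "(w, v) \<in> Bx \<Longrightarrow> w \<in> W \<and> v \<in> W"
  using equiv_Bx by (auto simp: equiv_def)
lemma St_refl: "w \<in> W \<Longrightarrow> (w, w) \<in> St \<alpha>"
  using equiv_St[of \<alpha>] by (simp add: equiv_def refl_on_def)
lemma St_sym: "(w, v) \<in> St \<alpha> \<Longrightarrow> (v, w) \<in> St \<alpha>"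
  using equiv_St[of \<alpha>] by (simp add: equiv_def sym_def)
lemma St_trans: "(w, v) \<in> St \<alpha> \<Longrightarrow> (v, u) \<in> St \<alpha> \<Longrightarrow> (w, u) \<in> St \<alpha>"
  using equiv_St[of \<alpha>] unfolding equiv_def trans_def by blast
lemma Kn_refl: "w \<in> W \<Longrightarrow> (w, w) \<in> Kn \<alpha>"
  using equiv_Kn[of \<alpha>] by (simp add: equiv_def refl_on_def)
lemma Kn_sym: "(w, v) \<in> Kn \<alpha> \<Longrightarrow> (v, w) \<in> Kn \<alpha>"
  using equiv_Kn[of \<alpha>] by (simp add: equiv_def sym_def)
lemma Kn_trans: "(w, v) \<in> Kn \<alpha> \<Longrightarrow> (v, u) \<in> Kn \<alpha> \<Longrightarrow> (w, u) \<in> Kn \<alpha>"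
  using equiv_Kn[of \<alpha>] unfolding equiv_def trans_def by blast
lemma Kn_W: "(w, v) \<in> Kn \<alpha> \<Longrightarrow> w \<in> W \<and> v \<in> W"
  using equiv_Kn[of \<alpha>] by (auto simp: equiv_def)
lemma St_W: "(w, v) \<in> St \<alpha> \<Longrightarrow> w \<in> W \<and> v \<in> W"
  using equiv_St[of \<alpha>] by (auto simp: equiv_def)

lemma St_iff: "(w, v) \<in> St \<alpha> \<Longrightarrow> (w, x) \<in> St \<alpha> \<longleftrightarrow> (v, x) \<in> St \<alpha>"
  using St_sym St_trans by metis

lemma Kn_iff: "(w, v) \<in> Kn \<alpha> \<Longrightarrow> (w, x) \<in> Kn \<alpha> \<longleftrightarrow> (v, x) \<in> Kn \<alpha>"
  using Kn_sym Kn_trans by metis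

lemma Bx_iff: "(w, v) \<in> Bx \<Longrightarrow> (w, x) \<in> Bx \<longleftrightarrow> (v, x) \<in> Bx"
  using Bx_sym Bx_trans by metis

text \<open>Uniformity makes the two equivalences commute, so that their composition is again an
  equivalence.\<close>

lemma Kn_Bx_swap: "(w, x) \<in> Bx \<Longrightarrow> (x, v) \<in> Kn \<alpha> \<Longrightarrow> (w, v) \<in> Kn \<alpha> O Bx"
  using uniformity[of x v \<alpha> w] Bx_sym by blast

lemma Kn_Bx_cancel:
  assumes "(w, v) \<in> Kn \<alpha> O Bx" "(w, u) \<in> Bx"
  shows "\<exists>x. (u, x) \<in> Kn \<alpha> \<and> (v, x) \<in> Bx"
proof -
  obtain k where k: "(w, k) \<in> Kn \<alpha>" "(k, v) \<in> Bx" using assms(1) by blast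
  obtain x where "(k, x) \<in> Bx" "(u, x) \<in> Kn \<alpha>" using uniformity[OF k(1) assms(2)] by blast
  then show ?thesis using Bx_iff[OF k(2)] by blast
qed

section \<open>The tree and its histories\<close>

definition hist :: "'w \<Rightarrow> 'm set" where "hist w = {mo w, pt w}"

text \<open>The topologies live on ex ante information, which is computed from the other components;
  hence a first stage without them, whose \<open>undefined\<close> is replaced in
  \<open>tree\<close>. At the upper moments every agent has a single vacuous choice and can tell the
  index from all others.\<close>

definition pretree :: "('m, 'a, 'p) model" where
  "pretree = \<lparr>Mom = mo ` W \<union> pt ` W,
    prec = (\<lambda>a b. \<exists>w\<in>W. a = mo w \<and> b = pt w),
    Choice = (\<lambda>\<alpha> m. if m \<in> mo ` W then {hist ` (St \<alpha> `` {u}) |u. u \<in> W \<and> mo u = m}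
      else {{h \<in> hist ` W. m \<in> h}}),
    Indist = (\<lambda>\<alpha>. (\<lambda>(w, v). ((mo w, hist w), (mo v, hist v))) ` Kn \<alpha> \<union>
      (\<lambda>w. ((pt w, hist w), (pt w, hist w))) ` W),
    Topol = undefined,
    Value_O = (\<lambda>h. real (card {\<alpha>. \<exists>w\<in>W. h = hist w \<and> Opt \<alpha> w})),
    Value_S = (\<lambda>h. real (card {\<alpha>. \<exists>w\<in>W. h = hist w \<and> SOpt \<alpha> w})),
    Val = (\<lambda>p. (\<lambda>w. (mo w, hist w)) ` (V p \<inter> W))\<rparr>"

text \<open>The least nonempty open set at an index. At an upper moment it is the whole one-point
  space, so it is not empty there; at a lower moment \<open>Comp_ex\<close> guarantees this.\<close>

definition core :: "'a \<Rightarrow> 'm index \<Rightarrow> 'm index set" where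
  "core \<alpha> i = {(m, h) \<in> ex_ante_info pretree \<alpha> i. m \<in> pt ` W \<or> (\<exists>w\<in>W. h = hist w \<and> Comp \<alpha> w)}"

text \<open>Nonempty open sets all contain \<open>core\<close>, whence CI, and the topology is a
  function of the ex ante information, whence KI.\<close>

definition tree :: "('m, 'a, 'p) model" where
  "tree = pretree\<lparr>Topol := \<lambda>\<alpha> i.
    topology (\<lambda>U. U = {} \<or> core \<alpha> i \<subseteq> U \<and> U \<subseteq> ex_ante_info pretree \<alpha> i)\<rparr>"

lemma ex_ante_info_tree: "ex_ante_info pretree = ex_ante_info tree"
  by (simp add: fun_eq_iff ex_ante_info_def tree_def indices_def hists_at_def histories_def)

lemma tree_sel [simp]:
  "Mom tree = mo ` W \<union> pt ` W"
  "prec tree = (\<lambda>a b. \<exists>w\<in>W. a = mo w \<and> b = pt w)"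
  "Indist tree \<alpha> = (\<lambda>(w, v). ((mo w, hist w), (mo v, hist v))) ` Kn \<alpha> \<union>
      (\<lambda>w. ((pt w, hist w), (pt w, hist w))) ` W"
  "Value_O tree = (\<lambda>h. real (card {\<alpha>. \<exists>w\<in>W. h = hist w \<and> Opt \<alpha> w}))"
  "Value_S tree = (\<lambda>h. real (card {\<alpha>. \<exists>w\<in>W. h = hist w \<and> SOpt \<alpha> w}))"
  "Val tree p = (\<lambda>w. (mo w, hist w)) ` (V p \<inter> W)"
  by (simp_all add: tree_def pretree_def)

lemma openin_tree:
  "openin (Topol tree \<alpha> i) U \<longleftrightarrow> U = {} \<or> core \<alpha> i \<subseteq> U \<and> U \<subseteq> ex_ante_info tree \<alpha> i"
proof -
  let ?T = "\<lambda>U. U = {} \<or> core \<alpha> i \<subseteq> U \<and> U \<subseteq> ex_ante_info pretree \<alpha> i"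
  have "istopology ?T"
    unfolding istopology_def
  proof (intro conjI allI impI)
    show "?T (S \<inter> T)" if "?T S" "?T T" for S T using that by blast
    show "?T (\<Union>\<K>)" if "\<forall>K\<in>\<K>. ?T K" for \<K>
    proof (cases "\<Union>\<K> = {}")
      case False
      then obtain K where "K \<in> \<K>" "K \<noteq> {}" by blast
      then have "core \<alpha> i \<subseteq> \<Union>\<K>" using that by blast
      moreover have "\<Union>\<K> \<subseteq> ex_ante_info pretree \<alpha> i" using that by blast
      ultimately show ?thesis by blast
    qed simp
  qed
  then have "openin (topology ?T) = ?T" by (rule topology_inverse')
  moreover have "Topol tree \<alpha> i = topology ?T" by (simp add: tree_def)
  ultimately show ?thesis unfolding ex_ante_info_tree[symmetric] by simp
qed

text \<open>The upper moment identifies the world; \<open>mo_pt\<close> rules out that the two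
  moments exchange roles.\<close>

lemma hist_eq [simp]: "w \<in> W \<Longrightarrow> v \<in> W \<Longrightarrow> hist w = hist v \<longleftrightarrow> w = v"
  unfolding hist_def using mo_pt pt_inj by (metis doubleton_eq_iff)

lemma hist_image_iff [simp]: "w \<in> W \<Longrightarrow> A \<subseteq> W \<Longrightarrow> hist w \<in> hist ` A \<longleftrightarrow> w \<in> A"
  using hist_eq by blast

lemma mo_in_hist: "w \<in> W \<Longrightarrow> v \<in> W \<Longrightarrow> mo w \<in> hist v \<longleftrightarrow> (w, v) \<in> Bx"
  unfolding hist_def using mo_pt mo_eq by auto

lemma pt_in_hist: "w \<in> W \<Longrightarrow> v \<in> W \<Longrightarrow> pt w \<in> hist v \<longleftrightarrow> w = v"
  unfolding hist_def using mo_pt pt_inj by force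

lemma prec_mo_pt: "w \<in> W \<Longrightarrow> prec tree (mo w) (pt w)"
  by auto

text \<open>A chain through \<open>pt w\<close> stays inside \<open>hist w\<close>, and a chain
  without upper moments has at most one element, since lower moments are pairwise
  incomparable.\<close>

lemma histories_tree: "histories tree = hist ` W"
proof
  have chain: "pred_on.chain (Mom tree) (prec tree) (hist w)" if "w \<in> W" for w
    unfolding pred_on.chain_def hist_def using that prec_mo_pt[OF that] by auto
  have comparable: "x = y \<or> prec tree x y \<or> prec tree y x"
    if "pred_on.chain (Mom tree) (prec tree) C" "x \<in> C" "y \<in> C" for C x y
    using that unfolding pred_on.chain_def by blast
  have subset: "C \<subseteq> hist w" if C: "pred_on.chain (Mom tree) (prec tree) C" and w: "pt w \<in> C" "w \<in> W" for C w
  proof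
    fix x assume "x \<in> C"
    then consider "x = pt w" | "prec tree x (pt w)" | "prec tree (pt w) x" using comparable C w by blast
    then show "x \<in> hist w"
    proof cases
      case 3
      then show ?thesis using mo_pt w(2) by fastforce
    qed (use pt_inj w(2) in \<open>auto simp: hist_def\<close>)
  qed
  show "hist ` W \<subseteq> histories tree"
  proof
    fix h assume "h \<in> hist ` W"
    then obtain w where w: "w \<in> W" "h = hist w" by blast
    have "\<not> hist w \<subset> S" if "pred_on.chain (Mom tree) (prec tree) S" for S
    proof
      assume "hist w \<subset> S"
      moreover from this have "S \<subseteq> hist w" using subset[OF that _ w(1)] by (auto simp: hist_def)
      ultimately show False by blast
    qed
    then show "h \<in> histories tree"
      unfolding histories_def pred_on.maxchain_def using w chain by blast
  qed
  show "histories tree \<subseteq> hist ` W"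
  proof
    fix C assume "C \<in> histories tree"
    then have C: "pred_on.chain (Mom tree) (prec tree) C"
        and max: "\<And>S. pred_on.chain (Mom tree) (prec tree) S \<Longrightarrow> \<not> C \<subset> S"
      unfolding histories_def pred_on.maxchain_def by blast+
    obtain w0 where w0: "w0 \<in> W" using W_nonempty by blast
    have "C \<noteq> {}" using max[OF chain[OF w0]] by (auto simp: hist_def)
    have "\<exists>w\<in>W. C \<subseteq> hist w"
    proof (cases "\<exists>w\<in>W. pt w \<in> C")
      case True
      then show ?thesis using subset[OF C] by blast
    next
      case False
      have C': "C \<subseteq> Mom tree" using C unfolding pred_on.chain_def by blast
      then obtain w where w: "w \<in> W" "mo w \<in> C" using \<open>C \<noteq> {}\<close> False by auto
      have "x = mo w" if "x \<in> C" for x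
      proof (rule ccontr)
        assume "x \<noteq> mo w"
        then have "prec tree x (mo w) \<or> prec tree (mo w) x" using comparable[OF C that w(2)] by blast
        then show False using False that w mo_pt by auto
      qed
      then show ?thesis using w by (auto simp: hist_def)
    qed
    then show "C \<in> hist ` W" using max chain by blast
  qed
qed

lemma hists_at_mo: "w \<in> W \<Longrightarrow> hists_at tree (mo w) = hist ` (Bx `` {w})"
  unfolding hists_at_def histories_tree using mo_in_hist Bx_W by blast

lemma hists_at_pt: "w \<in> W \<Longrightarrow> hists_at tree (pt w) = {hist w}"
  unfolding hists_at_def histories_tree using pt_in_hist by auto

lemma indices_tree: "(m, h) \<in> indices tree \<longleftrightarrow> (\<exists>w\<in>W. h = hist w \<and> (m = mo w \<or> m = pt w))"
proof
  assume "(m, h) \<in> indices tree"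
  then have "h \<in> histories tree" "m \<in> h" by (auto simp: indices_def hists_at_def)
  then show "\<exists>w\<in>W. h = hist w \<and> (m = mo w \<or> m = pt w)" unfolding histories_tree hist_def by blast
next
  assume "\<exists>w\<in>W. h = hist w \<and> (m = mo w \<or> m = pt w)"
  then show "(m, h) \<in> indices tree"
    by (auto simp: indices_def hists_at_def histories_tree) (auto simp: hist_def)
qed

lemma index_cases:
  assumes "i \<in> indices tree"
  obtains (mo) w where "w \<in> W" "i = (mo w, hist w)" | (pt) w where "w \<in> W" "i = (pt w, hist w)"
  using assms by (cases i) (auto simp: indices_tree)

lemma Choice_mo: "w \<in> W \<Longrightarrow> Choice tree \<alpha> (mo w) = (\<lambda>u. hist ` (St \<alpha> `` {u})) ` (Bx `` {w})"
  using mo_eq Bx_W by (auto simp: tree_def pretree_def) (metis Bx_sym Image_singleton_iff image_eqI)+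

lemma Choice_pt: "w \<in> W \<Longrightarrow> Choice tree \<alpha> (pt w) = {{hist w}}"
proof -
  assume w: "w \<in> W"
  have "pt w \<notin> mo ` W" using mo_pt w by force
  moreover have "{h \<in> hist ` W. pt w \<in> h} = {hist w}" using pt_in_hist w by auto
  ultimately show ?thesis by (simp add: tree_def pretree_def)
qed

section \<open>Frame conditions of the tree\<close>

lemma partition_tree:
  assumes "m \<in> Mom tree"
  shows "partition_on (hists_at tree m) (Choice tree \<alpha> m)"
proof -
  consider w where "w \<in> W" "m = mo w" | w where "w \<in> W" "m = pt w" using assms by auto
  then show ?thesis
  proof cases
    case (1 w)
    show ?thesis
      unfolding 1(2) hists_at_mo[OF 1(1)] Choice_mo[OF 1(1)]
    proof (rule partition_onI)
      show "\<Union> ((\<lambda>u. hist ` St \<alpha> `` {u}) ` (Bx `` {w})) = hist ` (Bx `` {w})"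
      proof -
        have "(\<Union>u\<in>Bx `` {w}. St \<alpha> `` {u}) = Bx `` {w}"
        proof (intro subset_antisym subsetI)
          fix x assume "x \<in> (\<Union>u\<in>Bx `` {w}. St \<alpha> `` {u})"
          then obtain u where "(w, u) \<in> Bx" "(u, x) \<in> St \<alpha>" by blast
          then show "x \<in> Bx `` {w}" using St_Bx[of \<alpha>] Bx_trans[of w u x] by blast
        next
          fix x assume "x \<in> Bx `` {w}"
          then show "x \<in> (\<Union>u\<in>Bx `` {w}. St \<alpha> `` {u})" using St_refl[of x \<alpha>] Bx_W by blast
        qed
        then show ?thesis by (metis image_UN)
      qed
      show "{} \<notin> (\<lambda>u. hist ` St \<alpha> `` {u}) ` (Bx `` {w})"
        using St_refl[of _ \<alpha>] Bx_W by blast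
      show "disjnt p q" if pq: "p \<in> (\<lambda>u. hist ` St \<alpha> `` {u}) ` (Bx `` {w})"
          "q \<in> (\<lambda>u. hist ` St \<alpha> `` {u}) ` (Bx `` {w})" "p \<noteq> q" for p q
      proof -
        obtain u v where uv: "p = hist ` St \<alpha> `` {u}" "q = hist ` St \<alpha> `` {v}" using pq by blast
        have "St \<alpha> `` {u} = St \<alpha> `` {v}" if "x \<in> p" "x \<in> q" for x
        proof -
          from that uv obtain y z where yz: "(u, y) \<in> St \<alpha>" "(v, z) \<in> St \<alpha>" "hist y = hist z"
            by auto
          then have "y = z" using St_W hist_eq by metis
          then show ?thesis using yz St_iff by blast
        qed
        then show ?thesis using uv pq(3) unfolding disjnt_def by blast
      qed
    qed
  next
    case (2 w)
    show ?thesis unfolding 2(2) hists_at_pt[OF 2(1)] Choice_pt[OF 2(1)]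
      by (simp add: partition_on_def)
  qed
qed

lemma choice_cell_mo:
  assumes w: "w \<in> W"
  shows "choice_cell tree \<alpha> (mo w) (hist w) = hist ` (St \<alpha> `` {w})"
  unfolding choice_cell_def Choice_mo[OF w]
proof (rule the_equality)
  show "hist ` St \<alpha> `` {w} \<in> (\<lambda>u. hist ` St \<alpha> `` {u}) ` Bx `` {w} \<and> hist w \<in> hist ` St \<alpha> `` {w}"
    using w Bx_refl St_refl by blast
  show "L = hist ` St \<alpha> `` {w}"
    if "L \<in> (\<lambda>u. hist ` St \<alpha> `` {u}) ` Bx `` {w} \<and> hist w \<in> L" for L
  proof -
    from that obtain u where u: "L = hist ` St \<alpha> `` {u}" "hist w \<in> hist ` St \<alpha> `` {u}" by auto
    then obtain y where "(u, y) \<in> St \<alpha>" "hist w = hist y" by blast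
    then have "(u, w) \<in> St \<alpha>" using St_W w hist_eq by metis
    then show ?thesis using u(1) St_iff by blast
  qed
qed

lemma choice_cell_pt: "w \<in> W \<Longrightarrow> choice_cell tree \<alpha> (pt w) (hist w) = {hist w}"
  unfolding choice_cell_def Choice_pt by (rule the_equality) auto

lemma Indist_tree_iff: "((m, h), j) \<in> Indist tree \<alpha> \<longleftrightarrow>
    (\<exists>x v. (x, v) \<in> Kn \<alpha> \<and> m = mo x \<and> h = hist x \<and> j = (mo v, hist v)) \<or>
    (\<exists>x\<in>W. m = pt x \<and> h = hist x \<and> j = (pt x, hist x))"
  unfolding tree_sel by force

lemma Indist_mo:
  assumes "w \<in> W"
  shows "((mo w, hist w), j) \<in> Indist tree \<alpha> \<longleftrightarrow> (\<exists>v. (w, v) \<in> Kn \<alpha> \<and> j = (mo v, hist v))"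
proof -
  have "x = w" if "(x, v) \<in> Kn \<alpha>" "hist w = hist x" for x v
    using that assms Kn_W hist_eq by metis
  then show ?thesis unfolding Indist_tree_iff using mo_pt[OF assms] by blast
qed

lemma Indist_pt:
  assumes "w \<in> W"
  shows "((pt w, hist w), j) \<in> Indist tree \<alpha> \<longleftrightarrow> j = (pt w, hist w)"
proof -
  have "pt w \<noteq> mo x" if "(x, v) \<in> Kn \<alpha>" for x v
    using that assms Kn_W mo_pt by metis
  then show ?thesis unfolding Indist_tree_iff using assms pt_inj[OF assms] by blast
qed

lemma equiv_Indist: "equiv (indices tree) (Indist tree \<alpha>)"
proof (rule equivI)
  show "Indist tree \<alpha> \<subseteq> indices tree \<times> indices tree"
    using Kn_W by (auto simp: indices_tree)
  show "refl_on (indices tree) (Indist tree \<alpha>)"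
  proof (rule refl_onI)
    fix i assume "i \<in> indices tree"
    then show "(i, i) \<in> Indist tree \<alpha>"
      by (cases rule: index_cases) (simp_all only: Indist_mo Indist_pt, use Kn_refl in blast)
  qed
  show "sym (Indist tree \<alpha>)"
    using Kn_sym by (force simp: sym_def)
  show "trans (Indist tree \<alpha>)"
  proof (rule transI)
    fix i j k assume ij: "(i, j) \<in> Indist tree \<alpha>" and jk: "(j, k) \<in> Indist tree \<alpha>"
    have "i \<in> indices tree" using ij Kn_W by (auto simp: indices_tree)
    then show "(i, k) \<in> Indist tree \<alpha>"
    proof (cases rule: index_cases)
      case (mo w)
      then obtain v where v: "(w, v) \<in> Kn \<alpha>" "j = (mo v, hist v)" using ij Indist_mo by blast
      then have "v \<in> W" using Kn_W by blast
      then obtain u where "(v, u) \<in> Kn \<alpha>" "k = (mo u, hist u)" using jk v Indist_mo by blast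
      then show ?thesis using mo v Kn_trans Indist_mo by metis
    next
      case (pt w)
      then show ?thesis using ij jk Indist_pt by simp
    qed
  qed
qed

lemma ex_ante_info_mo:
  assumes "w \<in> W"
  shows "ex_ante_info tree \<alpha> (mo w, hist w) = (\<lambda>v. (mo v, hist v)) ` ((Kn \<alpha> O Bx) `` {w})"
proof (rule set_eqI)
  fix j :: "'m index"
  obtain m h where j: "j = (m, h)" by fastforce
  have "(\<exists>h''\<in>hists_at tree m. ((mo w, hist w), (m, h'')) \<in> Indist tree \<alpha>) \<longleftrightarrow>
      (\<exists>v. (w, v) \<in> Kn \<alpha> \<and> m = mo v)"
  proof -
    have "hist v \<in> hists_at tree (mo v)" if "(w, v) \<in> Kn \<alpha>" for v
      using that Kn_W Bx_refl hists_at_mo by blast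
    then show ?thesis unfolding Indist_mo[OF assms] by blast
  qed
  then have "j \<in> ex_ante_info tree \<alpha> (mo w, hist w) \<longleftrightarrow>
      (m, h) \<in> indices tree \<and> (\<exists>v. (w, v) \<in> Kn \<alpha> \<and> m = mo v)"
    unfolding ex_ante_info_def j by blast
  also have "\<dots> \<longleftrightarrow> (\<exists>u v. u \<in> W \<and> (w, v) \<in> Kn \<alpha> \<and> h = hist u \<and> m = mo u \<and> mo u = mo v)"
    unfolding indices_tree using mo_pt Kn_W by metis
  also have "\<dots> \<longleftrightarrow> (\<exists>u v. (w, v) \<in> Kn \<alpha> \<and> h = hist u \<and> m = mo u \<and> (v, u) \<in> Bx)"
    using mo_eq Kn_W Bx_W by metis
  finally show "j \<in> ex_ante_info tree \<alpha> (mo w, hist w) \<longleftrightarrow>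
      j \<in> (\<lambda>v. (mo v, hist v)) ` ((Kn \<alpha> O Bx) `` {w})"
    unfolding j by blast
qed

lemma ex_ante_info_pt: "w \<in> W \<Longrightarrow> ex_ante_info tree \<alpha> (pt w, hist w) = {(pt w, hist w)}"
  unfolding ex_ante_info_def Indist_pt using hists_at_pt by (auto simp: indices_def)

lemma core_mo:
  assumes "w \<in> W"
  shows "core \<alpha> (mo w, hist w) = (\<lambda>v. (mo v, hist v)) ` {v. (w, v) \<in> Kn \<alpha> O Bx \<and> Comp \<alpha> v}"
proof -
  have "(mo v \<in> pt ` W \<or> (\<exists>w\<in>W. hist v = hist w \<and> Comp \<alpha> w)) \<longleftrightarrow> Comp \<alpha> v" if "(w, v) \<in> Kn \<alpha> O Bx" for v
  proof -
    have v: "v \<in> W" using that Bx_W by blast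
    then show ?thesis using mo_pt hist_eq by (metis imageE)
  qed
  then show ?thesis unfolding core_def ex_ante_info_tree ex_ante_info_mo[OF assms] by blast
qed

lemma core_nonempty:
  assumes "i \<in> indices tree"
  shows "core \<alpha> i \<noteq> {}"
  using assms
proof (cases rule: index_cases)
  case (mo w)
  then show ?thesis unfolding mo(2) core_mo[OF mo(1)] using Comp_ex[OF mo(1)] by simp
next
  case (pt w)
  then show ?thesis unfolding pt(2) core_def ex_ante_info_tree ex_ante_info_pt[OF pt(1)] by auto
qed

lemma IA_tree: "cond_IA tree"
  unfolding cond_IA_def
proof (intro ballI)
  fix m s assume m: "m \<in> Mom tree" and s: "s \<in> Select tree m"
  consider w where "w \<in> W" "m = mo w" | w where "w \<in> W" "m = pt w" using m by auto
  then show "(\<Inter>\<alpha>. s \<alpha>) \<noteq> {}"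
  proof cases
    case (1 w)
    then have "\<forall>\<alpha>. \<exists>u. (w, u) \<in> Bx \<and> s \<alpha> = hist ` (St \<alpha> `` {u})"
      using s unfolding Select_def 1(2) Choice_mo[OF 1(1)] by blast
    then obtain u where u: "\<And>\<alpha>. (w, u \<alpha>) \<in> Bx" "\<And>\<alpha>. s \<alpha> = hist ` (St \<alpha> `` {u \<alpha>})" by metis
    obtain x where "\<And>\<alpha>. (u \<alpha>, x) \<in> St \<alpha>" using independence[of w u] u(1) by blast
    then show ?thesis using u(2) by blast
  next
    case (2 w)
    then show ?thesis using s by (simp add: Select_def Choice_pt)
  qed
qed

lemma kiobt_frame_tree: "kiobt_frame tree"
proof -
  have "branching_time tree"
    unfolding branching_time_def
  proof (intro conjI)
    show "irreflp_on (Mom tree) (prec tree)" using mo_pt by (auto simp: irreflp_on_def)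
    show "transp_on (Mom tree) (prec tree)" unfolding transp_on_def using mo_pt by fastforce
    show "\<forall>m\<in>Mom tree. \<forall>m1\<in>Mom tree. \<forall>m2\<in>Mom tree.
       prec tree m1 m \<and> prec tree m2 m \<longrightarrow> prec tree m1 m2 \<or> m1 = m2 \<or> prec tree m2 m1"
      unfolding tree_sel(2) using pt_inj by metis
  qed (use W_nonempty in simp)
  moreover have "cond_NC tree"
    unfolding cond_NC_def
  proof (intro ballI impI allI)
    fix m h h' \<alpha> assume h: "h \<in> hists_at tree m" "h' \<in> hists_at tree m"
      and "\<exists>m'\<in>h \<inter> h'. prec tree m m'"
    \<comment> \<open>A moment with a predecessor is some \<open>pt w\<close> and lies on one
      history only, so NC compares a history with itself.\<close>
    then obtain w where w: "w \<in> W" "pt w \<in> h" "pt w \<in> h'" by auto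
    obtain u v where "u \<in> W" "h = hist u" "v \<in> W" "h' = hist v"
      using h unfolding hists_at_def histories_tree by blast
    then have "h = h'" using w pt_in_hist by blast
    then show "choice_cell tree \<alpha> m h = choice_cell tree \<alpha> m h'" by simp
  qed
  moreover have "cond_OAC tree"
    unfolding cond_OAC_def
  proof (intro allI impI ballI)
    fix \<alpha> m1 h1 m h h1'
    assume rel: "((m1, h1), (m, h)) \<in> Indist tree \<alpha>" and h1': "h1' \<in> choice_cell tree \<alpha> m1 h1"
    have "(m1, h1) \<in> indices tree" using rel equiv_Indist[of \<alpha>] by (auto simp: equiv_def)
    then show "((m1, h1'), (m, h)) \<in> Indist tree \<alpha>"
    proof (cases rule: index_cases)
      case (mo w)
      then obtain u where u: "(w, u) \<in> St \<alpha>" "h1' = hist u" using h1' choice_cell_mo by blast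
      have uW: "u \<in> W" and mo': "mo w = mo u" using u St_W mo_eq St_Bx by blast+
      obtain v where v: "(w, v) \<in> Kn \<alpha>" "(m, h) = (mo v, hist v)" using rel mo Indist_mo by auto
      have "(u, v) \<in> Kn \<alpha>" using Kn_iff u(1) St_Kn v(1) by blast
      then have "((mo u, hist u), (m, h)) \<in> Indist tree \<alpha>" using Indist_mo[OF uW] v by blast
      then show ?thesis using mo mo' u by simp
    next
      case (pt w)
      then show ?thesis using rel h1' choice_cell_pt by simp
    qed
  qed
  moreover have "cond_UnifH tree"
    unfolding cond_UnifH_def
  proof (intro allI impI ballI)
    fix \<alpha> m1 h1 m h h1'
    assume rel: "((m1, h1), (m, h)) \<in> Indist tree \<alpha>" and h1': "h1' \<in> hists_at tree m1"
    have "(m1, h1) \<in> indices tree" using rel equiv_Indist[of \<alpha>] by (auto simp: equiv_def)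
    then show "\<exists>h'\<in>hists_at tree m. ((m1, h1'), (m, h')) \<in> Indist tree \<alpha>"
    proof (cases rule: index_cases)
      case (mo w)
      then obtain u where u: "(w, u) \<in> Bx" "h1' = hist u" using h1' hists_at_mo by blast
      have uW: "u \<in> W" and mo': "mo w = mo u" using u Bx_W mo_eq by blast+
      obtain v where v: "(w, v) \<in> Kn \<alpha>" "m = mo v" "h = hist v" using rel mo Indist_mo by auto
      obtain v' where v': "(v, v') \<in> Bx" "(u, v') \<in> Kn \<alpha>" using uniformity[OF v(1) u(1)] by blast
      have "v \<in> W" "v' \<in> W" "mo v = mo v'" using v'(1) Bx_W mo_eq by blast+
      then have "hist v' \<in> hists_at tree m" using v(2) v'(1) hists_at_mo by blast
      moreover have "((mo u, hist u), (mo v', hist v')) \<in> Indist tree \<alpha>"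
        using Indist_mo[OF uW] v'(2) by blast
      moreover have "m1 = mo u" "m = mo v'" using mo mo' v(2) \<open>mo v = mo v'\<close> by simp_all
      ultimately show ?thesis unfolding u(2) by blast
    next
      case (pt w)
      then show ?thesis using rel h1' hists_at_pt Indist_pt by simp
    qed
  qed
  moreover have "topspace (Topol tree \<alpha> i) = ex_ante_info tree \<alpha> i" for \<alpha> i
  proof -
    have "core \<alpha> i \<subseteq> ex_ante_info tree \<alpha> i" unfolding core_def ex_ante_info_tree by blast
    then show ?thesis unfolding topspace_def openin_tree by blast
  qed
  moreover have "cond_CI tree"
    unfolding cond_CI_def openin_tree
  proof (intro allI ballI impI)
    fix \<alpha> i U V assume "i \<in> indices tree"
      and UV: "(U = {} \<or> core \<alpha> i \<subseteq> U \<and> U \<subseteq> ex_ante_info tree \<alpha> i) \<and>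
          (V = {} \<or> core \<alpha> i \<subseteq> V \<and> V \<subseteq> ex_ante_info tree \<alpha> i) \<and> U \<noteq> {} \<and> V \<noteq> {}"
    then show "U \<inter> V \<noteq> {}" using core_nonempty by blast
  qed
  moreover have "cond_KI tree"
    unfolding cond_KI_def topology_eq openin_tree core_def ex_ante_info_tree by simp
  ultimately show ?thesis
    using partition_tree IA_tree equiv_Indist unfolding kiobt_frame_def by blast
qed

lemma kiobt_model_tree: "kiobt_model tree"
  unfolding kiobt_model_def using kiobt_frame_tree by (auto simp: indices_tree)

text \<open>Fixing the choices of the other agents fixes their contribution to the value, so that only the
  contribution of \<open>\<alpha>\<close> remains to be compared.\<close>

lemma val_le_State_iff:
  assumes w: "w \<in> W"
    and Q: "\<And>\<beta> x y. (x, y) \<in> St \<beta> \<Longrightarrow> Q \<beta> x \<Longrightarrow> Q \<beta> y"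
    and A: "A \<subseteq> Bx `` {w}" "A \<noteq> {}" "\<And>x. x \<in> A \<Longrightarrow> Q \<alpha> x \<longleftrightarrow> a"
    and B: "B \<subseteq> Bx `` {w}" "B \<noteq> {}" "\<And>x. x \<in> B \<Longrightarrow> Q \<alpha> x \<longleftrightarrow> b"
    and closed: "\<And>x y. x \<in> B \<Longrightarrow> (x, y) \<in> St \<alpha> \<Longrightarrow> y \<in> B"
  shows "(\<forall>S\<in>State tree \<alpha> (mo w). val_le (\<lambda>h. real (card {\<alpha>. \<exists>w\<in>W. h = hist w \<and> Q \<alpha> w}))
      (hist ` A \<inter> S) (hist ` B \<inter> S)) \<longleftrightarrow> (a \<longrightarrow> b)"
    (is "(\<forall>S\<in>_. val_le ?v _ _) \<longleftrightarrow> _")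
proof
  have v: "?v (hist x) = card {\<beta>. Q \<beta> x}" if "x \<in> W" for x
  proof -
    have "{\<beta>. \<exists>w\<in>W. hist x = hist w \<and> Q \<beta> w} = {\<beta>. Q \<beta> x}" using that by auto
    then show ?thesis by simp
  qed
  have AW: "A \<subseteq> W" and BW: "B \<subseteq> W" using A(1) B(1) Bx_W by blast+
  have Qiff: "Q \<beta> x \<longleftrightarrow> Q \<beta> y" if "(x, y) \<in> St \<beta>" for \<beta> x y using that Q St_sym by blast
  show "\<forall>S\<in>State tree \<alpha> (mo w). val_le ?v (hist ` A \<inter> S) (hist ` B \<inter> S)" if "a \<longrightarrow> b"
  proof
    fix S assume "S \<in> State tree \<alpha> (mo w)"
    then obtain s where s: "s \<in> Select tree (mo w)" "S = hists_at tree (mo w) \<inter> (\<Inter>\<beta>\<in>- {\<alpha>}. s \<beta>)"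
      unfolding State_def by blast
    have "card {\<beta>. Q \<beta> x} \<le> card {\<beta>. Q \<beta> y}"
      if x: "x \<in> A" "hist x \<in> S" and y: "y \<in> B" "hist y \<in> S" for x y
    proof (rule card_mono)
      show "{\<beta>. Q \<beta> x} \<subseteq> {\<beta>. Q \<beta> y}"
      proof safe
        fix \<beta> assume Qx: "Q \<beta> x"
        show "Q \<beta> y"
        proof (cases "\<beta> = \<alpha>")
          case True
          then show ?thesis using Qx x y A(3) B(3) \<open>a \<longrightarrow> b\<close> by blast
        next
          case False
          have "s \<beta> \<in> Choice tree \<beta> (mo w)" using s(1) by (simp add: Select_def)
          then obtain u where u: "s \<beta> = hist ` (St \<beta> `` {u})" using Choice_mo[OF w] by blast
          have "hist x \<in> s \<beta>" "hist y \<in> s \<beta>" using x(2) y(2) s(2) False by auto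
          moreover have "x \<in> W" "y \<in> W" using AW BW x y by blast+
          moreover have "St \<beta> `` {u} \<subseteq> W" using St_W by blast
          ultimately have "(u, x) \<in> St \<beta>" "(u, y) \<in> St \<beta>" unfolding u by simp_all
          then show ?thesis using Qx Qiff by blast
        qed
      qed
    qed simp
    then show "val_le ?v (hist ` A \<inter> S) (hist ` B \<inter> S)"
      unfolding val_le_def using v AW BW by (auto simp: subset_iff)
  qed
  show "a \<longrightarrow> b" if le: "\<forall>S\<in>State tree \<alpha> (mo w). val_le ?v (hist ` A \<inter> S) (hist ` B \<inter> S)"
  proof (rule ccontr)
    assume ab: "\<not> (a \<longrightarrow> b)"
    obtain x y where x: "x \<in> A" and y: "y \<in> B" using A(2) B(2) by blast
    then have xw: "(w, x) \<in> Bx" and yw: "(w, y) \<in> Bx" using A(1) B(1) by blast+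
    \<comment> \<open>In \<open>z\<close> agent \<alpha> acts as in \<open>y\<close> and all others
      act as in \<open>x\<close>. So \<open>z\<close> belongs to the state fixed by \<open>x\<close>
      and, by \<open>closed\<close>, to \<open>B\<close>.\<close>
    have "\<exists>z. \<forall>\<beta>. (if \<beta> = \<alpha> then y else x, z) \<in> St \<beta>"
      by (rule independence[of w]) (use xw yw in simp)
    then obtain z where z: "\<And>\<beta>. (if \<beta> = \<alpha> then y else x, z) \<in> St \<beta>" by blast
    have zy: "(y, z) \<in> St \<alpha>" using z[of \<alpha>] by simp
    have zx: "(x, z) \<in> St \<beta>" if "\<beta> \<noteq> \<alpha>" for \<beta> using z[of \<beta>] that by simp
    have zB: "z \<in> B" using closed[OF y zy] .
    then have zw: "(w, z) \<in> Bx" using B(1) by blast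
    define S where "S = hists_at tree (mo w) \<inter> (\<Inter>\<beta>\<in>- {\<alpha>}. hist ` (St \<beta> `` {x}))"
    have "(\<lambda>\<beta>. hist ` (St \<beta> `` {x})) \<in> Select tree (mo w)"
      using xw Choice_mo[OF w] by (auto simp: Select_def)
    then have "S \<in> State tree \<alpha> (mo w)" unfolding State_def S_def by blast
    then have "val_le ?v (hist ` A \<inter> S) (hist ` B \<inter> S)" using le by blast
    moreover have "hist x \<in> S" "hist z \<in> S"
      unfolding S_def hists_at_mo[OF w] using xw zw zx St_refl Bx_W by blast+
    ultimately have "?v (hist x) \<le> ?v (hist z)" using x zB unfolding val_le_def by blast
    then have "card {\<beta>. Q \<beta> x} \<le> card {\<beta>. Q \<beta> z}" using v xw zw Bx_W by simp
    \<comment> \<open>The worlds \<open>x\<close> and \<open>z\<close> agree on all other agents,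
      while \<alpha> is counted for \<open>x\<close> only; the value drops strictly.\<close>
    moreover have "{\<beta>. Q \<beta> z} \<subset> {\<beta>. Q \<beta> x}"
    proof
      show "{\<beta>. Q \<beta> z} \<subseteq> {\<beta>. Q \<beta> x}"
      proof
        fix \<beta> assume "\<beta> \<in> {\<beta>. Q \<beta> z}"
        then show "\<beta> \<in> {\<beta>. Q \<beta> x}"
          using zx[of \<beta>] Qiff[of x z \<beta>] A(3)[OF x] ab by (cases "\<beta> = \<alpha>") auto
      qed
      show "{\<beta>. Q \<beta> z} \<noteq> {\<beta>. Q \<beta> x}" using A(3)[OF x] B(3)[OF zB] ab by blast
    qed
    then have "card {\<beta>. Q \<beta> z} < card {\<beta>. Q \<beta> x}" by (intro psubset_card_mono) simp_all
    ultimately show False by simp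
  qed
qed

lemma dom_le_tree:
  assumes "(w, u) \<in> Bx" "(w, v) \<in> Bx"
  shows "dom_le tree \<alpha> (mo w) (hist ` (St \<alpha> `` {u})) (hist ` (St \<alpha> `` {v})) \<longleftrightarrow> (Opt \<alpha> u \<longrightarrow> Opt \<alpha> v)"
  unfolding dom_le_def tree_sel
proof (rule val_le_State_iff)
  show "w \<in> W" using assms Bx_W by blast
  show "St \<alpha> `` {u} \<subseteq> Bx `` {w}" "St \<alpha> `` {v} \<subseteq> Bx `` {w}" using assms St_Bx Bx_trans by blast+
  show "St \<alpha> `` {u} \<noteq> {}" "St \<alpha> `` {v} \<noteq> {}" using assms St_refl Bx_W by blast+
  show "Opt \<alpha> x \<longleftrightarrow> Opt \<alpha> u" if "x \<in> St \<alpha> `` {u}" for x using that Opt_St St_sym by blast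
  show "Opt \<alpha> x \<longleftrightarrow> Opt \<alpha> v" if "x \<in> St \<alpha> `` {v}" for x using that Opt_St St_sym by blast
  show "y \<in> St \<alpha> `` {v}" if "x \<in> St \<alpha> `` {v}" "(x, y) \<in> St \<alpha>" for x y using that St_trans by blast
qed (rule Opt_St)

lemma mom_indist_mo:
  assumes w: "w \<in> W"
  shows "mom_indist tree \<alpha> (mo w) m \<longleftrightarrow> (\<exists>v. (w, v) \<in> Kn \<alpha> O Bx \<and> m = mo v)"
proof
  assume "mom_indist tree \<alpha> (mo w) m"
  then obtain h h' where hh: "((mo w, h), (m, h')) \<in> Indist tree \<alpha>" unfolding mom_indist_def by blast
  then have "(mo w, h) \<in> indices tree" using equiv_Indist[of \<alpha>] by (auto simp: equiv_def)
  then obtain x where x: "x \<in> W" "h = hist x" "mo w = mo x" unfolding indices_tree using mo_pt w by metis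
  then obtain v where "(x, v) \<in> Kn \<alpha>" "m = mo v" using hh Indist_mo[OF x(1)] by auto
  then show "\<exists>v. (w, v) \<in> Kn \<alpha> O Bx \<and> m = mo v" using Kn_Bx_swap mo_eq w x by metis
next
  assume "\<exists>v. (w, v) \<in> Kn \<alpha> O Bx \<and> m = mo v"
  then obtain k v where k: "(w, k) \<in> Kn \<alpha>" "(k, v) \<in> Bx" "m = mo v" by blast
  then have "m = mo k" using mo_eq Bx_W by metis
  then show "mom_indist tree \<alpha> (mo w) m" unfolding mom_indist_def using Indist_mo[OF w] k(1) by blast
qed

text \<open>All histories of the cell share the information class of \<open>u\<close>, because
  \<open>St \<alpha>\<close> is contained in \<open>Kn \<alpha>\<close>.\<close>

lemma epi_cluster_mo:
  assumes u: "(w, u) \<in> Bx" and v: "v \<in> W"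
  shows "epi_cluster tree \<alpha> (mo w) (hist ` (St \<alpha> `` {u})) (mo v) = hist ` {x. (v, x) \<in> Bx \<and> (u, x) \<in> Kn \<alpha>}"
proof (rule set_eqI)
  fix h
  have mo: "mo w = mo x" if "(u, x) \<in> St \<alpha>" for x
    using that St_Bx Bx_trans[OF u] mo_eq Bx_W by blast
  have rel: "((mo w, hist x), (mo v, h)) \<in> Indist tree \<alpha> \<longleftrightarrow> (\<exists>y. (u, y) \<in> Kn \<alpha> \<and> mo v = mo y \<and> h = hist y)"
    if x: "(u, x) \<in> St \<alpha>" for x
  proof -
    have "x \<in> W" "(u, x) \<in> Kn \<alpha>" using x St_W St_Kn by blast+
    then show ?thesis unfolding mo[OF x] using Indist_mo[of x] Kn_iff[of u x \<alpha>] by auto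
  qed
  have "h \<in> epi_cluster tree \<alpha> (mo w) (hist ` (St \<alpha> `` {u})) (mo v) \<longleftrightarrow>
      h \<in> hists_at tree (mo v) \<and> (\<exists>x. (u, x) \<in> St \<alpha> \<and> ((mo w, hist x), (mo v, h)) \<in> Indist tree \<alpha>)"
    unfolding epi_cluster_def by blast
  also have "\<dots> \<longleftrightarrow> h \<in> hists_at tree (mo v) \<and> (\<exists>y. (u, y) \<in> Kn \<alpha> \<and> mo v = mo y \<and> h = hist y)"
    using rel St_refl[of u \<alpha>] u Bx_W by blast
  also have "\<dots> \<longleftrightarrow> h \<in> hist ` (Bx `` {v}) \<and> (\<exists>y. (u, y) \<in> Kn \<alpha> \<and> (v, y) \<in> Bx \<and> h = hist y)"
    unfolding hists_at_mo[OF v] using mo_eq[OF v] Kn_W by blast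
  also have "\<dots> \<longleftrightarrow> h \<in> hist ` {x. (v, x) \<in> Bx \<and> (u, x) \<in> Kn \<alpha>}" by blast
  finally show "h \<in> epi_cluster tree \<alpha> (mo w) (hist ` (St \<alpha> `` {u})) (mo v) \<longleftrightarrow>
      h \<in> hist ` {x. (v, x) \<in> Bx \<and> (u, x) \<in> Kn \<alpha>}" .
qed

text \<open>\<open>SOpt \<alpha>\<close> is constant on information classes, hence on each cluster,
  and by uniformity both clusters are nonempty at every related moment. The comparison thus has the
  same outcome everywhere, and the moment of \<open>w\<close> shows that it takes place at least
  once.\<close>

lemma sdom_le_tree:
  assumes u: "(w, u) \<in> Bx" and u': "(w, u') \<in> Bx"
  shows "sdom_le tree \<alpha> (mo w) (hist ` (St \<alpha> `` {u})) (hist ` (St \<alpha> `` {u'})) \<longleftrightarrow> (SOpt \<alpha> u \<longrightarrow> SOpt \<alpha> u')"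
proof -
  have w: "w \<in> W" using u Bx_W by blast
  have *: "(\<forall>S\<in>State tree \<alpha> (mo v). val_le (Value_S tree)
      (epi_cluster tree \<alpha> (mo w) (hist ` (St \<alpha> `` {u})) (mo v) \<inter> S)
      (epi_cluster tree \<alpha> (mo w) (hist ` (St \<alpha> `` {u'})) (mo v) \<inter> S)) \<longleftrightarrow> (SOpt \<alpha> u \<longrightarrow> SOpt \<alpha> u')"
    if v: "(w, v) \<in> Kn \<alpha> O Bx" for v
  proof -
    have vW: "v \<in> W" using v Bx_W by blast
    show ?thesis
      unfolding epi_cluster_mo[OF u vW] epi_cluster_mo[OF u' vW] tree_sel
    proof (rule val_le_State_iff[OF vW])
      show "{x. (v, x) \<in> Bx \<and> (u, x) \<in> Kn \<alpha>} \<noteq> {}" "{x. (v, x) \<in> Bx \<and> (u', x) \<in> Kn \<alpha>} \<noteq> {}"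
        using Kn_Bx_cancel[OF v u] Kn_Bx_cancel[OF v u'] by blast+
      show "SOpt \<alpha> x \<longleftrightarrow> SOpt \<alpha> u" if "x \<in> {x. (v, x) \<in> Bx \<and> (u, x) \<in> Kn \<alpha>}" for x
        using that SOpt_Kn Kn_sym by blast
      show "SOpt \<alpha> x \<longleftrightarrow> SOpt \<alpha> u'" if "x \<in> {x. (v, x) \<in> Bx \<and> (u', x) \<in> Kn \<alpha>}" for x
        using that SOpt_Kn Kn_sym by blast
      show "SOpt \<beta> y" if "(x, y) \<in> St \<beta>" "SOpt \<beta> x" for \<beta> x y
        using that SOpt_Kn St_Kn by blast
      show "y \<in> {x. (v, x) \<in> Bx \<and> (u', x) \<in> Kn \<alpha>}"
        if "x \<in> {x. (v, x) \<in> Bx \<and> (u', x) \<in> Kn \<alpha>}" "(x, y) \<in> St \<alpha>" for x y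
        using that St_Bx St_Kn Bx_trans Kn_trans by blast
    qed blast+
  qed
  have "(w, w) \<in> Kn \<alpha> O Bx" using w Kn_refl Bx_refl by blast
  then show ?thesis unfolding sdom_le_def mom_indist_mo[OF w] using * by blast
qed

section \<open>Truth in the tree\<close>

lemma sat_tree: "w \<in> W \<Longrightarrow> sat tree (mo w) (hist w) \<phi> \<longleftrightarrow> ksat w \<phi>"
proof (induction \<phi> arbitrary: w)
  case (Atom p)
  then show ?case by auto
next
  case (Box \<phi>)
  have "sat tree (mo w) (hist v) \<phi> \<longleftrightarrow> ksat v \<phi>" if "(w, v) \<in> Bx" for v
    using that Box Bx_W mo_eq by metis
  then show ?case using hists_at_mo[OF Box(2)] by auto
next
  case (Stit \<alpha> \<phi>)
  have "sat tree (mo w) (hist v) \<phi> \<longleftrightarrow> ksat v \<phi>" if "(w, v) \<in> St \<alpha>" for v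
  proof -
    have "v \<in> W" "mo w = mo v" using that St_W mo_eq St_Bx by blast+
    then show ?thesis using Stit(1) by simp
  qed
  then show ?case using choice_cell_mo[OF Stit(2)] by auto
next
  case (Know \<alpha> \<phi>)
  have "sat tree (mo w) (hist w) (Know \<alpha> \<phi>) \<longleftrightarrow> (\<forall>v. (w, v) \<in> Kn \<alpha> \<longrightarrow> sat tree (mo v) (hist v) \<phi>)"
    unfolding sat.simps Indist_mo[OF Know(2)] by blast
  then show ?case using Know(1) Kn_W by simp
next
  case (Bel \<alpha> \<phi>)
  let ?T = "{(m', h'). (m', h') \<in> indices tree \<and> sat tree m' h' \<phi>}"
  have i: "(mo w, hist w) \<in> indices tree" using Bel(2) indices_tree by blast
  have "core \<alpha> (mo w, hist w) \<subseteq> ex_ante_info tree \<alpha> (mo w, hist w)"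
    unfolding core_def ex_ante_info_tree by blast
  \<comment> \<open>\<open>core\<close> is itself open and lies in every nonempty open set, so it is
    the best witness.\<close>
  then have "sat tree (mo w) (hist w) (Bel \<alpha> \<phi>) \<longleftrightarrow> core \<alpha> (mo w, hist w) \<subseteq> ?T"
    unfolding sat.simps openin_tree using core_nonempty[OF i, of \<alpha>] by blast
  also have "\<dots> \<longleftrightarrow> (\<forall>v. (w, v) \<in> Kn \<alpha> O Bx \<longrightarrow> Comp \<alpha> v \<longrightarrow> (mo v, hist v) \<in> ?T)"
    unfolding core_mo[OF Bel(2)] by blast
  also have "\<dots> \<longleftrightarrow> ksat w (Bel \<alpha> \<phi>)"
  proof -
    have "(mo v, hist v) \<in> ?T \<longleftrightarrow> ksat v \<phi>" if "(w, v) \<in> Kn \<alpha> O Bx" for v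
    proof -
      have "v \<in> W" using that Bx_W by blast
      then show ?thesis using Bel(1) indices_tree by auto
    qed
    then show ?thesis unfolding ksat.simps by blast
  qed
  finally show ?case .
next
  case (Ought \<alpha> \<phi>)
  have IH: "sat tree (mo w) (hist v) \<phi> \<longleftrightarrow> ksat v \<phi>" if "(w, v) \<in> Bx" for v
    using that Ought Bx_W mo_eq by metis
  have "sat tree (mo w) (hist w) (Ought \<alpha> \<phi>) \<longleftrightarrow> (\<forall>u\<in>Bx `` {w}. Opt \<alpha> u \<longrightarrow>
      hist ` (St \<alpha> `` {u}) \<subseteq> {g \<in> hists_at tree (mo w). sat tree (mo w) g \<phi>})"
    unfolding sat_Ought_obligatory Choice_mo[OF Ought(2)]
    by (rule obligatory_image_iff) (simp add: dom_le_tree, use Opt_ex[OF Ought(2)] in blast)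
  also have "\<dots> \<longleftrightarrow> (\<forall>u. (w, u) \<in> Bx \<longrightarrow> Opt \<alpha> u \<longrightarrow> (\<forall>x. (u, x) \<in> St \<alpha> \<longrightarrow> ksat x \<phi>))"
  proof -
    have "hist ` (St \<alpha> `` {u}) \<subseteq> {g \<in> hists_at tree (mo w). sat tree (mo w) g \<phi>} \<longleftrightarrow>
        (\<forall>x. (u, x) \<in> St \<alpha> \<longrightarrow> ksat x \<phi>)" if u: "(w, u) \<in> Bx" for u
    proof -
      have "(w, x) \<in> Bx" if "(u, x) \<in> St \<alpha>" for x using that u St_Bx Bx_trans by blast
      then show ?thesis unfolding hists_at_mo[OF Ought(2)] using IH by blast
    qed
    then show ?thesis by blast
  qed
  \<comment> \<open>Cells may be replaced by worlds because \<open>Opt \<alpha>\<close> is constant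
    on cells.\<close>
  also have "\<dots> \<longleftrightarrow> (\<forall>v. (w, v) \<in> Bx \<longrightarrow> Opt \<alpha> v \<longrightarrow> ksat v \<phi>)"
    using Opt_St St_Bx Bx_trans Bx_W St_refl by (meson subsetD)
  finally show ?case by simp
next
  case (SOught \<alpha> \<phi>)
  let ?P = "\<lambda>L. \<forall>m'. mom_indist tree \<alpha> (mo w) m' \<longrightarrow>
      epi_cluster tree \<alpha> (mo w) L m' \<subseteq> {g \<in> hists_at tree m'. sat tree m' g \<phi>}"
  have "sat tree (mo w) (hist w) (SOught \<alpha> \<phi>) \<longleftrightarrow>
      (\<forall>u\<in>Bx `` {w}. SOpt \<alpha> u \<longrightarrow> ?P (hist ` (St \<alpha> `` {u})))"
    unfolding sat_SOught_obligatory Choice_mo[OF SOught(2)]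
    by (rule obligatory_image_iff) (simp add: sdom_le_tree, use SOpt_ex[OF SOught(2)] in blast)
  also have "\<dots> \<longleftrightarrow> (\<forall>u. (w, u) \<in> Bx \<longrightarrow> SOpt \<alpha> u \<longrightarrow> (\<forall>x. (u, x) \<in> Kn \<alpha> \<longrightarrow> ksat x \<phi>))"
  proof -
    have "?P (hist ` (St \<alpha> `` {u})) \<longleftrightarrow> (\<forall>x. (u, x) \<in> Kn \<alpha> \<longrightarrow> ksat x \<phi>)" if u: "(w, u) \<in> Bx" for u
    proof -
      have "epi_cluster tree \<alpha> (mo w) (hist ` (St \<alpha> `` {u})) (mo v) \<subseteq>
            {g \<in> hists_at tree (mo v). sat tree (mo v) g \<phi>} \<longleftrightarrow>
          (\<forall>x. (v, x) \<in> Bx \<longrightarrow> (u, x) \<in> Kn \<alpha> \<longrightarrow> ksat x \<phi>)" if v: "v \<in> W" for v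
      proof -
        have "hist x \<in> hists_at tree (mo v) \<and> (sat tree (mo v) (hist x) \<phi> \<longleftrightarrow> ksat x \<phi>)" if x: "(v, x) \<in> Bx" for x
        proof -
          have "x \<in> W" "mo v = mo x" using x mo_eq Bx_W by blast+
          then show ?thesis using SOught(1) x hists_at_mo[OF v] by auto
        qed
        then show ?thesis unfolding epi_cluster_mo[OF u v] by blast
      qed
      then have "?P (hist ` (St \<alpha> `` {u})) \<longleftrightarrow>
          (\<forall>v. (w, v) \<in> Kn \<alpha> O Bx \<longrightarrow> (\<forall>x. (v, x) \<in> Bx \<longrightarrow> (u, x) \<in> Kn \<alpha> \<longrightarrow> ksat x \<phi>))"
        unfolding mom_indist_mo[OF SOught(2)] using Bx_W by blast
      also have "\<dots> \<longleftrightarrow> (\<forall>x. (u, x) \<in> Kn \<alpha> \<longrightarrow> ksat x \<phi>)"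
      proof -
        have "(w, x) \<in> Kn \<alpha> O Bx \<and> (x, x) \<in> Bx" if "(u, x) \<in> Kn \<alpha>" for x
          using that Kn_Bx_swap[OF u that] Bx_refl Kn_W by blast
        then show ?thesis by blast
      qed
      finally show ?thesis .
    qed
    then show ?thesis by blast
  qed
  also have "\<dots> \<longleftrightarrow> (\<forall>v. (w, v) \<in> Kn \<alpha> O Bx \<longrightarrow> SOpt \<alpha> v \<longrightarrow> ksat v \<phi>)"
  proof
    assume *: "\<forall>u. (w, u) \<in> Bx \<longrightarrow> SOpt \<alpha> u \<longrightarrow> (\<forall>x. (u, x) \<in> Kn \<alpha> \<longrightarrow> ksat x \<phi>)"
    show "\<forall>v. (w, v) \<in> Kn \<alpha> O Bx \<longrightarrow> SOpt \<alpha> v \<longrightarrow> ksat v \<phi>"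
    proof (intro allI impI)
      fix v assume v: "(w, v) \<in> Kn \<alpha> O Bx" "SOpt \<alpha> v"
      then obtain k where k: "(w, k) \<in> Kn \<alpha>" "(k, v) \<in> Bx" by blast
      \<comment> \<open>An optimal \<open>v\<close> anywhere in the ex ante information has a
        counterpart at the moment of \<open>w\<close> that \<alpha> cannot distinguish from
        it.\<close>
      obtain u where u: "(w, u) \<in> Bx" "(v, u) \<in> Kn \<alpha>" using uniformity[OF Kn_sym[OF k(1)] k(2)] by blast
      have "SOpt \<alpha> u" using SOpt_Kn[OF u(2)] v(2) by blast
      then show "ksat v \<phi>" using * u Kn_sym by blast
    qed
  next
    assume *: "\<forall>v. (w, v) \<in> Kn \<alpha> O Bx \<longrightarrow> SOpt \<alpha> v \<longrightarrow> ksat v \<phi>"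
    show "\<forall>u. (w, u) \<in> Bx \<longrightarrow> SOpt \<alpha> u \<longrightarrow> (\<forall>x. (u, x) \<in> Kn \<alpha> \<longrightarrow> ksat x \<phi>)"
      using * Kn_Bx_swap SOpt_Kn by blast
  qed
  finally show ?case by simp
qed simp_all

end

section \<open>Completeness\<close>

instance fm :: (countable, countable) countable
  by countable_datatype

subsection \<open>Maximal consistent sets\<close>

primrec imps :: "('p, 'a) fm list \<Rightarrow> ('p, 'a) fm \<Rightarrow> ('p, 'a) fm" where
  "imps [] \<phi> = \<phi>"
| "imps (\<psi> # \<psi>s) \<phi> = Imp \<psi> (imps \<psi>s \<phi>)"

definition entails :: "('p, 'a) fm set \<Rightarrow> ('p, 'a) fm \<Rightarrow> bool" where
  "entails \<Gamma> \<phi> \<longleftrightarrow> (\<exists>\<psi>s. set \<psi>s \<subseteq> \<Gamma> \<and> derivable_R' (imps \<psi>s \<phi>))"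

text \<open>There is no falsum in the language, so consistency is the failure to entail
  everything.\<close>

definition consistent :: "('p, 'a) fm set \<Rightarrow> bool" where
  "consistent \<Gamma> \<longleftrightarrow> (\<exists>\<phi>. \<not> entails \<Gamma> \<phi>)"

definition mcs :: "('p, 'a) fm set \<Rightarrow> bool" where
  "mcs w \<longleftrightarrow> consistent w \<and> (\<forall>\<phi>. \<phi> \<in> w \<or> Neg \<phi> \<in> w)"

lemma prop_eval_imps: "prop_eval v (imps \<psi>s \<phi>) \<longleftrightarrow> ((\<forall>\<psi>\<in>set \<psi>s. prop_eval v \<psi>) \<longrightarrow> prop_eval v \<phi>)"
  by (induction \<psi>s) auto

lemma derivable_tautology: "(\<And>v. prop_eval v \<phi>) \<Longrightarrow> derivable_R' \<phi>"
  by (simp add: derivable_from.ax axioms_R'.taut tautology_def)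

lemma derivable_imps: "derivable_R' (imps \<psi>s \<phi>) \<Longrightarrow> \<forall>\<psi>\<in>set \<psi>s. derivable_R' \<psi> \<Longrightarrow> derivable_R' \<phi>"
  by (induction \<psi>s) (auto intro: derivable_from.MP)

text \<open>Replaces propositional derivations in the calculus by truth-table reasoning with
  \<open>prop_eval\<close>.\<close>

lemma derivable_consequence:
  assumes "\<forall>\<psi>\<in>set \<psi>s. derivable_R' \<psi>" "\<And>v. \<forall>\<psi>\<in>set \<psi>s. prop_eval v \<psi> \<Longrightarrow> prop_eval v \<phi>"
  shows "derivable_R' \<phi>"
  using derivable_imps[OF derivable_tautology assms(1), of \<phi>] assms(2) by (simp add: prop_eval_imps)

lemma entails_derivable: "derivable_R' \<phi> \<Longrightarrow> entails \<Gamma> \<phi>"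
  unfolding entails_def by (rule exI[of _ "[]"]) simp

lemma entails_member: "\<phi> \<in> \<Gamma> \<Longrightarrow> entails \<Gamma> \<phi>"
  unfolding entails_def by (rule exI[of _ "[\<phi>]"]) (auto intro: derivable_tautology)

lemma entails_MP:
  assumes "entails \<Gamma> (Imp \<phi> \<psi>)" "entails \<Gamma> \<phi>"
  shows "entails \<Gamma> \<psi>"
proof -
  obtain as bs where as: "set as \<subseteq> \<Gamma>" "derivable_R' (imps as (Imp \<phi> \<psi>))"
    and bs: "set bs \<subseteq> \<Gamma>" "derivable_R' (imps bs \<phi>)"
    using assms unfolding entails_def by blast
  have "derivable_R' (imps (as @ bs) \<psi>)"
    by (rule derivable_consequence[of "[imps as (Imp \<phi> \<psi>), imps bs \<phi>]"])
      (use as bs in \<open>auto simp: prop_eval_imps\<close>)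
  then show ?thesis using as(1) bs(1) unfolding entails_def by (intro exI[of _ "as @ bs"]) simp
qed

lemma entails_imps: "entails \<Gamma> (imps \<psi>s \<phi>) \<Longrightarrow> \<forall>\<psi>\<in>set \<psi>s. entails \<Gamma> \<psi> \<Longrightarrow> entails \<Gamma> \<phi>"
  by (induction \<psi>s) (auto intro: entails_MP)

lemma entails_consequence:
  assumes "\<forall>\<psi>\<in>set \<psi>s. entails \<Gamma> \<psi>" "\<And>v. \<forall>\<psi>\<in>set \<psi>s. prop_eval v \<psi> \<Longrightarrow> prop_eval v \<phi>"
  shows "entails \<Gamma> \<phi>"
proof -
  have "derivable_R' (imps \<psi>s \<phi>)" using assms(2) by (intro derivable_tautology) (simp add: prop_eval_imps)
  then show ?thesis using entails_imps entails_derivable assms(1) by blast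
qed

lemma entails_insert:
  assumes "entails (insert \<psi> \<Gamma>) \<phi>"
  shows "entails \<Gamma> (Imp \<psi> \<phi>)"
proof -
  obtain \<psi>s where \<psi>s: "set \<psi>s \<subseteq> insert \<psi> \<Gamma>" "derivable_R' (imps \<psi>s \<phi>)"
    using assms unfolding entails_def by blast
  have "derivable_R' (imps (filter (\<lambda>\<chi>. \<chi> \<noteq> \<psi>) \<psi>s) (Imp \<psi> \<phi>))"
    by (rule derivable_consequence[of "[imps \<psi>s \<phi>]"]) (use \<psi>s in \<open>auto simp: prop_eval_imps\<close>)
  then show ?thesis
    using \<psi>s(1) unfolding entails_def by (intro exI[of _ "filter (\<lambda>\<chi>. \<chi> \<noteq> \<psi>) \<psi>s"]) auto
qed

lemma lindenbaum:
  assumes "consistent \<Gamma>"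
  obtains w where "\<Gamma> \<subseteq> w" "mcs w"
proof -
  obtain \<chi> where \<chi>: "\<not> entails \<Gamma> \<chi>" using assms unfolding consistent_def by blast
  \<comment> \<open>Zorn's lemma is applied to the sets that do not entail one fixed
    \<open>\<chi>\<close>; this passes to unions of chains since entailment uses finitely many
    premises.\<close>
  let ?A = "{\<Delta>. \<Gamma> \<subseteq> \<Delta> \<and> \<not> entails \<Delta> \<chi>}"
  have "\<exists>M\<in>?A. \<forall>X\<in>?A. M \<subseteq> X \<longrightarrow> X = M"
  proof (rule subset_Zorn_nonempty)
    show "?A \<noteq> {}" using \<chi> by blast
    fix \<C> assume \<C>: "\<C> \<noteq> {}" "subset.chain ?A \<C>"
    then have sub: "\<C> \<subseteq> ?A" by (simp add: subset_chain_def)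
    have "\<not> entails (\<Union>\<C>) \<chi>"
    proof
      assume "entails (\<Union>\<C>) \<chi>"
      then obtain \<psi>s where \<psi>s: "set \<psi>s \<subseteq> \<Union>\<C>" "derivable_R' (imps \<psi>s \<chi>)" unfolding entails_def by blast
      obtain B where "B \<in> \<C>" "set \<psi>s \<subseteq> B"
        by (rule finite_subset_Union_chain[OF _ \<psi>s(1) \<C>]) simp_all
      then show False using \<psi>s(2) sub unfolding entails_def by blast
    qed
    then show "\<Union>\<C> \<in> ?A" using \<C>(1) sub by blast
  qed
  then obtain w where "w \<in> ?A" and max: "\<forall>X\<in>?A. w \<subseteq> X \<longrightarrow> X = w" by (rule bexE)
  then have w: "\<Gamma> \<subseteq> w" "\<not> entails w \<chi>" by simp_all
  have "\<phi> \<in> w \<or> Neg \<phi> \<in> w" for \<phi>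
  proof (rule ccontr)
    assume no: "\<not> (\<phi> \<in> w \<or> Neg \<phi> \<in> w)"
    have *: "entails w (Imp \<psi> \<chi>)" if "\<psi> \<notin> w" for \<psi>
    proof (rule entails_insert, rule ccontr)
      assume "\<not> entails (insert \<psi> w) \<chi>"
      then have "insert \<psi> w = w" using max w(1) by blast
      then show False using that by blast
    qed
    \<comment> \<open>A case distinction inside the calculus: by maximality both
      \<open>\<phi>\<close> and its negation lead to \<open>\<chi>\<close>.\<close>
    have "entails w \<chi>"
      by (rule entails_consequence[of "[Imp \<phi> \<chi>, Imp (Neg \<phi>) \<chi>]"]) (use * no in auto)
    then show False using w(2) by blast
  qed
  then have "mcs w" using w(2) unfolding mcs_def consistent_def by blast
  then show ?thesis using that w(1) by blast
qed

lemma mcs_entails: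
  assumes "mcs w" "entails w \<phi>"
  shows "\<phi> \<in> w"
proof (rule ccontr)
  assume "\<phi> \<notin> w"
  then have "entails w (Neg \<phi>)" using assms(1) entails_member unfolding mcs_def by blast
  then have "entails w \<chi>" for \<chi>
    using assms(2) by (intro entails_consequence[of "[\<phi>, Neg \<phi>]"]) auto
  then show False using assms(1) unfolding mcs_def consistent_def by blast
qed

lemma mcs_consequence:
  assumes "mcs w" "\<forall>\<psi>\<in>set \<psi>s. \<psi> \<in> w" "\<And>v. \<forall>\<psi>\<in>set \<psi>s. prop_eval v \<psi> \<Longrightarrow> prop_eval v \<phi>"
  shows "\<phi> \<in> w"
  by (rule mcs_entails[OF assms(1) entails_consequence[OF _ assms(3)]])
    (use assms(2) entails_member in blast)+

lemma mcs_Neg: 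
  assumes "mcs w"
  shows "Neg \<phi> \<in> w \<longleftrightarrow> \<phi> \<notin> w"
proof -
  have False if "\<phi> \<in> w" "Neg \<phi> \<in> w"
  proof -
    have "entails w \<chi>" for \<chi>
      using that entails_member by (intro entails_consequence[of "[\<phi>, Neg \<phi>]"]) auto
    then show False using assms unfolding mcs_def consistent_def by blast
  qed
  then show ?thesis using assms unfolding mcs_def by blast
qed

lemma mcs_Conj:
  assumes "mcs w"
  shows "Conj \<phi> \<psi> \<in> w \<longleftrightarrow> \<phi> \<in> w \<and> \<psi> \<in> w"
proof (intro iffI conjI)
  assume *: "Conj \<phi> \<psi> \<in> w"
  show "\<phi> \<in> w" by (rule mcs_consequence[OF assms, of "[Conj \<phi> \<psi>]"]) (use * in auto)
  show "\<psi> \<in> w" by (rule mcs_consequence[OF assms, of "[Conj \<phi> \<psi>]"]) (use * in auto)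
next
  assume *: "\<phi> \<in> w \<and> \<psi> \<in> w"
  show "Conj \<phi> \<psi> \<in> w" by (rule mcs_consequence[OF assms, of "[\<phi>, \<psi>]"]) (use * in auto)
qed

lemma mcs_Imp: "mcs w \<Longrightarrow> Imp \<phi> \<psi> \<in> w \<longleftrightarrow> (\<phi> \<in> w \<longrightarrow> \<psi> \<in> w)"
  by (simp add: mcs_Neg mcs_Conj)

lemma mcs_derivable: "mcs w \<Longrightarrow> derivable_R' \<phi> \<Longrightarrow> \<phi> \<in> w"
  using mcs_entails entails_derivable by blast

lemma mcs_axiom: "mcs w \<Longrightarrow> Imp \<phi> \<psi> \<in> axioms_R' \<Longrightarrow> \<phi> \<in> w \<Longrightarrow> \<psi> \<in> w"
  using mcs_derivable[OF _ derivable_from.ax] mcs_Imp by blast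

lemma mcs_BigConj: "mcs w \<Longrightarrow> \<phi>s \<noteq> [] \<Longrightarrow> BigConj \<phi>s \<in> w \<longleftrightarrow> (\<forall>\<phi>\<in>set \<phi>s. \<phi> \<in> w)"
  by (induction \<phi>s rule: BigConj.induct) (simp_all add: mcs_Conj)

text \<open>Closure under conjunction compresses finitely many premises into one member of each set,
  so any inconsistency already shows between some \<open>a\<close> and some \<open>b\<close>. The
  purpose is to find common successors of two worlds.\<close>

lemma mcs_join:
  assumes A: "A \<noteq> {}" "\<And>a a'. a \<in> A \<Longrightarrow> a' \<in> A \<Longrightarrow> Conj a a' \<in> A"
    and B: "B \<noteq> {}" "\<And>b b'. b \<in> B \<Longrightarrow> b' \<in> B \<Longrightarrow> Conj b b' \<in> B"
    and compatible: "\<And>a b. a \<in> A \<Longrightarrow> b \<in> B \<Longrightarrow> \<not> derivable_R' (Imp a (Neg b))"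
  obtains w where "mcs w" "A \<subseteq> w" "B \<subseteq> w"
proof -
  have *: "\<exists>a\<in>A. \<exists>b\<in>B. \<forall>v. prop_eval v a \<and> prop_eval v b \<longrightarrow> (\<forall>\<psi>\<in>set \<psi>s. prop_eval v \<psi>)"
    if "set \<psi>s \<subseteq> A \<union> B" for \<psi>s
    using that
  proof (induction \<psi>s)
    case Nil
    then show ?case using A(1) B(1) by auto
  next
    case (Cons \<psi> \<psi>s)
    then obtain a b where ab: "a \<in> A" "b \<in> B"
        "\<And>v. prop_eval v a \<Longrightarrow> prop_eval v b \<Longrightarrow> \<forall>\<psi>\<in>set \<psi>s. prop_eval v \<psi>" by auto
    show ?case
    proof (cases "\<psi> \<in> A")
      case True
      then show ?thesis using ab A(2)[OF True ab(1)]
        by (intro bexI[of _ "Conj \<psi> a"] bexI[of _ b]) auto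
    next
      case False
      then have "\<psi> \<in> B" using Cons.prems by auto
      then show ?thesis using ab B(2)[of \<psi> b]
        by (intro bexI[of _ a] bexI[of _ "Conj \<psi> b"]) auto
    qed
  qed
  obtain a0 where "a0 \<in> A" using A(1) by blast
  have "\<not> entails (A \<union> B) (Conj a0 (Neg a0))"
  proof
    assume "entails (A \<union> B) (Conj a0 (Neg a0))"
    then obtain \<psi>s where \<psi>s: "set \<psi>s \<subseteq> A \<union> B" "derivable_R' (imps \<psi>s (Conj a0 (Neg a0)))"
      unfolding entails_def by blast
    obtain a b where ab: "a \<in> A" "b \<in> B"
        "\<And>v. prop_eval v a \<Longrightarrow> prop_eval v b \<Longrightarrow> \<forall>\<psi>\<in>set \<psi>s. prop_eval v \<psi>"
      using *[OF \<psi>s(1)] by blast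
    have "derivable_R' (Imp a (Neg b))"
      by (rule derivable_consequence[of "[imps \<psi>s (Conj a0 (Neg a0))]"])
        (use \<psi>s(2) ab(3) in \<open>auto simp: prop_eval_imps\<close>)
    then show False using compatible ab by blast
  qed
  then have "consistent (A \<union> B)" unfolding consistent_def by blast
  then obtain w where "A \<union> B \<subseteq> w" "mcs w" by (rule lindenbaum)
  then show ?thesis using that by blast
qed

subsection \<open>Canonical relations\<close>

definition normal :: "(('p, 'a) fm \<Rightarrow> ('p, 'a) fm) \<Rightarrow> bool" where
  "normal N \<longleftrightarrow> K_axioms N \<subseteq> axioms_R' \<and> (\<forall>\<phi>. derivable_R' \<phi> \<longrightarrow> derivable_R' (N \<phi>))"

definition acc :: "(('p, 'a) fm \<Rightarrow> ('p, 'a) fm) \<Rightarrow> (('p, 'a) fm set \<times> ('p, 'a) fm set) set" where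
  "acc N = {(w, v). mcs w \<and> mcs v \<and> (\<forall>\<phi>. N \<phi> \<in> w \<longrightarrow> \<phi> \<in> v)}"

lemma accD: "(w, v) \<in> acc N \<Longrightarrow> N \<phi> \<in> w \<Longrightarrow> \<phi> \<in> v"
  by (simp add: acc_def)

lemma acc_mcs: "(w, v) \<in> acc N \<Longrightarrow> mcs w \<and> mcs v"
  by (simp add: acc_def)

lemma normal_Box: "normal Box"
  unfolding normal_def by (auto simp: S5_axioms_def intro: axioms_R'.S5_Box derivable_from.nec_Box)

lemma normal_Stit: "normal (Stit \<alpha>)"
  unfolding normal_def by (auto simp: S5_axioms_def intro: axioms_R'.S5_Stit[of _ \<alpha>] derivable_from.nec_Stit)

lemma normal_Know: "normal (Know \<alpha>)"
  unfolding normal_def by (auto simp: S5_axioms_def intro: axioms_R'.S5_Know[of _ \<alpha>] derivable_from.nec_Know)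

lemma normal_Bel: "normal (Bel \<alpha>)"
  unfolding normal_def by (auto simp: KD_axioms_def intro: axioms_R'.KD_Bel[of _ \<alpha>] derivable_from.nec_Bel)

lemma normal_Ought: "normal (Ought \<alpha>)"
  unfolding normal_def by (auto intro: axioms_R'.K_Ought[of _ \<alpha>] derivable_from.nec_Ought)

lemma normal_SOught: "normal (SOught \<alpha>)"
  unfolding normal_def by (auto intro: axioms_R'.K_SOught[of _ \<alpha>] derivable_from.nec_SOught)

lemma derivable_mono:
  assumes "normal N" "derivable_R' (Imp \<phi> \<psi>)"
  shows "derivable_R' (Imp (N \<phi>) (N \<psi>))"
proof -
  have "Imp (N (Imp \<phi> \<psi>)) (Imp (N \<phi>) (N \<psi>)) \<in> axioms_R'"
    using assms(1) unfolding normal_def K_axioms_def by blast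
  moreover have "derivable_R' (N (Imp \<phi> \<psi>))" using assms unfolding normal_def by blast
  ultimately show ?thesis by (rule derivable_from.MP[OF derivable_from.ax])
qed

lemma normal_MP:
  assumes "normal N" "mcs w" "N (Imp \<phi> \<psi>) \<in> w" "N \<phi> \<in> w"
  shows "N \<psi> \<in> w"
proof -
  have "Imp (N (Imp \<phi> \<psi>)) (Imp (N \<phi>) (N \<psi>)) \<in> axioms_R'"
    using assms(1) unfolding normal_def K_axioms_def by blast
  then have "Imp (N \<phi>) (N \<psi>) \<in> w" using mcs_axiom assms(2,3) by blast
  then show ?thesis using mcs_Imp assms(2,4) by blast
qed

lemma normal_derivable: "normal N \<Longrightarrow> mcs w \<Longrightarrow> derivable_R' \<phi> \<Longrightarrow> N \<phi> \<in> w"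
  unfolding normal_def using mcs_derivable by blast

lemma normal_mono:
  "normal N \<Longrightarrow> mcs w \<Longrightarrow> derivable_R' (Imp \<phi> \<psi>) \<Longrightarrow> N \<phi> \<in> w \<Longrightarrow> N \<psi> \<in> w"
  using normal_MP normal_derivable by blast

lemma normal_Conj:
  assumes "normal N" "mcs w" "N \<phi> \<in> w" "N \<psi> \<in> w"
  shows "N (Conj \<phi> \<psi>) \<in> w"
proof -
  have "derivable_R' (Imp \<phi> (Imp \<psi> (Conj \<phi> \<psi>)))" by (rule derivable_tautology) auto
  then have "N (Imp \<psi> (Conj \<phi> \<psi>)) \<in> w" using normal_mono assms by blast
  then show ?thesis using normal_MP assms by blast
qed

lemma normal_nonempty:
  assumes "normal N" "mcs w"
  shows "{\<phi>. N \<phi> \<in> w} \<noteq> {}"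
proof -
  have "derivable_R' (Imp \<phi> \<phi>)" for \<phi> by (rule derivable_tautology) auto
  then show ?thesis using normal_derivable[OF assms] by blast
qed

lemma acc_join:
  assumes N: "normal N" "mcs w" and N': "normal N'" "mcs w'"
    and compatible: "\<And>\<phi> \<psi>. N \<phi> \<in> w \<Longrightarrow> N' \<psi> \<in> w' \<Longrightarrow> \<not> derivable_R' (Imp \<phi> (Neg \<psi>))"
  obtains v where "(w, v) \<in> acc N" "(w', v) \<in> acc N'"
proof -
  obtain v where "mcs v" "{\<phi>. N \<phi> \<in> w} \<subseteq> v" "{\<phi>. N' \<phi> \<in> w'} \<subseteq> v"
    by (rule mcs_join[of "{\<phi>. N \<phi> \<in> w}" "{\<phi>. N' \<phi> \<in> w'}"])
      (use normal_nonempty[OF N] normal_nonempty[OF N'] normal_Conj[OF N] normal_Conj[OF N'] compatible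
        in simp_all)
  then show ?thesis using that N(2) N'(2) unfolding acc_def by blast
qed

lemma acc_ex:
  assumes N: "normal N" "mcs w" and \<phi>: "N \<phi> \<notin> w"
  obtains v where "(w, v) \<in> acc N" "\<phi> \<notin> v"
proof -
  have Neg: "derivable_R' (Imp (Neg \<phi>) (Neg \<phi>))" by (rule derivable_tautology) auto
  \<comment> \<open>A singleton \<open>{Neg \<phi>}\<close> is not closed under conjunction; its set
    of provable consequences is.\<close>
  obtain v where v: "mcs v" "{\<psi>. N \<psi> \<in> w} \<subseteq> v" "{\<psi>. derivable_R' (Imp (Neg \<phi>) \<psi>)} \<subseteq> v"
  proof (rule mcs_join[of "{\<psi>. N \<psi> \<in> w}" "{\<psi>. derivable_R' (Imp (Neg \<phi>) \<psi>)}"])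
    show "{\<psi>. derivable_R' (Imp (Neg \<phi>) \<psi>)} \<noteq> {}" using Neg by blast
    show "Conj b b' \<in> {\<psi>. derivable_R' (Imp (Neg \<phi>) \<psi>)}"
      if "b \<in> {\<psi>. derivable_R' (Imp (Neg \<phi>) \<psi>)}" "b' \<in> {\<psi>. derivable_R' (Imp (Neg \<phi>) \<psi>)}" for b b'
    proof -
      have "derivable_R' (Imp (Neg \<phi>) (Conj b b'))"
        by (rule derivable_consequence[of "[Imp (Neg \<phi>) b, Imp (Neg \<phi>) b']"]) (use that in auto)
      then show ?thesis by simp
    qed
    show "\<not> derivable_R' (Imp a (Neg b))"
      if "a \<in> {\<psi>. N \<psi> \<in> w}" "b \<in> {\<psi>. derivable_R' (Imp (Neg \<phi>) \<psi>)}" for a b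
    proof
      assume "derivable_R' (Imp a (Neg b))"
      then have "derivable_R' (Imp a \<phi>)"
        by (intro derivable_consequence[of "[Imp a (Neg b), Imp (Neg \<phi>) b]"]) (use that in auto)
      then show False using normal_mono[OF N] \<phi> that by blast
    qed
  qed (use normal_nonempty[OF N] normal_Conj[OF N] in simp_all)
  have "\<phi> \<notin> v" using v(1,3) Neg mcs_Neg by blast
  then show ?thesis using that v N(2) unfolding acc_def by blast
qed

lemma acc_S5:
  assumes N: "normal N" and S5: "S5_axioms N \<subseteq> axioms_R'"
  shows acc_S5_equiv: "equiv {w. mcs w} (acc N)"
    and acc_S5_iff: "(w, v) \<in> acc N \<Longrightarrow> N \<phi> \<in> w \<longleftrightarrow> N \<phi> \<in> v"
    and acc_S5_refl: "mcs w \<Longrightarrow> (w, w) \<in> acc N"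
    and acc_S5_sym: "(w, v) \<in> acc N \<Longrightarrow> (v, w) \<in> acc N"
proof -
  have ax: "Imp (N \<phi>) \<phi> \<in> axioms_R'" "Imp (N \<phi>) (N (N \<phi>)) \<in> axioms_R'"
      "Imp (Neg (N \<phi>)) (N (Neg (N \<phi>))) \<in> axioms_R'" for \<phi>
    using S5 unfolding S5_axioms_def by blast+
  have T: "\<phi> \<in> w" if "mcs w" "N \<phi> \<in> w" for w \<phi>
    using mcs_axiom[OF _ ax(1)] that by blast
  have 4: "N (N \<phi>) \<in> w" if "mcs w" "N \<phi> \<in> w" for w \<phi>
    using mcs_axiom[OF _ ax(2)] that by blast
  have 5: "N (Neg (N \<phi>)) \<in> w" if "mcs w" "N \<phi> \<notin> w" for w \<phi>
    using mcs_axiom[OF _ ax(3)] mcs_Neg that by blast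
  have iff: "N \<phi> \<in> w \<longleftrightarrow> N \<phi> \<in> v" if wv: "(w, v) \<in> acc N" for w v \<phi>
  proof
    show "N \<phi> \<in> v" if "N \<phi> \<in> w" using accD[OF wv] 4 acc_mcs[OF wv] that by blast
    show "N \<phi> \<in> w" if "N \<phi> \<in> v"
    proof (rule ccontr)
      assume "N \<phi> \<notin> w"
      then have "Neg (N \<phi>) \<in> v" using accD[OF wv] 5 acc_mcs[OF wv] by blast
      then show False using mcs_Neg acc_mcs[OF wv] that by blast
    qed
  qed
  then show "N \<phi> \<in> w \<longleftrightarrow> N \<phi> \<in> v" if "(w, v) \<in> acc N" for w v \<phi> using that .
  \<comment> \<open>Related worlds are those with the same \<open>N\<close> formulas, a condition
    that is visibly an equivalence.\<close>
  have acc_iff: "(w, v) \<in> acc N \<longleftrightarrow> mcs w \<and> mcs v \<and> (\<forall>\<phi>. N \<phi> \<in> w \<longleftrightarrow> N \<phi> \<in> v)" for w v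
    using iff T acc_mcs unfolding acc_def by blast
  show "(w, w) \<in> acc N" if "mcs w" for w using that by (simp add: acc_iff)
  show "(v, w) \<in> acc N" if "(w, v) \<in> acc N" for w v using that by (simp add: acc_iff)
  show "equiv {w. mcs w} (acc N)"
  proof (rule equivI)
    show "acc N \<subseteq> {w. mcs w} \<times> {w. mcs w}" using acc_mcs by auto
    show "refl_on {w. mcs w} (acc N)" by (simp add: refl_on_def acc_iff)
    show "sym (acc N)" by (simp add: sym_def acc_iff)
    show "trans (acc N)" by (simp add: trans_def acc_iff)
  qed
qed

lemma S5_Box: "S5_axioms Box \<subseteq> axioms_R'"
  by (rule subsetI) (rule axioms_R'.S5_Box)

lemma S5_Stit: "S5_axioms (Stit \<alpha>) \<subseteq> axioms_R'"
  by (rule subsetI) (rule axioms_R'.S5_Stit)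

lemma S5_Know: "S5_axioms (Know \<alpha>) \<subseteq> axioms_R'"
  by (rule subsetI) (rule axioms_R'.S5_Know)

lemmas Box_iff = acc_S5_iff[OF normal_Box S5_Box]
lemmas Know_iff = acc_S5_iff[OF normal_Know S5_Know]
lemmas acc_Box_equiv = acc_S5_equiv[OF normal_Box S5_Box]
lemmas acc_Stit_equiv = acc_S5_equiv[OF normal_Stit S5_Stit]
lemmas acc_Know_equiv = acc_S5_equiv[OF normal_Know S5_Know]

lemmas acc_Box_refl = acc_S5_refl[OF normal_Box S5_Box]
lemmas acc_Stit_refl = acc_S5_refl[OF normal_Stit S5_Stit]
lemmas acc_Know_refl = acc_S5_refl[OF normal_Know S5_Know]
lemmas acc_Box_sym = acc_S5_sym[OF normal_Box S5_Box]
lemmas acc_Know_sym = acc_S5_sym[OF normal_Know S5_Know]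

lemma Stit_T: "mcs w \<Longrightarrow> Stit \<alpha> \<phi> \<in> w \<Longrightarrow> \<phi> \<in> w"
  by (rule accD[OF acc_Stit_refl])

lemma Know_T: "mcs w \<Longrightarrow> Know \<alpha> \<phi> \<in> w \<Longrightarrow> \<phi> \<in> w"
  by (rule accD[OF acc_Know_refl])

lemma acc_Box_iff: "(w, v) \<in> acc Box \<longleftrightarrow> mcs w \<and> mcs v \<and> (\<forall>\<phi>. Box \<phi> \<in> w \<longleftrightarrow> Box \<phi> \<in> v)"
proof
  assume *: "mcs w \<and> mcs v \<and> (\<forall>\<phi>. Box \<phi> \<in> w \<longleftrightarrow> Box \<phi> \<in> v)"
  have "(v, v) \<in> acc Box" using acc_Box_refl * by blast
  then show "(w, v) \<in> acc Box" using * unfolding acc_def by blast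
qed (use Box_iff acc_mcs in blast)

lemma Dia_in_mcs: "mcs w \<Longrightarrow> (w, v) \<in> acc Box \<Longrightarrow> \<phi> \<in> v \<Longrightarrow> Dia \<phi> \<in> w"
  using accD acc_mcs mcs_Neg by metis

section \<open>Inclusions and confluence of the canonical relations\<close>

lemma acc_mono: "(\<And>w \<phi>. mcs w \<Longrightarrow> N \<phi> \<in> w \<Longrightarrow> N' \<phi> \<in> w) \<Longrightarrow> acc N' \<subseteq> acc N"
  unfolding acc_def by auto

lemma acc_Stit_Box: "acc (Stit \<alpha>) \<subseteq> acc Box"
  by (rule acc_mono) (rule mcs_axiom[OF _ axioms_R'.Box_Stit])

lemma acc_Stit_Know: "acc (Stit \<alpha>) \<subseteq> acc (Know \<alpha>)"
  by (rule acc_mono) (rule mcs_axiom[OF _ axioms_R'.Know_Stit])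

text \<open>The world sought is a common successor of \<open>w'\<close> and \<open>v\<close>. The
  axiom \<open>Unif\<close> excludes a conflict: \<open>Dia (Know \<alpha> \<phi>)\<close> holds at
  \<open>w\<close>, hence \<open>Dia \<phi>\<close> holds at \<open>v\<close>, where the conflict
  would give \<open>Box (Neg \<phi>)\<close>.\<close>

lemma acc_uniformity:
  assumes wv: "(w, v) \<in> acc (Know \<alpha>)" and ww': "(w, w') \<in> acc Box"
  shows "\<exists>v'. (v, v') \<in> acc Box \<and> (w', v') \<in> acc (Know \<alpha>)"
proof -
  have m: "mcs w" "mcs v" "mcs w'" using wv ww' acc_mcs by blast+
  obtain v' where "(w', v') \<in> acc (Know \<alpha>)" "(v, v') \<in> acc Box"
  proof (rule acc_join[OF normal_Know m(3) normal_Box m(2)])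
    fix \<phi> \<psi> assume \<phi>: "Know \<alpha> \<phi> \<in> w'" and \<psi>: "Box \<psi> \<in> v"
    show "\<not> derivable_R' (Imp \<phi> (Neg \<psi>))"
    proof
      assume der: "derivable_R' (Imp \<phi> (Neg \<psi>))"
      have "Dia (Know \<alpha> \<phi>) \<in> w" using Dia_in_mcs m(1) ww' \<phi> by blast
      then have "Know \<alpha> (Dia \<phi>) \<in> w" using mcs_axiom[OF m(1) axioms_R'.Unif] by blast
      then have "Dia \<phi> \<in> v" using accD[OF wv] by blast
      moreover have "derivable_R' (Imp \<psi> (Neg \<phi>))"
        by (rule derivable_consequence[of "[Imp \<phi> (Neg \<psi>)]"]) (use der in auto)
      then have "Box (Neg \<phi>) \<in> v" using normal_mono[OF normal_Box m(2)] \<psi> by blast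
      ultimately show False using mcs_Neg m(2) by blast
    qed
  qed
  then show ?thesis by blast
qed

text \<open>The composition is the canonical relation of the compound modality K Box. The
  intermediate world is a common successor of \<open>w\<close> and \<open>v\<close>, with the second
  step reversed by symmetry.\<close>

lemma acc_KBox:
  assumes "mcs w" "mcs v" and *: "\<And>\<phi>. Know \<alpha> (Box \<phi>) \<in> w \<Longrightarrow> \<phi> \<in> v"
  shows "(w, v) \<in> acc (Know \<alpha>) O acc Box"
proof -
  obtain u where "(w, u) \<in> acc (Know \<alpha>)" "(v, u) \<in> acc Box"
  proof (rule acc_join[OF normal_Know assms(1) normal_Box assms(2)])
    fix \<phi> \<psi> assume \<phi>: "Know \<alpha> \<phi> \<in> w" and \<psi>: "Box \<psi> \<in> v"
    show "\<not> derivable_R' (Imp \<phi> (Neg \<psi>))"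
    proof
      assume der: "derivable_R' (Imp \<phi> (Neg \<psi>))"
      have T: "derivable_R' (Imp (Box \<psi>) \<psi>)" and 5: "derivable_R' (Imp (Neg (Box \<psi>)) (Box (Neg (Box \<psi>))))"
        using S5_Box by (auto simp: S5_axioms_def intro!: derivable_from.ax)
      \<comment> \<open>If \<psi> is false, so is \<open>Box \<psi>\<close>, and necessarily so by
        axiom 5. This puts a Box under the K, so that the hypothesis on \<open>v\<close>
        applies.\<close>
      have "derivable_R' (Imp \<phi> (Box (Neg (Box \<psi>))))"
        by (rule derivable_consequence[of "[Imp \<phi> (Neg \<psi>), Imp (Box \<psi>) \<psi>,
          Imp (Neg (Box \<psi>)) (Box (Neg (Box \<psi>)))]"]) (use der T 5 in auto)
      then have "Neg (Box \<psi>) \<in> v" using normal_mono[OF normal_Know assms(1)] \<phi> * by blast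
      then show False using mcs_Neg assms(2) \<psi> by blast
    qed
  qed
  then show ?thesis using acc_Box_sym by blast
qed

lemma acc_Ought_Box: "acc (Ought \<alpha>) \<subseteq> acc Box"
  by (rule acc_mono) (rule mcs_axiom[OF _ axioms_R'.Box_Ought])

lemma acc_SOught_KBox: "acc (SOught \<alpha>) \<subseteq> acc (Know \<alpha>) O acc Box"
proof safe
  fix w v assume "(w, v) \<in> acc (SOught \<alpha>)"
  then show "(w, v) \<in> acc (Know \<alpha>) O acc Box"
    using acc_KBox mcs_axiom[OF _ axioms_R'.KBox_SOught] acc_mcs accD by metis
qed

text \<open>The axiom \<open>BoxK_Bel\<close> has Box K where \<open>acc_KBox\<close> asks for K
  Box. The order is exchanged semantically, by confluence of the canonical relations.\<close>

lemma acc_Bel_KBox: "acc (Bel \<alpha>) \<subseteq> acc (Know \<alpha>) O acc Box"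
proof safe
  fix w v assume wv: "(w, v) \<in> acc (Bel \<alpha>)"
  have m: "mcs w" "mcs v" using acc_mcs[OF wv] by blast+
  show "(w, v) \<in> acc (Know \<alpha>) O acc Box"
  proof (rule acc_KBox[OF m])
    fix \<phi> assume K: "Know \<alpha> (Box \<phi>) \<in> w"
    have "Box (Know \<alpha> \<phi>) \<in> w"
    proof (rule ccontr)
      assume "Box (Know \<alpha> \<phi>) \<notin> w"
      then obtain u where u: "(w, u) \<in> acc Box" "Know \<alpha> \<phi> \<notin> u" using acc_ex[OF normal_Box m(1)] by blast
      then obtain x where x: "(u, x) \<in> acc (Know \<alpha>)" "\<phi> \<notin> x" using acc_ex[OF normal_Know] acc_mcs by metis
      have "(x, u) \<in> acc (Know \<alpha>)" by (rule acc_Know_sym[OF x(1)])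
      then obtain k where k: "(w, k) \<in> acc (Know \<alpha>)" "(x, k) \<in> acc Box"
        using acc_uniformity[OF _ acc_Box_sym[OF u(1)], of x \<alpha>] x(1) by blast
      then have "\<phi> \<in> x" using K accD acc_Box_sym by blast
      then show False using x(2) by blast
    qed
    then show "\<phi> \<in> v" using mcs_axiom[OF m(1) axioms_R'.BoxK_Bel] accD[OF wv] by blast
  qed
qed

text \<open>\<open>mcs_join\<close> treats two sets, but here there is one per agent. Conjoining
  formulas under each \<open>Stit\<close> reduces finitely many premises to one formula per agent,
  which is the shape of the axiom \<open>indep\<close>.\<close>

lemma mcs_independence:
  fixes u :: "'a::finite \<Rightarrow> ('p, 'a) fm set"
  assumes wu: "\<And>\<alpha>. (w, u \<alpha>) \<in> acc Box"
  shows "\<exists>x. \<forall>\<alpha>. (u \<alpha>, x) \<in> acc (Stit \<alpha>)"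
proof -
  have m: "mcs w" "mcs (u \<alpha>)" for \<alpha> using acc_mcs wu by blast+
  let ?\<Gamma> = "\<Union>\<alpha>. {Stit \<alpha> \<phi> |\<phi>. Stit \<alpha> \<phi> \<in> u \<alpha>}"
  \<comment> \<open>A list of all agents is nonempty, which keeps the conjunction away from
    \<open>BigConj []\<close>.\<close>
  obtain as :: "'a list" where as: "set as = UNIV" "distinct as"
    using finite_distinct_list[of "UNIV :: 'a set"] by auto
  have "as \<noteq> []" using as(1) by auto
  have mono: "derivable_R' (Imp (Stit \<alpha> (Conj \<phi> \<psi>)) (Stit \<alpha> \<phi>))"
       "derivable_R' (Imp (Stit \<alpha> (Conj \<phi> \<psi>)) (Stit \<alpha> \<psi>))" for \<alpha> :: 'a and \<phi> \<psi> :: "('p, 'a) fm"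
    by (rule derivable_mono[OF normal_Stit], rule derivable_tautology, simp)+
  have collect: "\<exists>f. (\<forall>\<alpha>. Stit \<alpha> (f \<alpha>) \<in> u \<alpha>) \<and> (\<forall>\<psi>\<in>set \<psi>s. \<exists>\<alpha>. derivable_R' (Imp (Stit \<alpha> (f \<alpha>)) \<psi>))"
    if "set \<psi>s \<subseteq> ?\<Gamma>" for \<psi>s
    using that
  proof (induction \<psi>s)
    case Nil
    have "\<forall>\<alpha>. \<exists>\<phi>. Stit \<alpha> \<phi> \<in> u \<alpha>" using normal_nonempty[OF normal_Stit m(2)] by blast
    then show ?case by (simp add: choice_iff)
  next
    case (Cons \<psi> \<psi>s)
    then have "\<exists>f. (\<forall>\<alpha>. Stit \<alpha> (f \<alpha>) \<in> u \<alpha>) \<and> (\<forall>\<psi>\<in>set \<psi>s. \<exists>\<alpha>. derivable_R' (Imp (Stit \<alpha> (f \<alpha>)) \<psi>))"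
      by simp
    then obtain f where f: "\<And>\<alpha>. Stit \<alpha> (f \<alpha>) \<in> u \<alpha>"
      "\<And>\<psi>. \<psi> \<in> set \<psi>s \<Longrightarrow> \<exists>\<alpha>. derivable_R' (Imp (Stit \<alpha> (f \<alpha>)) \<psi>)" by blast
    obtain \<beta> \<phi> where \<psi>: "\<psi> = Stit \<beta> \<phi>" "Stit \<beta> \<phi> \<in> u \<beta>" using Cons.prems by auto
    \<comment> \<open>Only the formula of \<beta> becomes stronger, so the implications found
      earlier survive.\<close>
    define g where "g = f(\<beta> := Conj (f \<beta>) \<phi>)"
    have gf: "derivable_R' (Imp (Stit \<alpha> (g \<alpha>)) (Stit \<alpha> (f \<alpha>)))" for \<alpha>
      using mono(1) by (auto simp: g_def intro: derivable_tautology)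
    have "Stit \<alpha> (g \<alpha>) \<in> u \<alpha>" for \<alpha>
      using f(1) \<psi>(2) normal_Conj[OF normal_Stit m(2)] by (simp add: g_def)
    moreover have "\<exists>\<alpha>. derivable_R' (Imp (Stit \<alpha> (g \<alpha>)) \<chi>)" if \<chi>: "\<chi> \<in> set (\<psi> # \<psi>s)" for \<chi>
    proof (cases "\<chi> = \<psi>")
      case True
      then show ?thesis using mono(2)[of \<beta> "f \<beta>" \<phi>] \<psi> by (intro exI[of _ \<beta>]) (simp add: g_def)
    next
      case False
      then obtain \<alpha> where \<alpha>: "derivable_R' (Imp (Stit \<alpha> (f \<alpha>)) \<chi>)" using f(2) \<chi> by auto
      have "derivable_R' (Imp (Stit \<alpha> (g \<alpha>)) \<chi>)"
        by (rule derivable_consequence[of "[Imp (Stit \<alpha> (g \<alpha>)) (Stit \<alpha> (f \<alpha>)), Imp (Stit \<alpha> (f \<alpha>)) \<chi>]"])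
          (use \<alpha> gf in auto)
      then show ?thesis by blast
    qed
    ultimately show ?case by blast
  qed
  have "consistent ?\<Gamma>"
  proof (rule ccontr)
    assume "\<not> consistent ?\<Gamma>"
    moreover obtain \<theta> :: "('p, 'a) fm" where \<theta>: "\<And>v. \<not> prop_eval v \<theta>"
      using prop_eval.simps(2,3) by blast
    ultimately obtain \<psi>s where \<psi>s: "set \<psi>s \<subseteq> ?\<Gamma>" "derivable_R' (imps \<psi>s \<theta>)"
      unfolding consistent_def entails_def by blast
    obtain f where f: "\<And>\<alpha>. Stit \<alpha> (f \<alpha>) \<in> u \<alpha>"
      "\<And>\<psi>. \<psi> \<in> set \<psi>s \<Longrightarrow> \<exists>\<alpha>. derivable_R' (Imp (Stit \<alpha> (f \<alpha>)) \<psi>)" using collect[OF \<psi>s(1)] by blast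
    define ps where "ps = map (\<lambda>\<alpha>. (\<alpha>, f \<alpha>)) as"
    have ps: "ps \<noteq> []" "distinct (map fst ps)" using as \<open>as \<noteq> []\<close> by (simp_all add: ps_def comp_def)
    have st: "map (\<lambda>(\<alpha>, \<phi>). Stit \<alpha> \<phi>) ps = map (\<lambda>\<alpha>. Stit \<alpha> (f \<alpha>)) as" by (simp add: ps_def)
    have "Dia (Stit \<alpha> (f \<alpha>)) \<in> w" for \<alpha> using Dia_in_mcs[OF m(1) wu f(1)] .
    then have "BigConj (map (\<lambda>(\<alpha>, \<phi>). Dia (Stit \<alpha> \<phi>)) ps) \<in> w"
      using mcs_BigConj[OF m(1)] ps(1) by (auto simp: ps_def)
    then have "Dia (BigConj (map (\<lambda>\<alpha>. Stit \<alpha> (f \<alpha>)) as)) \<in> w"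
      using mcs_axiom[OF m(1) axioms_R'.indep[OF ps]] unfolding st by blast
    \<comment> \<open>A world satisfying the conjunction would contain all of \<open>\<psi>s\<close>
      and therefore \<open>\<theta>\<close>, the contradiction that stands in for falsum.\<close>
    moreover have "Box (Neg (BigConj (map (\<lambda>\<alpha>. Stit \<alpha> (f \<alpha>)) as))) \<in> w"
    proof (rule ccontr)
      assume "Box (Neg (BigConj (map (\<lambda>\<alpha>. Stit \<alpha> (f \<alpha>)) as))) \<notin> w"
      then obtain v where v: "mcs v" "BigConj (map (\<lambda>\<alpha>. Stit \<alpha> (f \<alpha>)) as) \<in> v"
        using acc_ex[OF normal_Box m(1)] mcs_Neg acc_mcs by metis
      then have "Stit \<alpha> (f \<alpha>) \<in> v" for \<alpha> using mcs_BigConj[OF v(1)] \<open>as \<noteq> []\<close> as(1) by auto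
      then have "\<psi> \<in> v" if "\<psi> \<in> set \<psi>s" for \<psi>
        using f(2)[OF that] mcs_derivable[OF v(1)] mcs_Imp[OF v(1)] by blast
      then have "entails v \<theta>" unfolding entails_def using \<psi>s(2) by blast
      then have "\<theta> \<in> v" by (rule mcs_entails[OF v(1)])
      moreover have "Neg \<theta> \<in> v" using \<theta> by (intro mcs_derivable[OF v(1)] derivable_tautology) simp
      ultimately show False using mcs_Neg[OF v(1)] by blast
    qed
    ultimately show False using mcs_Neg[OF m(1)] by blast
  qed
  then obtain x where x: "?\<Gamma> \<subseteq> x" "mcs x" by (rule lindenbaum)
  have "(u \<alpha>, x) \<in> acc (Stit \<alpha>)" for \<alpha>
  proof -
    \<comment> \<open>Reflexivity strips the operator from the formulas
      \<open>Stit \<alpha> \<phi>\<close> put into \<open>x\<close>.\<close>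
    have "(x, x) \<in> acc (Stit \<alpha>)" by (rule acc_Stit_refl[OF x(2)])
    then show ?thesis using x m unfolding acc_def by blast
  qed
  then show ?thesis by blast
qed

subsection \<open>The canonical model\<close>

text \<open>Being a property of one world, it fits the parameters \<open>Opt\<close>,
  \<open>SOpt\<close> and \<open>Comp\<close>. For \<open>Bel \<alpha>\<close> it singles out the
  worlds where all beliefs of \<alpha> are true.\<close>

definition fulfils :: "(('p, 'a) fm \<Rightarrow> ('p, 'a) fm) \<Rightarrow> ('p, 'a) fm set \<Rightarrow> bool" where
  "fulfils N w \<longleftrightarrow> (\<forall>\<phi>. N \<phi> \<in> w \<longrightarrow> \<phi> \<in> w)"

text \<open>Lacking a falsum, the D condition is phrased with all refutable formulas; a
  contradiction then serves as the formula that is not necessary.\<close>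

lemma acc_serial:
  fixes w :: "('p, 'a) fm set"
  assumes "normal N" "mcs w" and D: "\<And>\<phi>. derivable_R' (Neg \<phi>) \<Longrightarrow> N \<phi> \<notin> w"
  obtains v where "(w, v) \<in> acc N"
proof -
  have "derivable_R' (Neg (Conj \<phi> (Neg \<phi>)))" for \<phi> :: "('p, 'a) fm"
    by (rule derivable_tautology) auto
  then show ?thesis using acc_ex[OF assms(1,2) D] that by metis
qed

text \<open>When \<open>N\<close> formulas are constant along \<open>r\<close>, what
  \<open>w\<close> demands of \<open>v\<close> is what \<open>v\<close> demands of itself, and the
  relation splits into \<open>r\<close> and a property of the target.\<close>

lemma acc_iff_fulfils:
  assumes sub: "acc N \<subseteq> r" and r: "\<And>w v. (w, v) \<in> r \<Longrightarrow> mcs w \<and> mcs v"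
    and iff: "\<And>w v \<phi>. (w, v) \<in> r \<Longrightarrow> N \<phi> \<in> w \<longleftrightarrow> N \<phi> \<in> v"
  shows "(w, v) \<in> acc N \<longleftrightarrow> (w, v) \<in> r \<and> fulfils N v"
proof (cases "(w, v) \<in> r")
  case True
  then show ?thesis using r[OF True] iff[OF True] by (simp add: acc_def fulfils_def)
qed (use sub in blast)

lemma Ought_iff: 
  assumes "(w, v) \<in> acc Box"
  shows "Ought \<alpha> \<phi> \<in> w \<longleftrightarrow> Ought \<alpha> \<phi> \<in> v"
  using assms acc_Box_sym[OF assms] mcs_axiom[OF _ axioms_R'.Ought_Box] acc_mcs accD by metis

text \<open>Backwards, confluence yields a route from \<open>v\<close> to \<open>w\<close> that
  again takes a K step first and a Box step second, so that \<open>inv\<close> can be used at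
  \<open>v\<close>.\<close>

lemma KBox_invariant:
  assumes inv: "\<And>w. mcs w \<Longrightarrow> \<phi> \<in> w \<Longrightarrow> Know \<alpha> (Box \<phi>) \<in> w"
    and wv: "(w, v) \<in> acc (Know \<alpha>) O acc Box"
  shows "\<phi> \<in> w \<longleftrightarrow> \<phi> \<in> v"
proof -
  obtain u where u: "(w, u) \<in> acc (Know \<alpha>)" "(u, v) \<in> acc Box" using wv by blast
  have sym: "(u, w) \<in> acc (Know \<alpha>)" by (rule acc_Know_sym[OF u(1)])
  obtain u' where u': "(w, u') \<in> acc Box" "(v, u') \<in> acc (Know \<alpha>)"
    using acc_uniformity[OF sym u(2)] by blast
  have m: "mcs w" "mcs v" using u acc_mcs by blast+
  show ?thesis
  proof
    assume "\<phi> \<in> w"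
    then show "\<phi> \<in> v" using inv[OF m(1)] accD[OF u(1)] accD[OF u(2)] by blast
  next
    assume "\<phi> \<in> v"
    then show "\<phi> \<in> w" using inv[OF m(2)] accD[OF u'(2)] accD[OF acc_Box_sym[OF u'(1)]] by blast
  qed
qed

lemma SOught_iff:
  assumes "(w, v) \<in> acc (Know \<alpha>) O acc Box"
  shows "SOught \<alpha> \<phi> \<in> w \<longleftrightarrow> SOught \<alpha> \<phi> \<in> v"
  by (rule KBox_invariant[OF _ assms]) (rule mcs_axiom[OF _ axioms_R'.SOught_KBox])

text \<open>The axiom \<open>Bel_BoxK\<close> gives Box K where K Box is wanted; as for
  \<open>acc_Bel_KBox\<close>, confluence makes up the difference.\<close>

lemma Bel_iff:
  assumes "(w, v) \<in> acc (Know \<alpha>) O acc Box"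
  shows "Bel \<alpha> \<phi> \<in> w \<longleftrightarrow> Bel \<alpha> \<phi> \<in> v"
proof (rule KBox_invariant[OF _ assms])
  fix w assume m: "mcs w" and B: "Bel \<alpha> \<phi> \<in> w"
  show "Know \<alpha> (Box (Bel \<alpha> \<phi>)) \<in> w"
  proof (rule ccontr)
    assume "Know \<alpha> (Box (Bel \<alpha> \<phi>)) \<notin> w"
    then obtain u where u: "(w, u) \<in> acc (Know \<alpha>)" "Box (Bel \<alpha> \<phi>) \<notin> u"
      using acc_ex[OF normal_Know m] by blast
    then obtain v where v: "(u, v) \<in> acc Box" "Bel \<alpha> \<phi> \<notin> v" using acc_ex[OF normal_Box] acc_mcs by metis
    have sym: "(u, w) \<in> acc (Know \<alpha>)" by (rule acc_Know_sym[OF u(1)])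
    obtain x where x: "(w, x) \<in> acc Box" "(v, x) \<in> acc (Know \<alpha>)"
      using acc_uniformity[OF sym v(1)] by blast
    have "Know \<alpha> (Bel \<alpha> \<phi>) \<in> x" using mcs_axiom[OF m axioms_R'.Bel_BoxK B] accD[OF x(1)] by blast
    then have "Know \<alpha> (Bel \<alpha> \<phi>) \<in> v" using Know_iff[OF x(2)] by blast
    then have "Bel \<alpha> \<phi> \<in> v" using acc_mcs[OF v(1)] by (metis Know_T)
    then show False using v(2) by blast
  qed
qed

section \<open>Worlds and moments as sets of numbers\<close>

definition canonical_point :: "('p::countable, 'a::finite) fm set \<Rightarrow> universe" where
  "canonical_point w = Suc ` to_nat ` w"

text \<open>Worlds are Box-related exactly if they have the same Box formulas, so these encode the
  class. The shift by \<open>Suc\<close> frees 0 as a tag that sets moments apart from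
  points.\<close>

definition canonical_moment :: "('p::countable, 'a::finite) fm set \<Rightarrow> universe" where
  "canonical_moment w = insert 0 (Suc ` to_nat ` {\<phi>. Box \<phi> \<in> w})"

lemma to_nat_image_eq: "to_nat ` A = to_nat ` B \<longleftrightarrow> A = B"
  by (simp add: inj_image_eq_iff)

lemma acc_KBox_mcs: "(w, v) \<in> acc (Know \<alpha>) O acc Box \<Longrightarrow> mcs w \<and> mcs v"
  using acc_mcs by blast

lemma acc_Ought_iff: "(w, v) \<in> acc (Ought \<alpha>) \<longleftrightarrow> (w, v) \<in> acc Box \<and> fulfils (Ought \<alpha>) v"
  by (rule acc_iff_fulfils[OF acc_Ought_Box]) (erule acc_mcs, erule Ought_iff)

lemma acc_SOught_iff: "(w, v) \<in> acc (SOught \<alpha>) \<longleftrightarrow> (w, v) \<in> acc (Know \<alpha>) O acc Box \<and> fulfils (SOught \<alpha>) v"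
  by (rule acc_iff_fulfils[OF acc_SOught_KBox]) (erule acc_KBox_mcs, erule SOught_iff)

lemma acc_Bel_iff: "(w, v) \<in> acc (Bel \<alpha>) \<longleftrightarrow> (w, v) \<in> acc (Know \<alpha>) O acc Box \<and> fulfils (Bel \<alpha>) v"
  by (rule acc_iff_fulfils[OF acc_Bel_KBox]) (erule acc_KBox_mcs, erule Bel_iff)

lemma Dia_witness:
  assumes "mcs w" "Dia \<phi> \<in> w"
  obtains v where "(w, v) \<in> acc Box" "\<phi> \<in> v"
proof -
  have "Box (Neg \<phi>) \<notin> w" using assms mcs_Neg by blast
  then show ?thesis using acc_ex[OF normal_Box assms(1)] that mcs_Neg acc_mcs by metis
qed

lemma Dia_derivable_Neg:
  assumes "mcs w" "derivable_R' (Neg \<phi>)" and "\<And>v. mcs v \<Longrightarrow> \<psi> \<in> v \<Longrightarrow> \<phi> \<in> v"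
  shows "Dia \<psi> \<notin> w"
proof
  assume "Dia \<psi> \<in> w"
  then obtain v where v: "(w, v) \<in> acc Box" "\<psi> \<in> v" using Dia_witness assms(1) by blast
  then show False using assms(2,3) mcs_derivable mcs_Neg acc_mcs by metis
qed

text \<open>Ought implies can: an obligation to something refutable would make that thing hold at
  some world.\<close>

lemma fulfils_Ought_ex:
  assumes w: "mcs w"
  shows "\<exists>v. (w, v) \<in> acc Box \<and> fulfils (Ought \<alpha>) v"
proof -
  have "Ought \<alpha> \<phi> \<notin> w" if "derivable_R' (Neg \<phi>)" for \<phi>
  proof
    assume "Ought \<alpha> \<phi> \<in> w"
    then have "Dia (Stit \<alpha> \<phi>) \<in> w" by (rule mcs_axiom[OF w axioms_R'.Ought_Can])
    moreover have "Dia (Stit \<alpha> \<phi>) \<notin> w" by (rule Dia_derivable_Neg[OF w that]) (rule Stit_T)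
    ultimately show False by blast
  qed
  then obtain v where "(w, v) \<in> acc (Ought \<alpha>)" by (rule acc_serial[OF normal_Ought w])
  then show ?thesis unfolding acc_Ought_iff by (rule exI)
qed

text \<open>An obligation at \<open>v\<close> is one at \<open>w\<close>, where by
  \<open>SOught_Know\<close> it is an obligation to know; as \<open>w\<close> meets it, the content
  holds throughout the information class.\<close>

lemma fulfils_SOught_Know:
  assumes wv: "(w, v) \<in> acc (Know \<alpha>)" and w: "fulfils (SOught \<alpha>) w"
  shows "fulfils (SOught \<alpha>) v"
  unfolding fulfils_def
proof (intro allI impI)
  have "(v, v) \<in> acc Box" using acc_Box_refl acc_mcs[OF wv] by blast
  then have "(w, v) \<in> acc (Know \<alpha>) O acc Box" using wv by blast
  then have iff: "SOught \<alpha> \<phi> \<in> w \<longleftrightarrow> SOught \<alpha> \<phi> \<in> v" for \<phi> by (rule SOught_iff)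
  fix \<phi> assume "SOught \<alpha> \<phi> \<in> v"
  then have "SOught \<alpha> \<phi> \<in> w" unfolding iff .
  then have "SOught \<alpha> (Know \<alpha> \<phi>) \<in> w"
    by (rule mcs_axiom[OF conjunct1[OF acc_mcs[OF wv]] axioms_R'.SOught_Know])
  then show "\<phi> \<in> v" using w accD[OF wv] unfolding fulfils_def by blast
qed

lemma fulfils_SOught_ex:
  assumes w: "mcs w"
  shows "\<exists>v. (w, v) \<in> acc Box \<and> fulfils (SOught \<alpha>) v"
proof -
  have "SOught \<alpha> \<phi> \<notin> w" if "derivable_R' (Neg \<phi>)" for \<phi>
  proof
    assume "SOught \<alpha> \<phi> \<in> w"
    then have "Dia (Know \<alpha> \<phi>) \<in> w" by (rule mcs_axiom[OF w axioms_R'.SOught_Can])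
    moreover have "Dia (Know \<alpha> \<phi>) \<notin> w" by (rule Dia_derivable_Neg[OF w that]) (rule Know_T)
    ultimately show False by blast
  qed
  then obtain v where "(w, v) \<in> acc (SOught \<alpha>)" by (rule acc_serial[OF normal_SOught w])
  then have v: "(w, v) \<in> acc (Know \<alpha>) O acc Box" "fulfils (SOught \<alpha>) v" unfolding acc_SOught_iff by simp_all
  then obtain k where k: "(w, k) \<in> acc (Know \<alpha>)" "(k, v) \<in> acc Box" by blast
  have sym: "(k, w) \<in> acc (Know \<alpha>)" by (rule acc_Know_sym[OF k(1)])
  \<comment> \<open>The optimal \<open>v\<close> may belong to another moment. Confluence leads back
    to the moment of \<open>w\<close> without leaving the information class of
    \<open>v\<close>.\<close>
  obtain u where u: "(w, u) \<in> acc Box" "(v, u) \<in> acc (Know \<alpha>)"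
    using acc_uniformity[OF sym k(2)] by blast
  show ?thesis using u(1) fulfils_SOught_Know[OF u(2) v(2)] by (intro exI conjI)
qed

lemma fulfils_Bel_ex:
  assumes w: "mcs w"
  shows "\<exists>v. (w, v) \<in> acc (Know \<alpha>) O acc Box \<and> fulfils (Bel \<alpha>) v"
proof -
  have "Bel \<alpha> \<phi> \<notin> w" if "derivable_R' (Neg \<phi>)" for \<phi>
  proof
    assume B: "Bel \<alpha> \<phi> \<in> w"
    have "Imp (Bel \<alpha> \<phi>) (Neg (Bel \<alpha> (Neg \<phi>))) \<in> axioms_R'"
      by (rule axioms_R'.KD_Bel[of _ \<alpha>]) (simp add: KD_axioms_def)
    then have "Neg (Bel \<alpha> (Neg \<phi>)) \<in> w" using mcs_axiom[OF w _ B] by blast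
    then show False using normal_derivable[OF normal_Bel w that] mcs_Neg[OF w] by blast
  qed
  then obtain v where "(w, v) \<in> acc (Bel \<alpha>)" by (rule acc_serial[OF normal_Bel w])
  then show ?thesis unfolding acc_Bel_iff by (rule exI)
qed

lemma canonical_kripke:
  fixes w0 :: "('p::countable, 'a::finite) fm set"
  assumes "mcs w0"
  shows "kripke {w :: ('p, 'a) fm set. mcs w} (acc Box) (\<lambda>\<alpha>. acc (Stit \<alpha>)) (\<lambda>\<alpha>. acc (Know \<alpha>))
    (\<lambda>\<alpha>. fulfils (Ought \<alpha>)) (\<lambda>\<alpha>. fulfils (SOught \<alpha>)) (\<lambda>\<alpha>. fulfils (Bel \<alpha>))
    canonical_moment canonical_point"
proof
  show "{w :: ('p, 'a) fm set. mcs w} \<noteq> {}" using assms by blast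
  show "equiv {w :: ('p, 'a) fm set. mcs w} (acc Box)" by (rule acc_Box_equiv)
  show "equiv {w :: ('p, 'a) fm set. mcs w} (acc (Stit \<alpha>))" for \<alpha> by (rule acc_Stit_equiv)
  show "equiv {w :: ('p, 'a) fm set. mcs w} (acc (Know \<alpha>))" for \<alpha> by (rule acc_Know_equiv)
  show "acc (Stit \<alpha>) \<subseteq> (acc Box :: (('p, 'a) fm set \<times> _) set)" for \<alpha> by (rule acc_Stit_Box)
  show "acc (Stit \<alpha>) \<subseteq> (acc (Know \<alpha>) :: (('p, 'a) fm set \<times> _) set)" for \<alpha> by (rule acc_Stit_Know)
next
  fix w v w' :: "('p, 'a) fm set" and \<alpha> u
  show "\<exists>x. \<forall>\<alpha>. (u \<alpha>, x) \<in> acc (Stit \<alpha>)" if "\<And>\<alpha>. (w, u \<alpha>) \<in> acc Box"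
    using that by (rule mcs_independence)
  show "\<exists>v'. (v, v') \<in> acc Box \<and> (w', v') \<in> acc (Know \<alpha>)"
    if "(w, v) \<in> acc (Know \<alpha>)" "(w, w') \<in> acc Box"
    using that by (rule acc_uniformity)
  show "fulfils (Ought \<alpha>) v" if wv: "(w, v) \<in> acc (Stit \<alpha>)" and w: "fulfils (Ought \<alpha>) w"
    unfolding fulfils_def
  proof (intro allI impI)
    fix \<phi> assume "Ought \<alpha> \<phi> \<in> v"
    then have "Ought \<alpha> \<phi> \<in> w" unfolding Ought_iff[OF subsetD[OF acc_Stit_Box wv]] .
    then have "Ought \<alpha> (Stit \<alpha> \<phi>) \<in> w"
      by (rule mcs_axiom[OF conjunct1[OF acc_mcs[OF wv]] axioms_R'.Ought_Stit])
    then show "\<phi> \<in> v" using w accD[OF wv] unfolding fulfils_def by blast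
  qed
  show "fulfils (SOught \<alpha>) v" if "(w, v) \<in> acc (Know \<alpha>)" "fulfils (SOught \<alpha>) w"
    using that by (rule fulfils_SOught_Know)
  assume "w \<in> {w. mcs w}"
  then have w: "mcs w" by simp
  show "\<exists>v. (w, v) \<in> acc Box \<and> fulfils (Ought \<alpha>) v" by (rule fulfils_Ought_ex[OF w])
  show "\<exists>v. (w, v) \<in> acc Box \<and> fulfils (SOught \<alpha>) v" by (rule fulfils_SOught_ex[OF w])
  show "\<exists>v. (w, v) \<in> acc (Know \<alpha>) O acc Box \<and> fulfils (Bel \<alpha>) v" by (rule fulfils_Bel_ex[OF w])
  assume "v \<in> {w. mcs w}"
  then have v: "mcs v" by simp
  have Suc: "Suc ` A = Suc ` B \<longleftrightarrow> A = B" "0 \<notin> Suc ` A" for A B by (auto simp: inj_image_eq_iff)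
  have "canonical_moment w = canonical_moment v \<longleftrightarrow>
      to_nat ` {\<phi>. Box \<phi> \<in> w} = to_nat ` {\<phi>. Box \<phi> \<in> v}"
    unfolding canonical_moment_def using Suc by (metis insert_ident)
  then show "canonical_moment w = canonical_moment v \<longleftrightarrow> (w, v) \<in> acc Box"
    unfolding to_nat_image_eq acc_Box_iff using w v by auto
  show "canonical_point w = canonical_point v \<longleftrightarrow> w = v"
    unfolding canonical_point_def Suc to_nat_image_eq ..
  show "canonical_moment w \<noteq> canonical_point v"
    unfolding canonical_moment_def canonical_point_def using Suc(2) by blast
qed

lemma acc_iff: "normal N \<Longrightarrow> mcs w \<Longrightarrow> N \<phi> \<in> w \<longleftrightarrow> (\<forall>v. (w, v) \<in> acc N \<longrightarrow> \<phi> \<in> v)"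
  using acc_ex accD by metis

lemma completeness:
  fixes \<phi> :: "('p::countable, 'a::finite) fm"
  assumes "valid_over TYPE(universe) \<phi>"
  shows "derivable_R' \<phi>"
proof (rule ccontr)
  assume nd: "\<not> derivable_R' \<phi>"
  have "\<not> entails {Neg \<phi>} \<phi>"
  proof
    assume "entails {Neg \<phi>} \<phi>"
    then obtain \<psi>s where \<psi>s: "set \<psi>s \<subseteq> {Neg \<phi>}" "derivable_R' (imps \<psi>s \<phi>)" unfolding entails_def by blast
    have "derivable_R' \<phi>"
      by (rule derivable_consequence[of "[imps \<psi>s \<phi>]"]) (use \<psi>s in \<open>auto simp: prop_eval_imps\<close>)
    then show False using nd by blast
  qed
  then obtain w0 where "{Neg \<phi>} \<subseteq> w0" "mcs w0" using lindenbaum unfolding consistent_def by metis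
  then have w0: "mcs w0" "\<phi> \<notin> w0" using mcs_Neg by blast+
  interpret kripke "{w :: ('p, 'a) fm set. mcs w}" "acc Box" "\<lambda>\<alpha>. acc (Stit \<alpha>)" "\<lambda>\<alpha>. acc (Know \<alpha>)"
    "\<lambda>\<alpha>. fulfils (Ought \<alpha>)" "\<lambda>\<alpha>. fulfils (SOught \<alpha>)" "\<lambda>\<alpha>. fulfils (Bel \<alpha>)" "\<lambda>p. {w. Atom p \<in> w}"
    canonical_moment canonical_point
    by (rule canonical_kripke[OF w0(1)])
  \<comment> \<open>Once the cut-down relations are recognised as canonical ones, this single
    argument covers all six modal cases.\<close>
  have step: "(\<forall>v. (w, v) \<in> acc N \<longrightarrow> ksat v \<psi>) \<longleftrightarrow> N \<psi> \<in> w"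
    if "normal N" "mcs w" and IH: "\<And>v. mcs v \<Longrightarrow> ksat v \<psi> \<longleftrightarrow> \<psi> \<in> v" for N w \<psi>
  proof -
    have "ksat v \<psi> \<longleftrightarrow> \<psi> \<in> v" if "(w, v) \<in> acc N" for v using IH acc_mcs[OF that] by simp
    then show ?thesis unfolding acc_iff[OF that(1,2)] by simp
  qed
  have truth: "ksat w \<psi> \<longleftrightarrow> \<psi> \<in> w" if "mcs w" for w \<psi>
    using that
  proof (induction \<psi> arbitrary: w)
    case (Box \<psi>)
    then show ?case using step[OF normal_Box] by simp
  next
    case (Stit \<alpha> \<psi>)
    then show ?case using step[OF normal_Stit] by simp
  next
    case (Know \<alpha> \<psi>)
    then show ?case using step[OF normal_Know] by simp
  next
    case (Bel \<alpha> \<psi>)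
    have "ksat w (Bel \<alpha> \<psi>) \<longleftrightarrow> (\<forall>v. (w, v) \<in> acc (Bel \<alpha>) \<longrightarrow> ksat v \<psi>)"
      unfolding ksat.simps acc_Bel_iff by blast
    also have "\<dots> \<longleftrightarrow> Bel \<alpha> \<psi> \<in> w" by (rule step[OF normal_Bel Bel(2,1)])
    finally show ?case .
  next
    case (Ought \<alpha> \<psi>)
    have "ksat w (Ought \<alpha> \<psi>) \<longleftrightarrow> (\<forall>v. (w, v) \<in> acc (Ought \<alpha>) \<longrightarrow> ksat v \<psi>)"
      unfolding ksat.simps acc_Ought_iff by blast
    also have "\<dots> \<longleftrightarrow> Ought \<alpha> \<psi> \<in> w" by (rule step[OF normal_Ought Ought(2,1)])
    finally show ?case .
  next
    case (SOught \<alpha> \<psi>)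
    have "ksat w (SOught \<alpha> \<psi>) \<longleftrightarrow> (\<forall>v. (w, v) \<in> acc (SOught \<alpha>) \<longrightarrow> ksat v \<psi>)"
      unfolding ksat.simps acc_SOught_iff by blast
    also have "\<dots> \<longleftrightarrow> SOught \<alpha> \<psi> \<in> w" by (rule step[OF normal_SOught SOught(2,1)])
    finally show ?case .
  qed (simp_all add: mcs_Neg mcs_Conj)
  have "(canonical_moment w0, hist w0) \<in> indices tree" using indices_tree w0(1) by blast
  then have "sat tree (canonical_moment w0) (hist w0) \<phi>"
    using assms kiobt_model_tree unfolding valid_over_def by blast
  then have "\<phi> \<in> w0" using sat_tree truth w0(1) by blast
  then show False using w0(2) by blast
qed

lemma derivable_valid_over: "derivable_R' \<phi> \<Longrightarrow> valid_over TYPE('m) \<phi>"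
  by (auto simp: valid_over_def indices_def intro: soundness)

text \<open>The free type \<open>'m\<close> expresses soundness for moments of any type; for the
  converse, validity over the one type that hosts the canonical tree suffices.\<close>

theorem mainTheorem2:
  fixes \<phi> :: "('p::countable, 'a::finite) fm"
  shows "(derivable_R' \<phi> \<longrightarrow> valid_over TYPE('m) \<phi>) \<and>
         (derivable_R' \<phi> \<longleftrightarrow> valid_over TYPE(universe) \<phi>)"
proof (intro conjI impI iffI)
  show "valid_over TYPE('m) \<phi>" if "derivable_R' \<phi>" using that by (rule derivable_valid_over)
  show "valid_over TYPE(universe) \<phi>" if "derivable_R' \<phi>" using that by (rule derivable_valid_over)
  show "derivable_R' \<phi>" if "valid_over TYPE(universe) \<phi>" using that by (rule completeness)
qed

end
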